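(* Let $k$ be an algebraically closed field of characteristic $p=2$, and let $B$ be a Borel subgroup of $SL_2$ over $k$, with first Frobenius kernel $B_1$. Then, as a $k$-algebra and as a $T/T_1$-module, $$\operatorname{HH}^{\bullet}(B_{1})\cong S^{\bullet}(\mathfrak{u}^{*})^{(1)}\otimes\operatorname{Dist}(B_{1})_{\operatorname{ad}},$$ where the generators consisting of elements in $\mathfrak{u}^{*}$ are of degree $1$.
   Context: $SL_2$ is regarded as defined over $\mathbb{F}_2$ with Frobenius morphism $F$. $T$ is a split maximal torus, $B=T\ltimes U$ is the Borel subgroup corresponding to the negative root, $U$ is its unipotent radical, $\mathfrak{u}=\operatorname{Lie} U$ (one-dimensional), and $\mathfrak{u}^*$ is its dual. $B_1$ and $T_1$ are the kernels of $F$ on $B$ and $T$. $\operatorname{Dist}(B_1)$ is the distribution algebra of $B_1$ (isomorphic to the restricted enveloping algebra of $\operatorname{Lie} B$), and $\operatorname{Dist}(B_1)_{\operatorname{ad}}$ is $\operatorname{Dist}(B_1)$ with the adjoint action. $\operatorname{HH}^{\bullet}(B_1)$ denotes the Hochschild cohomology ring of the algebra $\operatorname{Dist}(B_1)$; it is identified with $\operatorname{H}^{\bullet}(B_1,\operatorname{Dist}(B_1)_{\operatorname{ad}})$. $S^{\bullet}$ is the symmetric algebra, and $M^{(1)}$ denotes the Frobenius twist of a module $M$, i.e. the module obtained by composing the action on $M$ with $F$.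
   Formalization: The Frobenius twist on S(u* ) is dropped: u* carries its coadjoint T-action (weight α, trivial on T_1), not that action composed with F (weight 2α). With the literal twist the T-weights disagree: HH^1 has weights α,α,0,0, the right side 2α,2α,α,α. *)

theory Defs
  imports
    "HOL-Analysis.Determinants"
    "HOL-Computational_Algebra.Polynomial"
    "HOL-Library.Multiset"
    "HOL-Library.Poly_Mapping"
    "HOL-Algebra.QuotRing"
    "HOL-Algebra.Module"
begin

text \<open>
  Vector spaces and algebras over the field \<^typ>\<open>'k\<close> are records of type
  \<open>('k, 'a) module\<close> from HOL-Algebra.  For a mere vector space the fields
  \<^const>\<open>mult\<close> and \<^const>\<open>one\<close> carry no information.
\<close>

section \<open>Algebraic groups inside $SL_2$\<close>

type_synonym 'k mat2 = "'k^2^2"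

definition SL2 :: "'k::field mat2 set" where
  "SL2 = {x. det x = 1}"

definition diag_torus :: "'k::field mat2 set" where
  "diag_torus = {x \<in> SL2. x $ 1 $ 2 = 0 \<and> x $ 2 $ 1 = 0}"

definition lower_unipotent :: "'k::field mat2 set" where
  "lower_unipotent = {x. x $ 1 $ 1 = 1 \<and> x $ 2 $ 2 = 1 \<and> x $ 1 $ 2 = 0}"

definition lower_borel :: "'k::field mat2 set" where
  "lower_borel = {x \<in> SL2. x $ 1 $ 2 = 0}"

definition conj_by :: "'k::field mat2 \<Rightarrow> 'k mat2 \<Rightarrow> 'k mat2" where
  "conj_by g x = g ** x ** matrix_inv g"

text \<open>
  Over an algebraically closed field all pairs (maximal torus, Borel subgroup containing it) are
  conjugate, so this describes every Borel subgroup of $SL_2$ together with its unipotent radical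
  and a maximal torus.
\<close>
definition borel_triple :: "'k::field mat2 set \<Rightarrow> 'k mat2 set \<Rightarrow> 'k mat2 set \<Rightarrow> bool" where
  "borel_triple T U B \<longleftrightarrow>
    (\<exists>g\<in>SL2. T = conj_by g ` diag_torus \<and> U = conj_by g ` lower_unipotent \<and> B = conj_by g ` lower_borel)"

text \<open>The Frobenius morphism for the structure over the field with two elements.\<close>
definition frob :: "'k::field mat2 \<Rightarrow> 'k mat2" where
  "frob x = (\<chi> i j. (x $ i $ j)\<^sup>2)"

text \<open>
  Functions on a subset \<open>G\<close> of the matrices are extended by 0 outside \<open>G\<close>.  As the field is
  infinite and the groups in question are reduced, their coordinate rings are rings of functions
  on the rational points.  The matrix entries generate them, since the determinant is 1.
\<close>
definition restr :: "'k::field mat2 set \<Rightarrow> ('k mat2 \<Rightarrow> 'k) \<Rightarrow> 'k mat2 \<Rightarrow> 'k" where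
  "restr G f = (\<lambda>x. if x \<in> G then f x else 0)"

inductive_set coord_ring :: "'k::field mat2 set \<Rightarrow> ('k mat2 \<Rightarrow> 'k) set" for G where
  const: "restr G (\<lambda>_. c) \<in> coord_ring G"
| entry: "restr G (\<lambda>x. x $ i $ j) \<in> coord_ring G"
| add: "f \<in> coord_ring G \<Longrightarrow> h \<in> coord_ring G \<Longrightarrow> (\<lambda>x. f x + h x) \<in> coord_ring G"
| mult: "f \<in> coord_ring G \<Longrightarrow> h \<in> coord_ring G \<Longrightarrow> (\<lambda>x. f x * h x) \<in> coord_ring G"

definition augmentation_ideal :: "'k::field mat2 set \<Rightarrow> ('k mat2 \<Rightarrow> 'k) set" where
  "augmentation_ideal G = {f \<in> coord_ring G. f (mat 1) = 0}"

text \<open>The ideal of \<open>G\<^sub>1 = G \<inter> ker F\<close> in the coordinate ring of \<open>G\<close>.\<close>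
inductive_set frob_kernel_ideal :: "'k::field mat2 set \<Rightarrow> ('k mat2 \<Rightarrow> 'k) set" for G where
  gen: "f \<in> augmentation_ideal SL2 \<Longrightarrow> restr G (\<lambda>x. f (frob x)) \<in> frob_kernel_ideal G"
| add: "f \<in> frob_kernel_ideal G \<Longrightarrow> h \<in> frob_kernel_ideal G \<Longrightarrow>
    (\<lambda>x. f x + h x) \<in> frob_kernel_ideal G"
| mult: "f \<in> coord_ring G \<Longrightarrow> h \<in> frob_kernel_ideal G \<Longrightarrow>
    (\<lambda>x. f x * h x) \<in> frob_kernel_ideal G"

type_synonym 'k fnl = "('k mat2 \<Rightarrow> 'k) \<Rightarrow> 'k"

text \<open>Linear functionals on the coordinate ring, extended by 0.\<close>
definition functionals :: "'k::field mat2 set \<Rightarrow> 'k fnl set" where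
  "functionals G = {\<mu>. (\<forall>f. f \<notin> coord_ring G \<longrightarrow> \<mu> f = 0) \<and>
     (\<forall>f\<in>coord_ring G. \<forall>h\<in>coord_ring G. \<mu> (\<lambda>x. f x + h x) = \<mu> f + \<mu> h) \<and>
     (\<forall>c. \<forall>f\<in>coord_ring G. \<mu> (\<lambda>x. c * f x) = c * \<mu> f)}"

text \<open>The action on functionals induced by conjugation.\<close>
definition Ad :: "'k::field mat2 set \<Rightarrow> 'k mat2 \<Rightarrow> 'k fnl \<Rightarrow> 'k fnl" where
  "Ad G t \<mu> = (\<lambda>f. if f \<in> coord_ring G then \<mu> (restr G (\<lambda>x. f (conj_by t x))) else 0)"

text \<open>
  The distribution algebra of \<open>G\<^sub>1\<close>: functionals on the coordinate ring of \<open>G\<^sub>1\<close> vanishing on some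
  power of the augmentation ideal, with the convolution product.
\<close>
definition Dist1 :: "'k::field mat2 set \<Rightarrow> ('k, 'k fnl) module" where
  "Dist1 G =
    \<lparr>carrier = {\<mu> \<in> functionals G. (\<forall>f\<in>frob_kernel_ideal G. \<mu> f = 0) \<and>
       (\<exists>n. \<forall>fs. length fs = Suc n \<and> set fs \<subseteq> augmentation_ideal G \<longrightarrow>
          \<mu> (restr G (\<lambda>x. \<Prod>f\<leftarrow>fs. f x)) = 0)},
     mult = (\<lambda>\<mu> \<nu> f. if f \<in> coord_ring G
       then \<mu> (restr G (\<lambda>x. \<nu> (restr G (\<lambda>y. f (x ** y))))) else 0),
     one = (\<lambda>f. if f \<in> coord_ring G then f (mat 1) else 0),
     zero = (\<lambda>_. 0),
     add = (\<lambda>\<mu> \<nu> f. \<mu> f + \<nu> f),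
     smult = (\<lambda>c \<mu> f. c * \<mu> f)\<rparr>"

text \<open>The Lie algebra as the space of point derivations at the identity.\<close>
definition Lie :: "'k::field mat2 set \<Rightarrow> ('k, 'k fnl) module" where
  "Lie G =
    \<lparr>carrier = {\<delta> \<in> functionals G. \<forall>f\<in>coord_ring G. \<forall>h\<in>coord_ring G.
       \<delta> (\<lambda>x. f x * h x) = f (mat 1) * \<delta> h + \<delta> f * h (mat 1)},
     mult = undefined, one = undefined,
     zero = (\<lambda>_. 0),
     add = (\<lambda>\<mu> \<nu> f. \<mu> f + \<nu> f),
     smult = (\<lambda>c \<mu> f. c * \<mu> f)\<rparr>"

definition dual_space :: "('k::field, 'v) module \<Rightarrow> ('k, 'v \<Rightarrow> 'k) module" where
  "dual_space V =
    \<lparr>carrier = {\<xi>. (\<forall>v. v \<notin> carrier V \<longrightarrow> \<xi> v = 0) \<and>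
       (\<forall>v\<in>carrier V. \<forall>w\<in>carrier V. \<xi> (v \<oplus>\<^bsub>V\<^esub> w) = \<xi> v + \<xi> w) \<and>
       (\<forall>c. \<forall>v\<in>carrier V. \<xi> (c \<odot>\<^bsub>V\<^esub> v) = c * \<xi> v)},
     mult = undefined, one = undefined,
     zero = (\<lambda>_. 0),
     add = (\<lambda>\<xi> \<eta> v. \<xi> v + \<eta> v),
     smult = (\<lambda>c \<xi> v. c * \<xi> v)\<rparr>"

definition dual_act :: "('k::field, 'v) module \<Rightarrow> ('k mat2 \<Rightarrow> 'v \<Rightarrow> 'v) \<Rightarrow> 'k mat2 \<Rightarrow> ('v \<Rightarrow> 'k) \<Rightarrow> 'v \<Rightarrow> 'k" where
  "dual_act V \<rho> t \<xi> = (\<lambda>v. if v \<in> carrier V then \<xi> (\<rho> (matrix_inv t) v) else 0)"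

definition rational_rep :: "'k::field mat2 set \<Rightarrow> ('k, 'v) module \<Rightarrow> ('k mat2 \<Rightarrow> 'v \<Rightarrow> 'v) \<Rightarrow> bool" where
  "rational_rep G V \<rho> \<longleftrightarrow>
    (\<forall>t\<in>G. \<forall>v\<in>carrier V. \<rho> t v \<in> carrier V) \<and>
    (\<forall>t\<in>G. \<forall>v\<in>carrier V. \<forall>w\<in>carrier V. \<rho> t (v \<oplus>\<^bsub>V\<^esub> w) = \<rho> t v \<oplus>\<^bsub>V\<^esub> \<rho> t w) \<and>
    (\<forall>t\<in>G. \<forall>c. \<forall>v\<in>carrier V. \<rho> t (c \<odot>\<^bsub>V\<^esub> v) = c \<odot>\<^bsub>V\<^esub> \<rho> t v) \<and>
    (\<forall>v\<in>carrier V. \<rho> (mat 1) v = v) \<and>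
    (\<forall>s\<in>G. \<forall>t\<in>G. \<forall>v\<in>carrier V. \<rho> (s ** t) v = \<rho> s (\<rho> t v)) \<and>
    (\<forall>v\<in>carrier V. \<exists>(n::nat) w r. (\<forall>i<n. w i \<in> carrier V \<and> r i \<in> coord_ring G) \<and>
       (\<forall>t\<in>G. \<rho> t v = (\<Oplus>\<^bsub>V\<^esub>i\<in>{..<n}. r i t \<odot>\<^bsub>V\<^esub> w i)))"

text \<open>
  \<open>F\<close> induces an isomorphism of \<open>T/T\<^sub>1\<close> with the torus \<open>F(T)\<close>.  The \<open>T\<close>-module \<open>(V, \<rho>)\<close> comes from
  the \<open>T/T\<^sub>1\<close>-module \<open>(V, \<sigma>)\<close> by composing with \<open>F\<close>.  On rational points \<open>F\<close> is bijective, so the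
  triviality of \<open>T\<^sub>1\<close> is expressed by the rationality of \<open>\<sigma>\<close>.

  In characteristic 2 the root is twice a character of \<open>T\<close>, so the coadjoint action on the dual of
  the Lie algebra of \<open>U\<close> is itself such a Frobenius twist.  It is not twisted a second time: the
  first Hochschild cohomology of the distribution algebra of \<open>B\<^sub>1\<close> is free on a class whose weight
  under \<open>T\<close> is that of this dual, not twice that weight.
\<close>
definition frob_descent ::
  "'k::field mat2 set \<Rightarrow> ('k, 'v) module \<Rightarrow> ('k mat2 \<Rightarrow> 'v \<Rightarrow> 'v) \<Rightarrow> ('k mat2 \<Rightarrow> 'v \<Rightarrow> 'v) \<Rightarrow> bool" where
  "frob_descent T V \<rho> \<sigma> \<longleftrightarrow>
    rational_rep (frob ` T) V \<sigma> \<and> (\<forall>t\<in>T. \<forall>v\<in>carrier V. \<rho> t v = \<sigma> (frob t) v)"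

section \<open>Quotients, symmetric algebras and tensor products of algebras\<close>

definition quot_algebra :: "('k, 'a) module \<Rightarrow> 'a set \<Rightarrow> ('k, 'a set) module" where
  "quot_algebra A I =
    \<lparr>carrier = carrier (A Quot I), mult = mult (A Quot I), one = one (A Quot I),
     zero = zero (A Quot I), add = add (A Quot I),
     smult = (\<lambda>c X. \<Union>x\<in>X. I +>\<^bsub>A\<^esub> (c \<odot>\<^bsub>A\<^esub> x))\<rparr>"

definition algebra_iso :: "('k, 'a) module \<Rightarrow> ('k, 'b) module \<Rightarrow> ('a \<Rightarrow> 'b) set" where
  "algebra_iso A B =
    {\<phi> \<in> ring_iso A B. \<forall>c. \<forall>x\<in>carrier A. \<phi> (c \<odot>\<^bsub>A\<^esub> x) = c \<odot>\<^bsub>B\<^esub> \<phi> x}"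

definition push_keys :: "('a \<Rightarrow> 'b) \<Rightarrow> ('a \<Rightarrow>\<^sub>0 'k::field) \<Rightarrow> ('b \<Rightarrow>\<^sub>0 'k)" where
  "push_keys h p = (\<Sum>m\<in>Poly_Mapping.keys p. Poly_Mapping.single (h m) (Poly_Mapping.lookup p m))"

text \<open>The polynomial ring with one variable for each vector of \<open>V\<close>.\<close>
definition free_comm_algebra :: "('k::field, 'v) module \<Rightarrow> ('k, 'v multiset \<Rightarrow>\<^sub>0 'k) module" where
  "free_comm_algebra V =
    \<lparr>carrier = {p. \<forall>m\<in>Poly_Mapping.keys p. set_mset m \<subseteq> carrier V},
     mult = (*), one = 1, zero = 0, add = (+),
     smult = (\<lambda>c. Poly_Mapping.map ((*) c))\<rparr>"

abbreviation gen_var :: "'v \<Rightarrow> 'v multiset \<Rightarrow>\<^sub>0 'k::field" where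
  "gen_var v \<equiv> Poly_Mapping.single {#v#} 1"

definition linear_relations :: "('k::field, 'v) module \<Rightarrow> ('v multiset \<Rightarrow>\<^sub>0 'k) set" where
  "linear_relations V =
    {gen_var (v \<oplus>\<^bsub>V\<^esub> w) - gen_var v - gen_var w | v w. v \<in> carrier V \<and> w \<in> carrier V} \<union>
    {gen_var (c \<odot>\<^bsub>V\<^esub> v) - Poly_Mapping.map ((*) c) (gen_var v) | c v. v \<in> carrier V}"

definition sym_ideal :: "('k::field, 'v) module \<Rightarrow> ('v multiset \<Rightarrow>\<^sub>0 'k) set" where
  "sym_ideal V = Idl\<^bsub>free_comm_algebra V\<^esub> (linear_relations V)"

definition sym_algebra :: "('k::field, 'v) module \<Rightarrow> ('k, ('v multiset \<Rightarrow>\<^sub>0 'k) set) module" where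
  "sym_algebra V = quot_algebra (free_comm_algebra V) (sym_ideal V)"

definition sym_grade :: "('k::field, 'v) module \<Rightarrow> nat \<Rightarrow> ('v multiset \<Rightarrow>\<^sub>0 'k) set set" where
  "sym_grade V n = {sym_ideal V +>\<^bsub>free_comm_algebra V\<^esub> p | p.
     p \<in> carrier (free_comm_algebra V) \<and> (\<forall>m\<in>Poly_Mapping.keys p. size m = n)}"

text \<open>The action on cosets is taking images.\<close>
definition sym_act ::
  "('k::field mat2 \<Rightarrow> 'v \<Rightarrow> 'v) \<Rightarrow> 'k mat2 \<Rightarrow> ('v multiset \<Rightarrow>\<^sub>0 'k) set \<Rightarrow> ('v multiset \<Rightarrow>\<^sub>0 'k) set" where
  "sym_act \<rho> t X = push_keys (image_mset (\<rho> t)) ` X"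

text \<open>The vector space with basis \<open>A \<times> B\<close> and componentwise multiplication of basis elements.\<close>
definition pair_algebra ::
  "('k::field, 'a) module \<Rightarrow> ('k, 'b) module \<Rightarrow> ('k, 'a \<times> 'b \<Rightarrow>\<^sub>0 'k) module" where
  "pair_algebra A B =
    \<lparr>carrier = {p. Poly_Mapping.keys p \<subseteq> carrier A \<times> carrier B},
     mult = (\<lambda>p q. \<Sum>x\<in>Poly_Mapping.keys p. \<Sum>y\<in>Poly_Mapping.keys q.
       Poly_Mapping.single (fst x \<otimes>\<^bsub>A\<^esub> fst y, snd x \<otimes>\<^bsub>B\<^esub> snd y) (Poly_Mapping.lookup p x * Poly_Mapping.lookup q y)),
     one = Poly_Mapping.single (\<one>\<^bsub>A\<^esub>, \<one>\<^bsub>B\<^esub>) 1,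
     zero = 0, add = (+),
     smult = (\<lambda>c. Poly_Mapping.map ((*) c))\<rparr>"

abbreviation gen_pair :: "'a \<Rightarrow> 'b \<Rightarrow> 'a \<times> 'b \<Rightarrow>\<^sub>0 'k::field" where
  "gen_pair x y \<equiv> Poly_Mapping.single (x, y) 1"

definition bilinear_relations ::
  "('k::field, 'a) module \<Rightarrow> ('k, 'b) module \<Rightarrow> ('a \<times> 'b \<Rightarrow>\<^sub>0 'k) set" where
  "bilinear_relations A B =
    {gen_pair (x \<oplus>\<^bsub>A\<^esub> x') y - gen_pair x y - gen_pair x' y | x x' y.
       x \<in> carrier A \<and> x' \<in> carrier A \<and> y \<in> carrier B} \<union>
    {gen_pair x (y \<oplus>\<^bsub>B\<^esub> y') - gen_pair x y - gen_pair x y' | x y y'.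
       x \<in> carrier A \<and> y \<in> carrier B \<and> y' \<in> carrier B} \<union>
    {gen_pair (c \<odot>\<^bsub>A\<^esub> x) y - Poly_Mapping.map ((*) c) (gen_pair x y) | c x y.
       x \<in> carrier A \<and> y \<in> carrier B} \<union>
    {gen_pair x (c \<odot>\<^bsub>B\<^esub> y) - Poly_Mapping.map ((*) c) (gen_pair x y) | c x y.
       x \<in> carrier A \<and> y \<in> carrier B}"

definition tensor_ideal ::
  "('k::field, 'a) module \<Rightarrow> ('k, 'b) module \<Rightarrow> ('a \<times> 'b \<Rightarrow>\<^sub>0 'k) set" where
  "tensor_ideal A B = Idl\<^bsub>pair_algebra A B\<^esub> (bilinear_relations A B)"

definition tensor_algebra ::
  "('k::field, 'a) module \<Rightarrow> ('k, 'b) module \<Rightarrow> ('k, ('a \<times> 'b \<Rightarrow>\<^sub>0 'k) set) module" where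
  "tensor_algebra A B = quot_algebra (pair_algebra A B) (tensor_ideal A B)"

text \<open>The grading of the tensor product where \<open>A\<close> is graded by \<open>gr\<close> and \<open>B\<close> lives in degree 0.\<close>
definition tensor_grade ::
  "('k::field, 'a) module \<Rightarrow> ('k, 'b) module \<Rightarrow> (nat \<Rightarrow> 'a set) \<Rightarrow> nat \<Rightarrow> ('a \<times> 'b \<Rightarrow>\<^sub>0 'k) set set" where
  "tensor_grade A B gr n = {tensor_ideal A B +>\<^bsub>pair_algebra A B\<^esub> p | p.
     p \<in> carrier (pair_algebra A B) \<and> Poly_Mapping.keys p \<subseteq> gr n \<times> carrier B}"

definition tensor_act ::
  "('k::field mat2 \<Rightarrow> 'a \<Rightarrow> 'a) \<Rightarrow> ('k mat2 \<Rightarrow> 'b \<Rightarrow> 'b) \<Rightarrow> 'k mat2 \<Rightarrow>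
    ('a \<times> 'b \<Rightarrow>\<^sub>0 'k) set \<Rightarrow> ('a \<times> 'b \<Rightarrow>\<^sub>0 'k) set" where
  "tensor_act \<rho> \<sigma> t X = push_keys (map_prod (\<rho> t) (\<sigma> t)) ` X"

section \<open>Hochschild cohomology\<close>

text \<open>
  An element of the total Hochschild complex \<open>\<Oplus>\<^sub>n Hom(A\<^sup>\<otimes>\<^sup>n, A)\<close> is a function on lists: its
  restriction to lists of length \<open>n\<close> is the multilinear component of degree \<open>n\<close>.
\<close>
definition hoch_cochains :: "('k::field, 'a) module \<Rightarrow> ('a list \<Rightarrow> 'a) set" where
  "hoch_cochains A = {c.
     (\<forall>xs. set xs \<subseteq> carrier A \<longrightarrow> c xs \<in> carrier A) \<and>
     (\<forall>xs. \<not> set xs \<subseteq> carrier A \<longrightarrow> c xs = \<zero>\<^bsub>A\<^esub>) \<and>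
     (\<forall>xs ys x y. set (xs @ x # y # ys) \<subseteq> carrier A \<longrightarrow>
        c (xs @ (x \<oplus>\<^bsub>A\<^esub> y) # ys) = c (xs @ x # ys) \<oplus>\<^bsub>A\<^esub> c (xs @ y # ys)) \<and>
     (\<forall>xs ys a x. set (xs @ x # ys) \<subseteq> carrier A \<longrightarrow>
        c (xs @ (a \<odot>\<^bsub>A\<^esub> x) # ys) = a \<odot>\<^bsub>A\<^esub> c (xs @ x # ys)) \<and>
     (\<exists>N. \<forall>xs. length xs > N \<longrightarrow> c xs = \<zero>\<^bsub>A\<^esub>)}"

definition hoch_diff :: "('k::field, 'a) module \<Rightarrow> ('a list \<Rightarrow> 'a) \<Rightarrow> 'a list \<Rightarrow> 'a" where
  "hoch_diff A c xs =
    (if xs = [] \<or> \<not> set xs \<subseteq> carrier A then \<zero>\<^bsub>A\<^esub>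
     else let n = length xs - 1 in
       hd xs \<otimes>\<^bsub>A\<^esub> c (tl xs)
       \<oplus>\<^bsub>A\<^esub> (\<Oplus>\<^bsub>A\<^esub>i\<in>{..<n}. (- 1) ^ Suc i \<odot>\<^bsub>A\<^esub>
              c (take i xs @ (xs ! i \<otimes>\<^bsub>A\<^esub> xs ! Suc i) # drop (i + 2) xs))
       \<oplus>\<^bsub>A\<^esub> (- 1) ^ Suc n \<odot>\<^bsub>A\<^esub> (c (butlast xs) \<otimes>\<^bsub>A\<^esub> last xs))"

definition hoch_cocycles :: "('k::field, 'a) module \<Rightarrow> ('k, 'a list \<Rightarrow> 'a) module" where
  "hoch_cocycles A =
    \<lparr>carrier = {c \<in> hoch_cochains A. hoch_diff A c = (\<lambda>_. \<zero>\<^bsub>A\<^esub>)},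
     mult = (\<lambda>c d xs. if set xs \<subseteq> carrier A
       then (\<Oplus>\<^bsub>A\<^esub>i\<in>{..length xs}. c (take i xs) \<otimes>\<^bsub>A\<^esub> d (drop i xs)) else \<zero>\<^bsub>A\<^esub>),
     one = (\<lambda>xs. if xs = [] then \<one>\<^bsub>A\<^esub> else \<zero>\<^bsub>A\<^esub>),
     zero = (\<lambda>_. \<zero>\<^bsub>A\<^esub>),
     add = (\<lambda>c d xs. c xs \<oplus>\<^bsub>A\<^esub> d xs),
     smult = (\<lambda>a c xs. a \<odot>\<^bsub>A\<^esub> c xs)\<rparr>"

definition hoch_coboundaries :: "('k::field, 'a) module \<Rightarrow> ('a list \<Rightarrow> 'a) set" where
  "hoch_coboundaries A = hoch_diff A ` hoch_cochains A"

definition HH :: "('k::field, 'a) module \<Rightarrow> ('k, ('a list \<Rightarrow> 'a) set) module" where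
  "HH A = quot_algebra (hoch_cocycles A) (hoch_coboundaries A)"

definition HH_grade :: "('k::field, 'a) module \<Rightarrow> nat \<Rightarrow> ('a list \<Rightarrow> 'a) set set" where
  "HH_grade A n = {hoch_coboundaries A +>\<^bsub>hoch_cocycles A\<^esub> c | c.
     c \<in> carrier (hoch_cocycles A) \<and> (\<forall>xs. length xs \<noteq> n \<longrightarrow> c xs = \<zero>\<^bsub>A\<^esub>)}"

definition cochain_act ::
  "('k::field, 'a) module \<Rightarrow> ('k mat2 \<Rightarrow> 'a \<Rightarrow> 'a) \<Rightarrow> 'k mat2 \<Rightarrow> ('a list \<Rightarrow> 'a) \<Rightarrow> 'a list \<Rightarrow> 'a" where
  "cochain_act A \<rho> t c =
    (\<lambda>xs. if set xs \<subseteq> carrier A then \<rho> t (c (map (\<rho> (matrix_inv t)) xs)) else \<zero>\<^bsub>A\<^esub>)"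

definition HH_act ::
  "('k::field, 'a) module \<Rightarrow> ('k mat2 \<Rightarrow> 'a \<Rightarrow> 'a) \<Rightarrow> 'k mat2 \<Rightarrow> ('a list \<Rightarrow> 'a) set \<Rightarrow> ('a list \<Rightarrow> 'a) set" where
  "HH_act A \<rho> t X = cochain_act A \<rho> t ` X"

end

(*
  In characteristic 2 the algebra Dist(B_1) is commutative: the four functions 1, A, C, AC of the
  coordinates A, C of the Borel subgroup form a basis of k[B_1] = k[A, C]/(A^2 - 1, C^2), and the dual
  basis exhibits Dist(B_1) as a product of two copies of the dual numbers k[eps]/(eps^2).

  The derivation d/d eps is a Hochschild 1-cocycle y, and its cup powers multiplied by elements of
  the algebra are cocycles.  Conversely, the two idempotents span a separable subalgebra, so a cocycle
  of positive degree can be changed by a coboundary into one that has y as a left cup factor.  Iterating,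
  every cocycle is cohomologous to a polynomial in y, whose coefficients are read off from the values at
  (eps, ..., eps) on the two factors.  As eps^2 = 0, these values vanish on coboundaries.
  Thus the cohomology ring is the polynomial ring in y over the algebra itself.
*)
theory Submission
  imports Defs
begin

text \<open>Why there are two factors: modulo the ideal of B_1 the inverse of A is A itself, so A is
  group-like, AC is primitive, and C = A * AC. Dually, the functionals belonging to 1 and A are
  orthogonal idempotents, and those belonging to AC and C are the nilpotents of the two factors.
  Characteristic 2 is used beyond commutativity: d/d eps respects eps^2 = 0 only because 2 eps = 0,
  and conjugation by the torus scales C by an inverse square, so that all weights factor through the
  Frobenius morphism. The objects to be compared are quotients of huge carriers by ideals. Each is
  given a symbol, a surjective homomorphism onto a concrete commutative ring whose kernel is exactly
  the ideal; the cosets are then its fibres. The symbols of the cohomology ring and of the tensor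
  product have the same target, so the isomorphism matches fibres over the same element, and
  gradings and torus actions are compared there as explicit formulas. The real work lies in showing
  that the kernels are no larger than the ideals.\<close>

section \<open>Pairs of dual numbers\<close>

text \<open>\<open>DP a b a' b'\<close> stands for the element \<open>(a + b\<epsilon>, a' + b'\<epsilon>)\<close> of the square of the dual numbers.\<close>
datatype 'a dp = DP (re0: 'a) (ep0: 'a) (re1: 'a) (ep1: 'a)

instantiation dp :: (comm_ring_1) comm_ring_1
begin
definition "0 = DP 0 0 0 0"
definition "1 = DP 1 0 1 0"
definition "x + y = DP (re0 x + re0 y) (ep0 x + ep0 y) (re1 x + re1 y) (ep1 x + ep1 y)"
definition "x - y = DP (re0 x - re0 y) (ep0 x - ep0 y) (re1 x - re1 y) (ep1 x - ep1 y)"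
definition "- x = DP (- re0 x) (- ep0 x) (- re1 x) (- ep1 x)"
definition "x * y = DP (re0 x * re0 y) (re0 x * ep0 y + ep0 x * re0 y)
                       (re1 x * re1 y) (re1 x * ep1 y + ep1 x * re1 y)"
instance
  by standard
    (auto simp: zero_dp_def one_dp_def plus_dp_def minus_dp_def uminus_dp_def times_dp_def
      algebra_simps)
end

lemma dp_sel [simp]:
  "re0 0 = 0" "ep0 0 = 0" "re1 0 = 0" "ep1 0 = 0"
  "re0 1 = 1" "ep0 1 = 0" "re1 1 = 1" "ep1 1 = 0"
  "re0 (x + y) = re0 x + re0 y" "ep0 (x + y) = ep0 x + ep0 y"
  "re1 (x + y) = re1 x + re1 y" "ep1 (x + y) = ep1 x + ep1 y"
  "re0 (x - y) = re0 x - re0 y" "ep0 (x - y) = ep0 x - ep0 y"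
  "re1 (x - y) = re1 x - re1 y" "ep1 (x - y) = ep1 x - ep1 y"
  "re0 (- x) = - re0 x" "ep0 (- x) = - ep0 x" "re1 (- x) = - re1 x" "ep1 (- x) = - ep1 x"
  "re0 (x * y) = re0 x * re0 y" "ep0 (x * y) = re0 x * ep0 y + ep0 x * re0 y"
  "re1 (x * y) = re1 x * re1 y" "ep1 (x * y) = re1 x * ep1 y + ep1 x * re1 y"
  by (simp_all add: zero_dp_def one_dp_def plus_dp_def minus_dp_def uminus_dp_def times_dp_def)

lemma dp_eq_iff: "x = y \<longleftrightarrow> re0 x = re0 y \<and> ep0 x = ep0 y \<and> re1 x = re1 y \<and> ep1 x = ep1 y"
  by (auto intro: dp.expand)

lemma dp_sel_sum [simp]:
  "re0 (sum f A) = (\<Sum>i\<in>A. re0 (f i))" "ep0 (sum f A) = (\<Sum>i\<in>A. ep0 (f i))"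
  "re1 (sum f A) = (\<Sum>i\<in>A. re1 (f i))" "ep1 (sum f A) = (\<Sum>i\<in>A. ep1 (f i))"
  by (induction A rule: infinite_finite_induct) auto

text \<open>Scalars enter as diagonal elements, so that scalar multiplication is ring multiplication
  and linearity can be stated inside the ring.\<close>

definition dscal :: "'a::comm_ring_1 \<Rightarrow> 'a dp" where
  "dscal a = DP a 0 a 0"

lemma dscal_sel [simp]: "re0 (dscal a) = a" "ep0 (dscal a) = 0" "re1 (dscal a) = a" "ep1 (dscal a) = 0"
  by (simp_all add: dscal_def)

lemma dscal_hom [simp]: "dscal 1 = 1" "dscal 0 = 0"
  by (simp_all add: dp_eq_iff)

lemma dscal_mult: "dscal (a * b) = dscal a * dscal b"
  by (simp add: dp_eq_iff)

section \<open>The bar complex in characteristic 2\<close>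

text \<open>
  Cochains in all degrees at once are functions on lists.  \<open>bar_tail c x ys\<close> collects all terms of
  the differential of \<open>c\<close> at \<open>x # ys\<close> except the first one; signs play no role.
\<close>
fun bar_tail :: "('b::comm_ring_1 list \<Rightarrow> 'b) \<Rightarrow> 'b \<Rightarrow> 'b list \<Rightarrow> 'b" where
  "bar_tail c x [] = c [] * x"
| "bar_tail c x (y # ys) = c (x * y # ys) + bar_tail (\<lambda>l. c (x # l)) y ys"

fun bar_diff :: "('b::comm_ring_1 list \<Rightarrow> 'b) \<Rightarrow> 'b list \<Rightarrow> 'b" where
  "bar_diff c [] = 0"
| "bar_diff c (x # xs) = x * c xs + bar_tail c x xs"

definition cup :: "('b::comm_ring_1 list \<Rightarrow> 'b) \<Rightarrow> ('b list \<Rightarrow> 'b) \<Rightarrow> 'b list \<Rightarrow> 'b" where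
  "cup c e xs = (\<Sum>i\<le>length xs. c (take i xs) * e (drop i xs))"

lemma cup_Nil [simp]: "cup c e [] = c [] * e []"
  by (simp add: cup_def)

text \<open>The cut before the first entry is split off; in every other cut that entry belongs to
  the left factor. Inductions on the list therefore keep the left factor arbitrary.\<close>

lemma cup_Cons [simp]: "cup c e (x # xs) = c [] * e (x # xs) + cup (\<lambda>l. c (x # l)) e xs"
  by (simp add: cup_def sum.atMost_Suc_shift del: sum.atMost_Suc)

lemma cup_add_left: "cup (\<lambda>l. c l + c' l) e xs = cup c e xs + cup c' e xs"
  by (simp add: cup_def algebra_simps sum.distrib)

lemma cup_mult_left: "cup (\<lambda>l. a * c l) e xs = a * cup c e xs"
  by (simp add: cup_def algebra_simps sum_distrib_left)

lemma bar_tail_add: "bar_tail (\<lambda>l. c l + e l) x xs = bar_tail c x xs + bar_tail e x xs"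
  by (induction xs arbitrary: c e x) (simp_all add: algebra_simps)

lemma bar_tail_mult: "bar_tail (\<lambda>l. a * c l) x xs = a * bar_tail c x xs"
  by (induction xs arbitrary: c x) (simp_all add: algebra_simps)

lemma bar_tail_zero: "bar_tail (\<lambda>_. 0) x xs = 0"
  by (induction xs arbitrary: x) simp_all

lemma bar_diff_zero: "bar_diff (\<lambda>_. 0) xs = 0"
  by (cases xs) (simp_all add: bar_tail_zero)

lemma bar_diff_add: "bar_diff (\<lambda>l. c l + e l) xs = bar_diff c xs + bar_diff e xs"
  by (cases xs) (simp_all add: bar_tail_add algebra_simps)

text \<open>Bridge to the usual form of the Hochschild differential, where the inner terms are
  indexed by the position of the contracted pair; the recursion peels off position 0.\<close>

lemma bar_tail_sum:
  "bar_tail c x ys =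
    (\<Sum>i<length ys. c (take i (x # ys) @ ((x # ys) ! i * (x # ys) ! Suc i) # drop (i + 2) (x # ys)))
    + c (butlast (x # ys)) * last (x # ys)"
  by (induction ys arbitrary: c x) (simp_all add: sum.lessThan_Suc_shift del: sum.lessThan_Suc)

context
  assumes two: "(2::'b::comm_ring_1) = 0"
begin

lemma double [simp]: "(x::'b) + x = 0"
  by (simp add: two flip: mult_2)

lemma double' [simp]: "(x::'b) + (x + y) = y"
  by (simp add: add.assoc [symmetric])

lemma add_eq_iff_char2: "(x::'b) + y = z \<longleftrightarrow> x = z + y"
  by (metis add.assoc add_0_right double)

text \<open>The simplicial identity behind d^2 = 0. After one expansion, the terms that contract
  \<open>y\<close> with the next entry while \<open>x\<close> stays in front arise twice, once
  directly and once through the induction hypothesis, and cancel.\<close>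

lemma bar_tail_tail: "bar_tail (bar_tail c x) (y::'b) zs = bar_tail c (x * y) zs"
proof (induction zs arbitrary: c x y)
  case (Cons z zs)
  then show ?case by (simp add: bar_tail_add algebra_simps)
qed (simp add: algebra_simps)

text \<open>The tail of the second differential duplicates its leading term; in characteristic 2
  this is d^2 = 0.\<close>

lemma bar_tail_diff: "bar_tail (bar_diff c) (x::'b) ys = x * bar_diff c ys"
proof (cases ys)
  case (Cons y zs)
  then show ?thesis
    by (simp add: bar_tail_add bar_tail_mult bar_tail_tail algebra_simps)
qed simp

lemma bar_diff_diff: "bar_diff (bar_diff c) xs = (0::'b)"
  by (cases xs) (simp_all add: bar_tail_diff)

text \<open>The last two summands together are \<open>cup c (bar_diff e)\<close> at
  \<open>x # l\<close>, so this is the Leibniz rule without the leading term. The products in which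
  an entry at the cut stands between the two cochains belong to both differentials and
  cancel.\<close>

lemma bar_tail_cup:
  "bar_tail (cup c e) (x::'b) l =
    cup (bar_tail c x) e l + c [] * (x * e l + bar_tail e x l) + cup (\<lambda>l. c (x # l)) (bar_diff e) l"
proof (induction l arbitrary: c x)
  case (Cons z zs)
  then show ?case
    by (simp add: bar_tail_add bar_tail_mult cup_add_left algebra_simps)
qed (simp add: algebra_simps)

lemma bar_diff_cup: "bar_diff (cup c e) xs = cup (bar_diff c) e xs + cup c (bar_diff e) (xs::'b list)"
  by (cases xs) (simp_all add: bar_tail_cup cup_add_left cup_mult_left algebra_simps)

end

section \<open>Cohomology of the bar complex of a pair of dual numbers\<close>

text \<open>The bound on the length makes the total complex a direct sum over the degrees. It is
  what makes symbols polynomials, and it starts the induction that lowers the degree.\<close>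

definition dp_cochains :: "('k::comm_ring_1 dp list \<Rightarrow> 'k dp) set" where
  "dp_cochains = {c.
     (\<forall>xs ys x y. c (xs @ (x + y) # ys) = c (xs @ x # ys) + c (xs @ y # ys)) \<and>
     (\<forall>xs ys a x. c (xs @ (dscal a * x) # ys) = dscal a * c (xs @ x # ys)) \<and>
     (\<exists>N. \<forall>xs. length xs > N \<longrightarrow> c xs = 0)}"

lemma dp_cochainsI:
  assumes "\<And>xs ys x y. c (xs @ (x + y) # ys) = c (xs @ x # ys) + c (xs @ y # ys)"
    and "\<And>xs ys a x. c (xs @ (dscal a * x) # ys) = dscal a * c (xs @ x # ys)"
    and "\<And>xs. length xs > N \<Longrightarrow> c xs = 0"
  shows "c \<in> dp_cochains"
  using assms by (auto simp: dp_cochains_def)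

lemma dp_cochains_add_arg: "c \<in> dp_cochains \<Longrightarrow> c (xs @ (x + y) # ys) = c (xs @ x # ys) + c (xs @ y # ys)"
  and dp_cochains_scal_arg: "c \<in> dp_cochains \<Longrightarrow> c (xs @ (dscal a * x) # ys) = dscal a * c (xs @ x # ys)"
  by (auto simp: dp_cochains_def)

lemmas dp_cochains_add_hd = dp_cochains_add_arg[where xs = "[]", simplified]
lemmas dp_cochains_scal_hd = dp_cochains_scal_arg[where xs = "[]", simplified]

lemma dp_cochains_bound:
  assumes "c \<in> dp_cochains"
  obtains N where "\<And>xs. length xs > N \<Longrightarrow> c xs = 0"
  using assms by (auto simp: dp_cochains_def)

lemma dp_cochains_0_hd: "c \<in> dp_cochains \<Longrightarrow> c (0 # ys) = 0"
  using dp_cochains_scal_hd[of c 0 0 ys] by simp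

lemma dp_cochains_shift:
  assumes "c \<in> dp_cochains"
  shows "(\<lambda>l. c (x # l)) \<in> dp_cochains"
proof -
  obtain N where "\<And>xs. length xs > N \<Longrightarrow> c xs = 0"
    using assms dp_cochains_bound by blast
  then show ?thesis
    by (intro dp_cochainsI[where N = N])
      (simp_all add: dp_cochains_add_arg[OF assms, where xs = "x # xs" for xs, simplified]
        dp_cochains_scal_arg[OF assms, where xs = "x # xs" for xs, simplified])
qed

lemma dp_cochains_add:
  assumes "c \<in> dp_cochains" "e \<in> dp_cochains"
  shows "(\<lambda>l. c l + e l) \<in> dp_cochains"
proof -
  obtain M N where "\<And>xs. length xs > M \<Longrightarrow> c xs = 0" "\<And>xs. length xs > N \<Longrightarrow> e xs = 0"
    using assms dp_cochains_bound by metis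
  then show ?thesis
    by (intro dp_cochainsI[where N = "max M N"])
      (simp_all add: assms[THEN dp_cochains_add_arg] assms[THEN dp_cochains_scal_arg] distrib_left add_ac)
qed

lemma dp_cochains_mult:
  assumes "c \<in> dp_cochains"
  shows "(\<lambda>l. a * c l) \<in> dp_cochains"
proof -
  obtain N where "\<And>xs. length xs > N \<Longrightarrow> c xs = 0"
    using assms dp_cochains_bound by metis
  then show ?thesis
    by (intro dp_cochainsI[where N = N])
      (simp_all add: assms[THEN dp_cochains_add_arg] assms[THEN dp_cochains_scal_arg] distrib_left mult.left_commute)
qed

lemma bar_tail_add_hd:
  assumes "c \<in> dp_cochains"
  shows "bar_tail c (x + y) ys = bar_tail c x ys + bar_tail c y ys"
proof (cases ys)
  case (Cons z zs)
  then show ?thesis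
    by (simp add: algebra_simps bar_tail_add dp_cochains_add_hd[OF assms])
qed (simp add: algebra_simps)

lemma bar_tail_scal_hd:
  assumes "c \<in> dp_cochains"
  shows "bar_tail c (dscal a * x) ys = dscal a * bar_tail c x ys"
proof (cases ys)
  case (Cons z zs)
  then show ?thesis
    by (simp add: mult.assoc distrib_left bar_tail_mult dp_cochains_scal_hd[OF assms])
qed (simp add: algebra_simps)

lemma bar_tail_add_arg:
  assumes "c \<in> dp_cochains"
  shows "bar_tail c z (xs @ (x + y) # ys) = bar_tail c z (xs @ x # ys) + bar_tail c z (xs @ y # ys)"
  using assms
proof (induction xs arbitrary: c z)
  case Nil
  then show ?case
    by (simp add: bar_tail_add_hd[OF dp_cochains_shift] dp_cochains_add_hd distrib_left add_ac)
next
  case (Cons u xs)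
  then show ?case
    using dp_cochains_add_arg[OF Cons.prems, of "(z * u) # xs" x y ys]
    by (simp add: Cons.IH[OF dp_cochains_shift[OF Cons.prems]] add_ac)
qed

lemma bar_tail_scal_arg:
  assumes "c \<in> dp_cochains"
  shows "bar_tail c z (xs @ (dscal a * x) # ys) = dscal a * bar_tail c z (xs @ x # ys)"
  using assms
proof (induction xs arbitrary: c z)
  case Nil
  have "c (z * (dscal a * x) # ys) = dscal a * c (z * x # ys)"
    using dp_cochains_scal_hd[OF Nil, of a "z * x"] by (simp add: mult.left_commute)
  then show ?case
    using bar_tail_scal_hd[OF dp_cochains_shift[OF Nil]] by (simp add: algebra_simps)
next
  case (Cons u xs)
  then show ?case
    using dp_cochains_scal_arg[OF Cons.prems, of "(z * u) # xs" a x ys]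
    by (simp add: Cons.IH[OF dp_cochains_shift[OF Cons.prems]] distrib_left)
qed

lemma bar_tail_bound:
  assumes "\<And>l. length l > N \<Longrightarrow> c l = 0" and "length xs > N"
  shows "bar_tail c x xs = 0"
  using assms
proof (induction xs arbitrary: c x N)
  case (Cons y ys)
  show ?case
  proof (cases "N = 0")
    case True
    \<comment> \<open>Here \<open>c\<close> vanishes on all nonempty lists, so the shifted cochain
      is zero; it is written as a multiple by 0 to fit \<open>bar_tail_mult\<close>.\<close>
    then have "bar_tail (\<lambda>l. c (x # l)) y ys = 0 * bar_tail c y ys"
      using Cons.prems by (subst bar_tail_mult[symmetric]) simp
    then show ?thesis using Cons.prems by simp
  next
    case False
    then show ?thesis
      using Cons.prems Cons.IH[of "N - 1" "\<lambda>l. c (x # l)" y] by simp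
  qed
qed simp

lemma bar_diff_cochains:
  assumes "c \<in> dp_cochains"
  shows "bar_diff c \<in> dp_cochains"
proof -
  obtain N where N: "\<And>xs. length xs > N \<Longrightarrow> c xs = 0"
    using assms dp_cochains_bound by metis
  show ?thesis
  proof (rule dp_cochainsI[where N = "Suc N"])
    fix xs ys :: "'a dp list" and x y a
    show "bar_diff c (xs @ (x + y) # ys) = bar_diff c (xs @ x # ys) + bar_diff c (xs @ y # ys)"
      using bar_tail_add_arg[OF assms] bar_tail_add_hd[OF assms] dp_cochains_add_arg[OF assms]
      by (cases xs) (simp_all add: algebra_simps)
    show "bar_diff c (xs @ (dscal a * x) # ys) = dscal a * bar_diff c (xs @ x # ys)"
      using bar_tail_scal_arg[OF assms] bar_tail_scal_hd[OF assms] dp_cochains_scal_arg[OF assms]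
      by (cases xs) (simp_all add: algebra_simps)
  next
    fix xs :: "'a dp list" assume "length xs > Suc N"
    then show "bar_diff c xs = 0"
      using N bar_tail_bound[of N c] by (cases xs) simp_all
  qed
qed

lemma cup_add_arg:
  assumes "c \<in> dp_cochains" "e \<in> dp_cochains"
  shows "cup c e (xs @ (x + y) # ys) = cup c e (xs @ x # ys) + cup c e (xs @ y # ys)"
  using assms(1)
proof (induction xs arbitrary: c)
  case Nil
  then show ?case
    by (simp add: dp_cochains_add_hd assms(2) cup_add_left algebra_simps)
next
  case (Cons u xs)
  then show ?case
    using dp_cochains_add_arg[OF assms(2), of "u # xs"]
    by (simp add: Cons.IH[OF dp_cochains_shift[OF Cons.prems]] distrib_left add_ac)
qed

lemma cup_scal_arg:
  assumes "c \<in> dp_cochains" "e \<in> dp_cochains"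
  shows "cup c e (xs @ (dscal a * x) # ys) = dscal a * cup c e (xs @ x # ys)"
  using assms(1)
proof (induction xs arbitrary: c)
  case Nil
  then show ?case
    by (simp add: dp_cochains_scal_hd assms(2) cup_mult_left distrib_left mult.left_commute)
next
  case (Cons u xs)
  then show ?case
    using dp_cochains_scal_arg[OF assms(2), of "u # xs"]
    by (simp add: Cons.IH[OF dp_cochains_shift[OF Cons.prems]] distrib_left mult.left_commute)
qed

lemma cup_cochains:
  assumes "c \<in> dp_cochains" "e \<in> dp_cochains"
  shows "cup c e \<in> dp_cochains"
proof -
  obtain M N where MN: "\<And>xs. length xs > M \<Longrightarrow> c xs = 0" "\<And>xs. length xs > N \<Longrightarrow> e xs = 0"
    using assms dp_cochains_bound by metis
  show ?thesis
  proof (rule dp_cochainsI[where N = "M + N"])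
    fix xs :: "'a dp list" assume *: "length xs > M + N"
    have "c (take i xs) * e (drop i xs) = 0" if "i \<le> length xs" for i
      using MN(1)[of "take i xs"] MN(2)[of "drop i xs"] * that
      by (cases "i > M") auto
    then show "cup c e xs = 0"
      by (simp add: cup_def)
  qed (simp_all add: cup_add_arg cup_scal_arg assms)
qed

section \<open>The derivation d/d eps and its cup powers\<close>

abbreviation (input) eps0 :: "'k::comm_ring_1 dp" where "eps0 \<equiv> DP 0 1 0 0"
abbreviation (input) eps1 :: "'k::comm_ring_1 dp" where "eps1 \<equiv> DP 0 0 0 1"
abbreviation (input) idem0 :: "'k::comm_ring_1 dp" where "idem0 \<equiv> DP 1 0 0 0"
abbreviation (input) idem1 :: "'k::comm_ring_1 dp" where "idem1 \<equiv> DP 0 0 1 0"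

definition eps_deriv :: "'k::comm_ring_1 dp \<Rightarrow> 'k dp" where
  "eps_deriv x = DP (ep0 x) 0 (ep1 x) 0"

lemma eps_deriv_sel [simp]:
  "re0 (eps_deriv x) = ep0 x" "ep0 (eps_deriv x) = 0" "re1 (eps_deriv x) = ep1 x" "ep1 (eps_deriv x) = 0"
  by (simp_all add: eps_deriv_def)

lemma eps_deriv_add: "eps_deriv (x + y) = eps_deriv x + eps_deriv y"
  by (simp add: dp_eq_iff)

lemma eps_deriv_scal: "eps_deriv (dscal a * x) = dscal a * eps_deriv x"
  by (simp add: dp_eq_iff)

text \<open>Each factor is tested with its own nilpotent: the first components come from arguments
  \<open>eps0\<close>, the second ones from arguments \<open>eps1\<close>.\<close>

definition bar_coeff :: "('k::comm_ring_1 dp list \<Rightarrow> 'k dp) \<Rightarrow> nat \<Rightarrow> 'k dp" where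
  "bar_coeff c n =
    DP (re0 (c (replicate n eps0))) (ep0 (c (replicate n eps0)))
       (re1 (c (replicate n eps1))) (ep1 (c (replicate n eps1)))"

lemma bar_coeff_sel [simp]:
  "re0 (bar_coeff c n) = re0 (c (replicate n eps0))"
  "ep0 (bar_coeff c n) = ep0 (c (replicate n eps0))"
  "re1 (bar_coeff c n) = re1 (c (replicate n eps1))"
  "ep1 (bar_coeff c n) = ep1 (c (replicate n eps1))"
  by (simp_all add: bar_coeff_def)

text \<open>The polynomial with coefficients \<open>a n\<close> in the derivation y: the n-th cup
  power of y sends n arguments to the product of their derivatives.\<close>

definition power_cochain :: "(nat \<Rightarrow> 'k::comm_ring_1 dp) \<Rightarrow> 'k dp list \<Rightarrow> 'k dp" where
  "power_cochain a xs = a (length xs) * prod_list (map eps_deriv xs)"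

lemma power_cochain_cochains:
  assumes "\<And>n. n > N \<Longrightarrow> a n = 0"
  shows "power_cochain a \<in> dp_cochains"
  by (rule dp_cochainsI[where N = N])
    (simp_all add: power_cochain_def eps_deriv_add eps_deriv_scal assms distrib_left distrib_right
      mult.assoc mult.left_commute)

text \<open>The derivative of a nilpotent generator is the idempotent of its factor, which equals
  all its positive powers. Degree 0 is separate because the empty product is 1 on both
  factors.\<close>

lemma bar_coeff_power_cochain: "bar_coeff (power_cochain a) n = a n"
proof -
  have "eps_deriv eps0 ^ n = (idem0 :: 'a dp)" if "n > 0"
    using that by (induction n rule: nat_induct_non_zero) (simp_all add: dp_eq_iff)
  moreover have "eps_deriv eps1 ^ n = (idem1 :: 'a dp)" if "n > 0"
    using that by (induction n rule: nat_induct_non_zero) (simp_all add: dp_eq_iff)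
  ultimately show ?thesis
    by (cases "n = 0") (simp_all add: bar_coeff_def power_cochain_def)
qed

text \<open>Left cup multiplication by y. As y lives in degree 1, only the cut after the first entry
  contributes.\<close>

definition deriv_cup :: "('k::comm_ring_1 dp list \<Rightarrow> 'k dp) \<Rightarrow> 'k dp list \<Rightarrow> 'k dp" where
  "deriv_cup c xs = (case xs of [] \<Rightarrow> 0 | x # ys \<Rightarrow> eps_deriv x * c ys)"

lemma deriv_cup_simps [simp]: "deriv_cup c [] = 0" "deriv_cup c (x # xs) = eps_deriv x * c xs"
  by (simp_all add: deriv_cup_def)

lemma deriv_cup_cochains:
  assumes "c \<in> dp_cochains"
  shows "deriv_cup c \<in> dp_cochains"
proof -
  obtain N where N: "\<And>xs. length xs > N \<Longrightarrow> c xs = 0"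
    using assms dp_cochains_bound by metis
  show ?thesis
  proof (rule dp_cochainsI[where N = "Suc N"])
    fix xs ys :: "'a dp list" and x y a
    show "deriv_cup c (xs @ (x + y) # ys) = deriv_cup c (xs @ x # ys) + deriv_cup c (xs @ y # ys)"
      by (cases xs) (simp_all add: dp_cochains_add_arg[OF assms] eps_deriv_add algebra_simps)
    show "deriv_cup c (xs @ (dscal a * x) # ys) = dscal a * deriv_cup c (xs @ x # ys)"
      by (cases xs) (simp_all add: dp_cochains_scal_arg[OF assms] eps_deriv_scal mult.assoc mult.left_commute)
    show "length xs > Suc N \<Longrightarrow> deriv_cup c xs = 0"
      using N by (cases xs) simp_all
  qed
qed

lemma bar_coeff_deriv_cup: "bar_coeff (deriv_cup c) (Suc n) = bar_coeff c n"
  by (simp add: dp_eq_iff)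

section \<open>Exactness: cocycles with vanishing coefficients are coboundaries\<close>

context
  assumes two: "(2::'k::comm_ring_1) = 0"
begin

lemma dp_two: "(2 :: 'k dp) = 0"
  unfolding one_add_one[symmetric] dp_eq_iff dp_sel by (simp add: two)

text \<open>Characteristic 2 is essential: for two multiples of eps the left side is 0, and the
  right side is twice a multiple of eps.\<close>

lemma eps_deriv_mult: "eps_deriv (x * y) = x * eps_deriv y + y * eps_deriv (x :: 'k dp)"
  by (simp add: dp_eq_iff mult.commute double[OF two])

text \<open>The Leibniz rule splits every inner term in two, and neighbouring terms share one of the
  halves; after cancellation the tail of the differential is a second copy of its leading term. The
  coefficients stay arbitrary in the induction because dropping an argument shifts their
  index.\<close>

lemma bar_diff_power_cochain: "bar_diff (power_cochain a) xs = (0 :: 'k dp)"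
proof -
  have "bar_tail (power_cochain a) x xs = x * power_cochain a (xs :: 'k dp list)" for x xs
  proof (induction xs arbitrary: a x)
    case (Cons y ys)
    have "(\<lambda>l. power_cochain a (x # l)) = (\<lambda>l. eps_deriv x * power_cochain (\<lambda>n. a (Suc n)) l)"
      by (simp add: power_cochain_def fun_eq_iff algebra_simps)
    then show ?case
      by (simp add: Cons.IH bar_tail_mult)
        (simp add: power_cochain_def eps_deriv_mult algebra_simps double'[OF dp_two] double[OF dp_two])
  qed (simp add: power_cochain_def mult.commute)
  then show ?thesis
    by (cases xs) (simp_all add: double[OF dp_two])
qed

text \<open>The Leibniz rule for cup multiplication by the cocycle y, without a sign in
  characteristic 2.\<close>

lemma bar_diff_deriv_cup: "bar_diff (deriv_cup c) xs = deriv_cup (bar_diff c) (xs :: 'k dp list)"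
proof (cases xs)
  case (Cons x ys)
  then show ?thesis
    by (cases ys) (simp_all add: bar_tail_mult eps_deriv_mult algebra_simps double'[OF dp_two] double[OF dp_two])
qed simp

text \<open>On constant lists with entry e, e^2 = 0, all inner terms contain e^2; the two outer ones
  are equal by commutativity and cancel in characteristic 2.\<close>

lemma bar_coeff_bar_diff:
  assumes "c \<in> dp_cochains"
  shows "bar_coeff (bar_diff c) n = (0 :: 'k dp)"
proof -
  have tail: "bar_tail c e (replicate n e) = e * c (replicate n e)"
    if "c \<in> dp_cochains" "e * e = 0" for c and e :: "'k dp" and n
    using that(1)
  proof (induction n arbitrary: c)
    case (Suc n)
    then show ?case
      using dp_cochains_shift[OF Suc.prems] dp_cochains_0_hd[OF Suc.prems] that(2) by simp
  qed (simp add: mult.commute)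
  have "bar_diff c (replicate n e) = 0" if "e * e = 0" for e :: "'k dp"
    using tail[OF assms that] by (cases n) (simp_all add: double[OF dp_two])
  moreover have "eps0 * eps0 = (0 :: 'k dp)" "eps1 * eps1 = (0 :: 'k dp)"
    by (simp_all add: dp_eq_iff)
  ultimately show ?thesis
    by (simp add: dp_eq_iff)
qed

text \<open>
  The subalgebra spanned by the two idempotents is separable.  Subtracting a suitable coboundary
  makes \<open>c\<close> linear over it in the first argument and zero when the first argument lies in it, so
  that \<open>c\<close> splits off the derivation with respect to \<open>\<epsilon>\<close> as a left factor.
\<close>
lemma split_off_deriv:
  assumes c: "c \<in> dp_cochains" and cocycle: "\<And>xs. bar_diff c xs = (0 :: 'k dp)"
  defines "h \<equiv> \<lambda>l. idem0 * c (idem0 # l) + idem1 * c (idem1 # l)"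
    and "c' \<equiv> \<lambda>l. idem0 * (eps0 * c (idem0 # l) + c (eps0 # l)) + idem1 * (eps1 * c (idem1 # l) + c (eps1 # l))"
  shows "c (x # xs) + bar_diff h (x # xs) = deriv_cup c' (x # xs)"
proof -
  let ?s = "idem0 * c (idem0 * x # xs) + idem1 * c (idem1 * x # xs)"
  \<comment> \<open>The separability element, the sum of the tensors of each idempotent with itself,
    is fed into the cocycle identity: one leg multiplies, the other becomes a new first argument.
    Its legs multiply to 1, which brings back \<open>c\<close>.\<close>
  have "0 = idem0 * bar_diff c (idem0 # x # xs) + idem1 * bar_diff c (idem1 # x # xs)"
    by (simp only: cocycle mult_zero_right add_0_right)
  also have "\<dots> = (idem0 * idem0 + idem1 * idem1) * c (x # xs) + ?s + bar_tail h x xs"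
    by (simp add: h_def bar_tail_add bar_tail_mult algebra_simps)
  also have "idem0 * idem0 + idem1 * idem1 = (1 :: 'k dp)"
    by (simp add: dp_eq_iff)
  finally have "c (x # xs) + bar_tail h x xs + ?s = 0"
    by (simp add: add_ac)
  then have *: "c (x # xs) + bar_tail h x xs = ?s"
    using add_eq_iff_char2[OF dp_two] by (metis add_0_left)
  \<comment> \<open>In these coordinates the real parts of \<open>x\<close> cancel between the first
    two terms and \<open>x * h xs\<close>. What remains is linear in the eps parts of
    \<open>x\<close>, and its coefficient is \<open>c'\<close>.\<close>
  have "idem0 * x = dscal (re0 x) * idem0 + dscal (ep0 x) * eps0"
    "idem1 * x = dscal (re1 x) * idem1 + dscal (ep1 x) * eps1"
    by (simp_all add: dp_eq_iff)
  then have "?s + x * h xs =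
      idem0 * (dscal (re0 x) * c (idem0 # xs) + dscal (ep0 x) * c (eps0 # xs)) +
      idem1 * (dscal (re1 x) * c (idem1 # xs) + dscal (ep1 x) * c (eps1 # xs)) +
      x * (idem0 * c (idem0 # xs) + idem1 * c (idem1 # xs))"
    by (simp add: dp_cochains_add_hd[OF c] dp_cochains_scal_hd[OF c] h_def)
  also have "\<dots> = eps_deriv x * c' xs"
    by (simp add: c'_def dp_eq_iff distrib_left add_ac mult.commute double[OF two] double'[OF two])
  finally show ?thesis
    using * by (simp add: algebra_simps)
qed

text \<open>Induction on a bound for the degrees. Passing from \<open>c\<close> to the right factor
  of y lowers the bound by one, and that factor is again a cocycle with vanishing coefficients,
  because multiplication by y commutes with the differential, is injective, and shifts coefficients
  by one degree.\<close>

lemma coboundary_if_bar_coeff_0: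
  assumes "c \<in> dp_cochains" "\<And>xs. bar_diff c xs = (0 :: 'k dp)" "\<And>n. bar_coeff c n = 0"
  shows "\<exists>h \<in> dp_cochains. c = bar_diff h"
proof -
  have "\<exists>h \<in> dp_cochains. c = bar_diff h" if "\<And>xs. length xs \<ge> N \<Longrightarrow> c xs = 0" for N
    using that assms
  proof (induction N arbitrary: c)
    case 0
    then have "c = bar_diff (\<lambda>_. 0)"
      by (simp add: fun_eq_iff bar_diff_zero)
    moreover have "(\<lambda>_. 0) \<in> dp_cochains"
      by (auto simp: dp_cochains_def)
    ultimately show ?case by blast
  next
    case (Suc N)
    define h where "h = (\<lambda>l. idem0 * c (idem0 # l) + idem1 * c (idem1 # l))"
    define c' where "c' = (\<lambda>l. idem0 * (eps0 * c (idem0 # l) + c (eps0 # l)) + idem1 * (eps1 * c (idem1 # l) + c (eps1 # l)))"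
    have h: "h \<in> dp_cochains" and c': "c' \<in> dp_cochains"
      unfolding h_def c'_def
      by (intro dp_cochains_add dp_cochains_mult dp_cochains_shift Suc.prems)+
    \<comment> \<open>In degree 0 there is no argument from which y could be split off; the value
      there is a coefficient and vanishes by assumption.\<close>
    have "c [] = bar_coeff c 0"
      by (simp add: dp_eq_iff)
    then have "c [] = 0"
      using Suc.prems(4) by simp
    then have split: "c xs + bar_diff h xs = deriv_cup c' xs" for xs
      using split_off_deriv[OF Suc.prems(2,3)] by (cases xs) (simp_all add: h_def c'_def)
    have "deriv_cup (bar_diff c') xs = 0" for xs
      unfolding bar_diff_deriv_cup[symmetric]
      using split bar_diff_add[of c "bar_diff h" xs] Suc.prems(3) bar_diff_diff[OF dp_two]
      by (simp add: split)
    \<comment> \<open>The element (eps, eps) has derivative 1, so inserting it as first argument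
      removes the factor y.\<close>
    from this[of "DP 0 1 0 1 # xs" for xs] have "bar_diff c' xs = 0" for xs
      by (simp add: dp_eq_iff)
    moreover have "bar_coeff c' n = 0" for n
    proof -
      have "bar_coeff (deriv_cup c') (Suc n) = bar_coeff c (Suc n) + bar_coeff (bar_diff h) (Suc n)"
        unfolding split[symmetric, abs_def] by (simp add: dp_eq_iff)
      then show ?thesis
        using Suc.prems(4) bar_coeff_bar_diff[OF h] by (simp add: bar_coeff_deriv_cup)
    qed
    moreover have "c' xs = 0" if "length xs \<ge> N" for xs
      using Suc.prems(1) that by (simp add: c'_def)
    ultimately obtain h' where h': "h' \<in> dp_cochains" "c' = bar_diff h'"
      using Suc.IH c' by blast
    \<comment> \<open>Multiplying a primitive of \<open>c'\<close> by y gives a primitive of y times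
      \<open>c'\<close>; adding \<open>h\<close> undoes the initial correction.\<close>
    have "c xs = bar_diff (\<lambda>l. deriv_cup h' l + h l) xs" for xs
      using split[of xs]
      by (simp add: bar_diff_add bar_diff_deriv_cup h'(2) add_eq_iff_char2[OF dp_two])
    then show ?case
      using h h'(1) by (intro bexI[of _ "\<lambda>l. deriv_cup h' l + h l"]) (auto intro: dp_cochains_add deriv_cup_cochains)
  qed
  moreover obtain N where "\<And>xs. length xs \<ge> Suc N \<Longrightarrow> c xs = 0"
    using dp_cochains_bound[OF assms(1)] by (metis Suc_le_lessD)
  ultimately show ?thesis by blast
qed

end

section \<open>Symbols of cochains in the polynomial ring over the pair of dual numbers\<close>

definition dp_poly :: "(nat \<Rightarrow> 'k::comm_ring_1 dp) \<Rightarrow> 'k poly dp" where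
  "dp_poly a = DP (Abs_poly (\<lambda>n. re0 (a n))) (Abs_poly (\<lambda>n. ep0 (a n)))
    (Abs_poly (\<lambda>n. re1 (a n))) (Abs_poly (\<lambda>n. ep1 (a n)))"

definition dp_coeff :: "'k::comm_ring_1 poly dp \<Rightarrow> nat \<Rightarrow> 'k dp" where
  "dp_coeff p n = DP (coeff (re0 p) n) (coeff (ep0 p) n) (coeff (re1 p) n) (coeff (ep1 p) n)"

lemma dp_coeff_sel [simp]:
  "re0 (dp_coeff p n) = coeff (re0 p) n" "ep0 (dp_coeff p n) = coeff (ep0 p) n"
  "re1 (dp_coeff p n) = coeff (re1 p) n" "ep1 (dp_coeff p n) = coeff (ep1 p) n"
  by (simp_all add: dp_coeff_def)

lemma dp_coeff_eqI: "(\<And>n. dp_coeff p n = dp_coeff q n) \<Longrightarrow> p = q"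
  by (simp add: dp_eq_iff poly_eq_iff dp_coeff_def)

lemma dp_coeff_dp_poly:
  assumes "\<And>n. n > N \<Longrightarrow> a n = 0"
  shows "dp_coeff (dp_poly a) n = a n"
  by (simp add: dp_poly_def dp_coeff_def coeff_Abs_poly[of N] assms)

lemma dp_coeff_eventually_0: "\<exists>N. \<forall>n>N. dp_coeff p n = 0"
proof (intro exI allI impI)
  fix n assume "n > degree (re0 p) + degree (ep0 p) + degree (re1 p) + degree (ep1 p)"
  then show "dp_coeff p n = 0"
    by (simp add: dp_coeff_def dp_eq_iff coeff_eq_0)
qed

lemma dp_coeff_add: "dp_coeff (p + q) n = dp_coeff p n + dp_coeff q n"
  by (simp add: dp_eq_iff)

lemma dp_coeff_mult: "dp_coeff (p * q) n = (\<Sum>i\<le>n. dp_coeff p i * dp_coeff q (n - i))"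
  by (simp add: dp_eq_iff coeff_mult sum.distrib)

text \<open>The target is the polynomial ring in y over a pair of dual numbers with the two layers
  exchanged, so that \<open>'k poly dp\<close> gets its ring structure from existing instances.
  \<open>Abs_poly\<close> is faithful here because cochains vanish in large degrees.\<close>

definition bar_symbol :: "('k::comm_ring_1 dp list \<Rightarrow> 'k dp) \<Rightarrow> 'k poly dp" where
  "bar_symbol c = dp_poly (bar_coeff c)"

lemma dp_coeff_bar_symbol:
  assumes "c \<in> dp_cochains"
  shows "dp_coeff (bar_symbol c) n = bar_coeff c n"
proof -
  obtain N where "\<And>xs. length xs > N \<Longrightarrow> c xs = 0"
    using assms dp_cochains_bound by metis
  then show ?thesis
    unfolding bar_symbol_def by (intro dp_coeff_dp_poly[of N]) (simp add: dp_eq_iff)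
qed

text \<open>Prefixes and suffixes of a constant list are constant, so the cup product becomes a
  convolution of coefficients.\<close>

lemma bar_coeff_cup: "bar_coeff (cup c e) n = (\<Sum>i\<le>n. bar_coeff c i * bar_coeff e (n - i))"
  by (simp add: dp_eq_iff cup_def sum.distrib min_def)

lemma bar_symbol_add:
  assumes "c \<in> dp_cochains" "e \<in> dp_cochains"
  shows "bar_symbol (\<lambda>l. c l + e l) = bar_symbol c + bar_symbol e"
  by (intro dp_coeff_eqI)
    (simp add: dp_coeff_add dp_coeff_bar_symbol assms dp_cochains_add; simp add: dp_eq_iff)

lemma bar_symbol_cup:
  assumes "c \<in> dp_cochains" "e \<in> dp_cochains"
  shows "bar_symbol (cup c e) = bar_symbol c * bar_symbol e"
  by (intro dp_coeff_eqI)
    (simp add: dp_coeff_mult dp_coeff_bar_symbol assms cup_cochains bar_coeff_cup)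

lemma power_cochain_symbol:
  "power_cochain (dp_coeff p) \<in> dp_cochains" "bar_symbol (power_cochain (dp_coeff p)) = p"
proof -
  show *: "power_cochain (dp_coeff p) \<in> dp_cochains"
    using dp_coeff_eventually_0[of p] power_cochain_cochains by blast
  show "bar_symbol (power_cochain (dp_coeff p)) = p"
    by (intro dp_coeff_eqI) (simp add: dp_coeff_bar_symbol * bar_coeff_power_cochain)
qed

section \<open>Algebras modelled on type classes\<close>

text \<open>An algebra isomorphism from a whole type onto \<open>Q\<close>. Ring arithmetic can then
  be done in the type class, and the scalar map \<open>sc\<close> absorbs the different ways in
  which the field sits in the models.\<close>

definition alg_model :: "('k \<Rightarrow> 'c::comm_ring_1) \<Rightarrow> ('c \<Rightarrow> 'q) \<Rightarrow> ('k, 'q) module \<Rightarrow> bool" where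
  "alg_model sc \<beta> Q \<longleftrightarrow> inj \<beta> \<and> carrier Q = range \<beta> \<and>
    (\<forall>z w. \<beta> z \<otimes>\<^bsub>Q\<^esub> \<beta> w = \<beta> (z * w)) \<and> \<one>\<^bsub>Q\<^esub> = \<beta> 1 \<and>
    (\<forall>z w. \<beta> z \<oplus>\<^bsub>Q\<^esub> \<beta> w = \<beta> (z + w)) \<and> \<zero>\<^bsub>Q\<^esub> = \<beta> 0 \<and>
    (\<forall>c z. c \<odot>\<^bsub>Q\<^esub> \<beta> z = \<beta> (sc c * z))"

lemma alg_modelD:
  assumes "alg_model sc \<beta> Q"
  shows "inj \<beta>" "carrier Q = range \<beta>" "\<beta> z \<otimes>\<^bsub>Q\<^esub> \<beta> w = \<beta> (z * w)" "\<one>\<^bsub>Q\<^esub> = \<beta> 1"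
    "\<beta> z \<oplus>\<^bsub>Q\<^esub> \<beta> w = \<beta> (z + w)" "\<zero>\<^bsub>Q\<^esub> = \<beta> 0" "c \<odot>\<^bsub>Q\<^esub> \<beta> z = \<beta> (sc c * z)" "inv_into UNIV \<beta> (\<beta> z) = z"
  using assms by (auto simp: alg_model_def)

lemma alg_model_iso:
  assumes Q: "alg_model sc \<beta> Q" and Q': "alg_model sc \<beta>' Q'"
  shows "\<beta>' \<circ> inv_into UNIV \<beta> \<in> algebra_iso Q Q'"
proof -
  have "\<beta>' \<circ> inv_into UNIV \<beta> \<in> ring_hom Q Q'"
    by (rule ring_hom_memI) (auto simp: alg_modelD[OF Q] alg_modelD[OF Q'])
  moreover have "bij_betw (\<beta>' \<circ> inv_into UNIV \<beta>) (carrier Q) (carrier Q')"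
    unfolding alg_modelD(2)[OF Q] alg_modelD(2)[OF Q']
    by (rule bij_betw_trans[of _ _ UNIV])
      (simp_all add: alg_modelD(1)[OF Q] alg_modelD(1)[OF Q'] inj_imp_bij_betw_inv bij_betw_imageI)
  ultimately show ?thesis
    by (auto simp: algebra_iso_def ring_iso_def alg_modelD[OF Q] alg_modelD[OF Q'])
qed

lemma alg_model_cring:
  assumes "alg_model sc \<beta> Q"
  shows "cring Q"
proof (rule cringI)
  note [simp] = alg_modelD[OF assms]
  show "abelian_group Q"
  proof (rule abelian_groupI)
    fix x assume "x \<in> carrier Q"
    then obtain z where "x = \<beta> z" by auto
    then have "\<beta> (- z) \<oplus>\<^bsub>Q\<^esub> x = \<zero>\<^bsub>Q\<^esub>" by simp
    then show "\<exists>y\<in>carrier Q. y \<oplus>\<^bsub>Q\<^esub> x = \<zero>\<^bsub>Q\<^esub>" by auto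
  qed (auto simp: add_ac)
  show "comm_monoid Q"
    by (rule comm_monoidI) (auto simp: mult_ac)
qed (auto simp: alg_modelD[OF assms] algebra_simps)

lemma alg_model_finsum:
  assumes "alg_model sc \<beta> Q" "finite A"
  shows "(\<Oplus>\<^bsub>Q\<^esub>i\<in>A. \<beta> (f i)) = \<beta> (\<Sum>i\<in>A. f i)"
proof -
  interpret cring Q using assms(1) by (rule alg_model_cring)
  show ?thesis
    using assms(2)
    by (induction A) (auto simp: finsum_insert alg_modelD[OF assms(1)] Pi_iff)
qed

text \<open>The fibres of a surjective homomorphism \<open>H\<close> are the elements of the quotient by its kernel.\<close>
definition fib :: "('k, 'a) module \<Rightarrow> ('a \<Rightarrow> 'c) \<Rightarrow> 'c \<Rightarrow> 'a set" where
  "fib A H z = {x \<in> carrier A. H x = z}"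

lemma fib_coset:
  assumes "abelian_group A"
    and add: "\<And>x y. x \<in> carrier A \<Longrightarrow> y \<in> carrier A \<Longrightarrow> H (x \<oplus>\<^bsub>A\<^esub> y) = H x + (H y :: 'c::comm_ring_1)"
    and x: "x \<in> carrier A"
  shows "fib A H 0 +>\<^bsub>A\<^esub> x = fib A H (H x)"
proof -
  interpret abelian_group A by fact
  have "y \<in> (\<Union>h\<in>fib A H 0. {h \<oplus>\<^bsub>A\<^esub> x})" if y: "y \<in> carrier A" "H y = H x" for y
  proof -
    have *: "(y \<ominus>\<^bsub>A\<^esub> x) \<oplus>\<^bsub>A\<^esub> x = y"
      using x y(1) by (simp add: a_minus_def a_assoc l_neg)
    then have "H (y \<ominus>\<^bsub>A\<^esub> x) + H x = H y"
      using add[of "y \<ominus>\<^bsub>A\<^esub> x" x] x y by simp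
    then have "y \<ominus>\<^bsub>A\<^esub> x \<in> fib A H 0"
      using x y by (simp add: fib_def)
    with * show ?thesis by force
  qed
  then show ?thesis
    using x by (auto simp: a_r_coset_def' fib_def add)
qed

text \<open>The first isomorphism theorem for a carrier whose product is only known to be closed:
  the ring laws of the quotient come from the target. This suits Hochschild cocycles, of which only
  the additive group is established.\<close>

lemma fib_model:
  fixes H :: "'a \<Rightarrow> 'c::comm_ring_1"
  assumes A: "abelian_group A"
    and closed: "\<And>x y. x \<in> carrier A \<Longrightarrow> y \<in> carrier A \<Longrightarrow> x \<otimes>\<^bsub>A\<^esub> y \<in> carrier A" "\<one>\<^bsub>A\<^esub> \<in> carrier A"
      "\<And>c x. x \<in> carrier A \<Longrightarrow> c \<odot>\<^bsub>A\<^esub> x \<in> carrier A"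
    and add: "\<And>x y. x \<in> carrier A \<Longrightarrow> y \<in> carrier A \<Longrightarrow> H (x \<oplus>\<^bsub>A\<^esub> y) = H x + H y"
    and mult: "\<And>x y. x \<in> carrier A \<Longrightarrow> y \<in> carrier A \<Longrightarrow> H (x \<otimes>\<^bsub>A\<^esub> y) = H x * H y"
    and one: "H \<one>\<^bsub>A\<^esub> = 1"
    and smult: "\<And>c x. x \<in> carrier A \<Longrightarrow> H (c \<odot>\<^bsub>A\<^esub> x) = sc c * H x"
    and surj: "\<And>z. \<exists>x\<in>carrier A. H x = z"
  shows "alg_model sc (fib A H) (quot_algebra A (fib A H 0))" (is "alg_model _ _ ?Q")
proof -
  interpret abelian_group A by fact
  note coset = fib_coset[OF A add]
  have ne: "\<exists>x. x \<in> fib A H z" for z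
    using surj[of z] by (auto simp: fib_def)
  have "inj (fib A H)"
  proof (rule injI)
    fix z w assume "fib A H z = fib A H w"
    with ne[of z] show "z = w" by (auto simp: fib_def)
  qed
  moreover have "carrier ?Q = range (fib A H)"
  proof -
    have "carrier ?Q = (\<lambda>x. fib A H (H x)) ` carrier A"
      using coset by (auto simp: quot_algebra_def FactRing_def A_RCOSETS_def RCOSETS_def a_r_coset_def)
    also have "\<dots> = range (fib A H)"
      using surj by (auto simp: image_iff) metis
    finally show ?thesis .
  qed
  moreover have "fib A H z \<otimes>\<^bsub>?Q\<^esub> fib A H w = fib A H (z * w)" for z w
  proof -
    have "fib A H z \<otimes>\<^bsub>?Q\<^esub> fib A H w =
        (\<Union>x\<in>fib A H z. \<Union>y\<in>fib A H w. fib A H 0 +>\<^bsub>A\<^esub> (x \<otimes>\<^bsub>A\<^esub> y))"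
      by (simp add: quot_algebra_def FactRing_def rcoset_mult_def)
    \<comment> \<open>The product of cosets is a union over representatives; all its members are the
      same fibre, and nonemptiness lets the union collapse.\<close>
    also have "\<dots> = (\<Union>x\<in>fib A H z. \<Union>y\<in>fib A H w. fib A H (z * w))"
      by (intro SUP_cong refl) (auto simp: fib_def[of A H z] fib_def[of A H w] coset closed mult)
    also have "\<dots> = fib A H (z * w)"
      using ne by auto
    finally show ?thesis .
  qed
  moreover have "fib A H z \<oplus>\<^bsub>?Q\<^esub> fib A H w = fib A H (z + w)" for z w
  proof -
    \<comment> \<open>The sum of cosets is setwise, so an element over \<open>z + w\<close> is split
      explicitly by subtracting some element over \<open>w\<close>.\<close>
    have "y \<in> set_mult (add_monoid A) (fib A H z) (fib A H w)" if "y \<in> fib A H (z + w)" for y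
    proof -
      obtain x where x: "x \<in> carrier A" "H x = w" using surj by blast
      have y: "y \<in> carrier A" "H y = z + w" using that by (auto simp: fib_def)
      have *: "(y \<ominus>\<^bsub>A\<^esub> x) \<oplus>\<^bsub>A\<^esub> x = y"
        using x(1) y(1) by (simp add: a_minus_def a_assoc l_neg)
      then have "H (y \<ominus>\<^bsub>A\<^esub> x) + H x = H y"
        using add[of "y \<ominus>\<^bsub>A\<^esub> x" x] x y by simp
      then have "y \<ominus>\<^bsub>A\<^esub> x \<in> fib A H z" "x \<in> fib A H w"
        using x y by (simp_all add: fib_def)
      then have "(y \<ominus>\<^bsub>A\<^esub> x) \<oplus>\<^bsub>A\<^esub> x \<in> set_mult (add_monoid A) (fib A H z) (fib A H w)"
        unfolding set_mult_def by auto
      then show ?thesis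
        by (simp add: *)
    qed
    then show ?thesis
      by (auto simp: quot_algebra_def FactRing_def set_add_def set_mult_def fib_def add)
  qed
  moreover have "c \<odot>\<^bsub>?Q\<^esub> fib A H z = fib A H (sc c * z)" for c z
  proof -
    have "c \<odot>\<^bsub>?Q\<^esub> fib A H z = (\<Union>x\<in>fib A H z. fib A H 0 +>\<^bsub>A\<^esub> (c \<odot>\<^bsub>A\<^esub> x))"
      by (simp add: quot_algebra_def)
    also have "\<dots> = (\<Union>x\<in>fib A H z. fib A H (sc c * z))"
      by (intro SUP_cong refl) (auto simp: fib_def[of A H z] coset closed smult)
    also have "\<dots> = fib A H (sc c * z)"
      using ne by auto
    finally show ?thesis .
  qed
  moreover have "\<one>\<^bsub>?Q\<^esub> = fib A H 1"
    by (simp add: quot_algebra_def FactRing_def coset closed one)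
  moreover have "\<zero>\<^bsub>?Q\<^esub> = fib A H 0"
    by (simp add: quot_algebra_def FactRing_def)
  ultimately show ?thesis
    by (simp add: alg_model_def)
qed

text \<open>Actions on quotients are defined as images of cosets, and such an image might be only
  part of a fibre. The right inverse \<open>P'\<close>, compatible with the symbol, shows that it is
  all of it.\<close>

lemma image_fib:
  assumes "\<And>x. x \<in> carrier A \<Longrightarrow> P x \<in> carrier A" "\<And>x. x \<in> carrier A \<Longrightarrow> P' x \<in> carrier A"
    and "\<And>x. x \<in> carrier A \<Longrightarrow> P (P' x) = x"
    and "\<And>x. x \<in> carrier A \<Longrightarrow> H (P x) = star (H x)" "\<And>x. x \<in> carrier A \<Longrightarrow> H (P' x) = star' (H x)"
    and "\<And>z. star' (star z) = z"
  shows "P ` fib A H z = fib A H (star z)"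
proof -
  have "y \<in> P ` fib A H z" if "y \<in> fib A H (star z)" for y
    using that assms by (intro image_eqI[of _ _ "P' y"]) (auto simp: fib_def)
  then show ?thesis
    using assms by (auto simp: fib_def)
qed

section \<open>Torus actions on the models\<close>

text \<open>The local finiteness clause of \<open>rational_rep\<close>, phrased with sums in the
  model.\<close>

definition loc_fin :: "'k::field mat2 set \<Rightarrow> ('k \<Rightarrow> 'c::comm_ring_1) \<Rightarrow> ('k mat2 \<Rightarrow> 'c \<Rightarrow> 'c) \<Rightarrow> 'c \<Rightarrow> bool" where
  "loc_fin G sc \<rho> z \<longleftrightarrow> (\<exists>(n::nat) w r. (\<forall>i<n. r i \<in> coord_ring G) \<and>
     (\<forall>s\<in>G. \<rho> s z = (\<Sum>i<n. sc (r i s) * w i)))"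

lemma loc_fin_0: "(\<And>s. s \<in> G \<Longrightarrow> \<rho> s 0 = 0) \<Longrightarrow> loc_fin G sc \<rho> 0"
  unfolding loc_fin_def by (intro exI[of _ 0]) simp

lemma loc_fin_weight:
  assumes "r \<in> coord_ring G" "\<And>s. s \<in> G \<Longrightarrow> \<rho> s z = sc (r s) * z"
  shows "loc_fin G sc \<rho> z"
  unfolding loc_fin_def
  using assms by (intro exI[of _ "Suc 0"] exI[of _ "\<lambda>_. z"] exI[of _ "\<lambda>_. r"]) simp

lemma loc_fin_add:
  assumes "loc_fin G sc \<rho> z" "loc_fin G sc \<rho> z'"
    and "\<And>s. s \<in> G \<Longrightarrow> \<rho> s (z + z') = \<rho> s z + \<rho> s z'"
  shows "loc_fin G sc \<rho> (z + z')"
proof -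
  obtain n w r where 1: "\<forall>i<(n::nat). r i \<in> coord_ring G" "\<forall>s\<in>G. \<rho> s z = (\<Sum>i<n. sc (r i s) * w i)"
    using assms(1) by (auto simp: loc_fin_def)
  obtain m v q where 2: "\<forall>i<(m::nat). q i \<in> coord_ring G" "\<forall>s\<in>G. \<rho> s z' = (\<Sum>i<m. sc (q i s) * v i)"
    using assms(2) by (auto simp: loc_fin_def)
  have sum: "(\<Sum>i<n + m. f i) = (\<Sum>i<n. f i) + (\<Sum>i<m. f (n + i))" for f :: "nat \<Rightarrow> 'b"
    by (induction m) (simp_all add: add_ac)
  show ?thesis
    unfolding loc_fin_def
    using 1 2 assms(3)
    by (intro exI[of _ "n + m"] exI[of _ "\<lambda>i. if i < n then w i else v (i - n)"]
        exI[of _ "\<lambda>i. if i < n then r i else q (i - n)"]) (auto simp: sum)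
qed

lemma loc_fin_sum:
  assumes "finite A" "\<And>i. i \<in> A \<Longrightarrow> loc_fin G sc \<rho> (f i)"
    and "\<And>s z z'. s \<in> G \<Longrightarrow> \<rho> s (z + z') = \<rho> s z + \<rho> s z'" "\<And>s. s \<in> G \<Longrightarrow> \<rho> s 0 = 0"
  shows "loc_fin G sc \<rho> (\<Sum>i\<in>A. f i)"
  using assms by (induction A) (auto intro: loc_fin_add loc_fin_0)

text \<open>All actions here pass through one character \<open>\<kappa>\<close>; the group laws are
  then formal, and rationality is reduced to local finiteness.\<close>

lemma model_rational_rep:
  assumes Q: "alg_model sc \<beta> Q"
    and "\<And>c z w. star c (z + w) = star c z + star c w" "\<And>c a z. star c (sc a * z) = sc a * star c z"
    and "\<And>z. star 1 z = z" "\<And>c d z. star (c * d) z = star c (star d z)"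
    and "\<kappa> (mat 1) = 1" "\<And>s t. s \<in> G \<Longrightarrow> t \<in> G \<Longrightarrow> \<kappa> (s ** t) = \<kappa> s * \<kappa> t"
    and loc: "\<And>z. loc_fin G sc (\<lambda>s. star (\<kappa> s)) z"
  shows "rational_rep G Q (\<lambda>s x. \<beta> (star (\<kappa> s) (inv_into UNIV \<beta> x)))"
proof -
  note [simp] = alg_modelD[OF Q]
  have "\<exists>(n::nat) w r. (\<forall>i<n. w i \<in> range \<beta> \<and> r i \<in> coord_ring G) \<and>
       (\<forall>t\<in>G. \<beta> (star (\<kappa> t) z) = (\<Oplus>\<^bsub>Q\<^esub>i\<in>{..<n}. r i t \<odot>\<^bsub>Q\<^esub> w i))" for z
  proof -
    obtain n w r where "\<forall>i<(n::nat). r i \<in> coord_ring G" "\<forall>s\<in>G. star (\<kappa> s) z = (\<Sum>i<n. sc (r i s) * w i)"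
      using loc[of z] by (auto simp: loc_fin_def)
    then show ?thesis
      by (intro exI[of _ n] exI[of _ "\<lambda>i. \<beta> (w i)"] exI[of _ r]) (auto simp: alg_model_finsum[OF Q])
  qed
  then show ?thesis
    using assms by (auto simp: rational_rep_def)
qed

text \<open>\<open>\<kappa>\<close> is meant as the character on the dual of the Lie algebra. The
  nilpotents lie on the side of the Lie algebra and are scaled by its inverse, whereas the
  polynomial variable is scaled by \<open>\<kappa>\<close> itself.\<close>

definition dp_torus :: "'k::field \<Rightarrow> 'k dp \<Rightarrow> 'k dp" where
  "dp_torus \<kappa> z = DP (re0 z) (ep0 z / \<kappa>) (re1 z) (ep1 z / \<kappa>)"

definition poly_torus :: "'k::field \<Rightarrow> 'k poly \<Rightarrow> 'k poly" where
  "poly_torus \<kappa> p = pcompose p [:0, \<kappa>:]"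

definition dp_poly_torus :: "'k::field \<Rightarrow> 'k poly dp \<Rightarrow> 'k poly dp" where
  "dp_poly_torus \<kappa> z = DP (poly_torus \<kappa> (re0 z)) (Polynomial.smult (1 / \<kappa>) (poly_torus \<kappa> (ep0 z)))
    (poly_torus \<kappa> (re1 z)) (Polynomial.smult (1 / \<kappa>) (poly_torus \<kappa> (ep1 z)))"

abbreviation (input) poly_scal :: "'k::comm_ring_1 \<Rightarrow> 'k poly" where
  "poly_scal c \<equiv> [:c:]"

abbreviation (input) dp_poly_scal :: "'k::comm_ring_1 \<Rightarrow> 'k poly dp" where
  "dp_poly_scal c \<equiv> dscal [:c:]"

lemma coeff_poly_torus [simp]: "coeff (poly_torus \<kappa> p) n = \<kappa> ^ n * coeff p n"
  by (simp add: poly_torus_def coeff_pcompose_linear)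

lemma dp_torus_sel [simp]:
  "re0 (dp_torus \<kappa> z) = re0 z" "ep0 (dp_torus \<kappa> z) = ep0 z / \<kappa>"
  "re1 (dp_torus \<kappa> z) = re1 z" "ep1 (dp_torus \<kappa> z) = ep1 z / \<kappa>"
  by (simp_all add: dp_torus_def)

lemma dp_poly_torus_sel [simp]:
  "re0 (dp_poly_torus \<kappa> z) = poly_torus \<kappa> (re0 z)" "ep0 (dp_poly_torus \<kappa> z) = Polynomial.smult (1 / \<kappa>) (poly_torus \<kappa> (ep0 z))"
  "re1 (dp_poly_torus \<kappa> z) = poly_torus \<kappa> (re1 z)" "ep1 (dp_poly_torus \<kappa> z) = Polynomial.smult (1 / \<kappa>) (poly_torus \<kappa> (ep1 z))"
  by (simp_all add: dp_poly_torus_def)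

lemma dp_coeff_torus: "dp_coeff (dp_poly_torus \<kappa> z) n = dscal (\<kappa> ^ n) * dp_torus \<kappa> (dp_coeff z n)"
  by (simp add: dp_eq_iff)

lemma dp_torus_simps:
  "dp_torus \<kappa> (z + w) = dp_torus \<kappa> z + dp_torus \<kappa> w" "dp_torus \<kappa> (dscal a * z) = dscal a * dp_torus \<kappa> z"
  "dp_torus 1 z = z" "dp_torus (\<kappa> * \<psi>) z = dp_torus \<kappa> (dp_torus \<psi> z)" "dp_torus \<kappa> 0 = 0"
  "dp_torus \<kappa> (z * w) = dp_torus \<kappa> z * dp_torus \<kappa> w" "dp_torus \<kappa> 1 = 1"
  by (simp_all add: dp_eq_iff add_divide_distrib)

lemma poly_torus_simps:
  "poly_torus \<kappa> (p + q) = poly_torus \<kappa> p + poly_torus \<kappa> q" "poly_torus \<kappa> (poly_scal a * p) = poly_scal a * poly_torus \<kappa> p"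
  "poly_torus 1 p = p" "poly_torus (\<kappa> * \<psi>) p = poly_torus \<kappa> (poly_torus \<psi> p)" "poly_torus \<kappa> 0 = 0"
  "poly_torus \<kappa> (Polynomial.smult a p) = Polynomial.smult a (poly_torus \<kappa> p)"
  by (simp_all add: poly_eq_iff algebra_simps power_mult_distrib)

lemma poly_torus_mult: "poly_torus \<kappa> (p * q) = poly_torus \<kappa> p * poly_torus \<kappa> q"
  by (simp add: poly_torus_def pcompose_mult)

lemma dp_poly_torus_simps:
  "dp_poly_torus \<kappa> (z + w) = dp_poly_torus \<kappa> z + dp_poly_torus \<kappa> w"
  "dp_poly_torus \<kappa> (dp_poly_scal a * z) = dp_poly_scal a * dp_poly_torus \<kappa> z"
  "dp_poly_torus 1 z = z" "dp_poly_torus (\<kappa> * \<psi>) z = dp_poly_torus \<kappa> (dp_poly_torus \<psi> z)" "dp_poly_torus \<kappa> 0 = 0"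
  "dp_poly_torus \<kappa> (z * w) = dp_poly_torus \<kappa> z * dp_poly_torus \<kappa> w"
  by (simp_all add: dp_eq_iff poly_torus_simps poly_torus_mult smult_add_right algebra_simps)

lemma coord_ring_power:
  assumes "\<kappa> \<in> coord_ring G"
  shows "\<exists>r\<in>coord_ring G. \<forall>s\<in>G. r s = \<kappa> s ^ n"
proof (induction n)
  case 0
  show ?case
    by (intro bexI[of _ "restr G (\<lambda>_. 1)"]) (auto simp: restr_def coord_ring.const[unfolded restr_def])
next
  case (Suc n)
  then obtain r where "r \<in> coord_ring G" "\<forall>s\<in>G. r s = \<kappa> s ^ n" by blast
  then show ?case
    using coord_ring.mult[OF assms] by (intro bexI[of _ "\<lambda>s. \<kappa> s * r s"]) auto
qed

context
  fixes G :: "'k::field mat2 set" and \<kappa> :: "'k mat2 \<Rightarrow> 'k"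
  assumes \<kappa>: "\<kappa> \<in> coord_ring G" and \<kappa>': "(\<lambda>s. 1 / \<kappa> s) \<in> coord_ring G"
begin

lemma loc_fin_dp_torus: "loc_fin G dscal (\<lambda>s. dp_torus (\<kappa> s)) z"
proof -
  obtain r where r: "r \<in> coord_ring G" "\<forall>s\<in>G. r s = \<kappa> s ^ 0"
    using coord_ring_power[OF \<kappa>] by blast
  have "loc_fin G dscal (\<lambda>s. dp_torus (\<kappa> s)) (DP (re0 z) 0 (re1 z) 0 + DP 0 (ep0 z) 0 (ep1 z))"
  proof (rule loc_fin_add)
    show "loc_fin G dscal (\<lambda>s. dp_torus (\<kappa> s)) (DP (re0 z) 0 (re1 z) 0)"
      by (rule loc_fin_weight[OF r(1)]) (use r in \<open>simp add: dp_eq_iff\<close>)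
    show "loc_fin G dscal (\<lambda>s. dp_torus (\<kappa> s)) (DP 0 (ep0 z) 0 (ep1 z))"
      by (rule loc_fin_weight[OF \<kappa>']) (simp add: dp_eq_iff)
  qed (simp add: dp_torus_simps)
  also have "DP (re0 z) 0 (re1 z) 0 + DP 0 (ep0 z) 0 (ep1 z) = z"
    by (simp add: dp_eq_iff)
  finally show ?thesis .
qed

lemma loc_fin_poly_torus: "loc_fin G poly_scal (\<lambda>s. poly_torus (\<kappa> s)) p"
proof -
  have "loc_fin G poly_scal (\<lambda>s. poly_torus (\<kappa> s)) (\<Sum>i\<le>degree p. monom (coeff p i) i)"
  proof (rule loc_fin_sum)
    fix i
    obtain r where r: "r \<in> coord_ring G" "\<forall>s\<in>G. r s = \<kappa> s ^ i"
      using coord_ring_power[OF \<kappa>] by blast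
    show "loc_fin G poly_scal (\<lambda>s. poly_torus (\<kappa> s)) (monom (coeff p i) i)"
      by (rule loc_fin_weight[OF r(1)]) (use r in \<open>simp add: poly_eq_iff\<close>)
  qed (simp_all add: poly_torus_simps)
  then show ?thesis
    by (simp add: poly_as_sum_of_monoms)
qed

text \<open>Decomposition into weight vectors: monomials of degree i have weight
  \<open>\<kappa> ^ i\<close> over the idempotents and \<open>\<kappa> ^ i / \<kappa>\<close> over
  the nilpotents.\<close>

lemma loc_fin_dp_poly_torus: "loc_fin G dp_poly_scal (\<lambda>s. dp_poly_torus (\<kappa> s)) z"
proof -
  let ?f = "\<lambda>i. DP (monom (coeff (re0 z) i) i) 0 (monom (coeff (re1 z) i) i) 0"
  let ?g = "\<lambda>i. DP 0 (monom (coeff (ep0 z) i) i) 0 (monom (coeff (ep1 z) i) i)"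
  obtain N where N: "degree (re0 z) \<le> N" "degree (ep0 z) \<le> N" "degree (re1 z) \<le> N" "degree (ep1 z) \<le> N"
    by (rule that[of "degree (re0 z) + degree (ep0 z) + degree (re1 z) + degree (ep1 z)"]) simp_all
  have "loc_fin G dp_poly_scal (\<lambda>s. dp_poly_torus (\<kappa> s)) (\<Sum>i\<le>N. ?f i + ?g i)"
  proof (rule loc_fin_sum)
    fix i
    obtain r where r: "r \<in> coord_ring G" "\<forall>s\<in>G. r s = \<kappa> s ^ i"
      using coord_ring_power[OF \<kappa>] by blast
    show "loc_fin G dp_poly_scal (\<lambda>s. dp_poly_torus (\<kappa> s)) (?f i + ?g i)"
    proof (rule loc_fin_add)
      show "loc_fin G dp_poly_scal (\<lambda>s. dp_poly_torus (\<kappa> s)) (?f i)"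
        by (rule loc_fin_weight[OF r(1)]) (use r in \<open>simp add: dp_eq_iff poly_eq_iff\<close>)
      show "loc_fin G dp_poly_scal (\<lambda>s. dp_poly_torus (\<kappa> s)) (?g i)"
        by (rule loc_fin_weight[OF coord_ring.mult[OF r(1) \<kappa>']]) (use r in \<open>simp add: dp_eq_iff poly_eq_iff\<close>)
    qed (simp add: dp_poly_torus_simps)
  qed (simp_all add: dp_poly_torus_simps)
  also have "(\<Sum>i\<le>N. ?f i + ?g i) = z"
    by (simp add: dp_eq_iff poly_as_sum_of_monoms' N)
  finally show ?thesis .
qed

end

lemma model_frob_descent:
  assumes "alg_model sc \<beta> Q"
    and "rational_rep (frob ` T) Q (\<lambda>s x. \<beta> (star (\<kappa> s) (inv_into UNIV \<beta> x)))"
    and "\<And>t z. t \<in> T \<Longrightarrow> \<rho> t (\<beta> z) = \<beta> (star (\<kappa> (frob t)) z)"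
  shows "frob_descent T Q \<rho> (\<lambda>s x. \<beta> (star (\<kappa> s) (inv_into UNIV \<beta> x)))"
  using assms by (auto simp: frob_descent_def alg_modelD[OF assms(1)])

section \<open>Hochschild cohomology of a pair of dual numbers\<close>

definition to_model :: "('b \<Rightarrow> 'a) \<Rightarrow> ('a list \<Rightarrow> 'a) \<Rightarrow> 'b list \<Rightarrow> 'b" where
  "to_model j c zs = inv_into UNIV j (c (map j zs))"

text \<open>The value zero off the carrier is the convention of \<open>hoch_cochains\<close>; it
  makes this map a bijection between the two kinds of cochains.\<close>

definition from_model :: "('k, 'a) module \<Rightarrow> ('b \<Rightarrow> 'a) \<Rightarrow> ('b list \<Rightarrow> 'b) \<Rightarrow> 'a list \<Rightarrow> 'a" where
  "from_model D j e xs = (if set xs \<subseteq> carrier D then j (e (map (inv_into UNIV j) xs)) else \<zero>\<^bsub>D\<^esub>)"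

definition hoch_symbol :: "('k::comm_ring_1 dp \<Rightarrow> 'a) \<Rightarrow> ('a list \<Rightarrow> 'a) \<Rightarrow> 'k poly dp" where
  "hoch_symbol j c = bar_symbol (to_model j c)"

definition dp_cocycles :: "('k::comm_ring_1 dp list \<Rightarrow> 'k dp) set" where
  "dp_cocycles = {e \<in> dp_cochains. bar_diff e = (\<lambda>_. 0)}"

context
  fixes D :: "('k::field, 'a) module" and j :: "'k dp \<Rightarrow> 'a"
  assumes D: "alg_model dscal j D" and two: "(2::'k) = 0"
begin

interpretation cring D
  using D by (rule alg_model_cring)

lemma dp_torus_dscal: "dp_torus \<kappa> (dscal a) = dscal a"
  by (simp add: dp_eq_iff)

lemma set_subset_carrier_iff: "set xs \<subseteq> carrier D \<longleftrightarrow> (\<exists>zs. xs = map j zs)"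
proof
  assume "set xs \<subseteq> carrier D"
  then have "xs = map j (map (inv_into UNIV j) xs)"
    by (auto simp: alg_modelD(2)[OF D] f_inv_into_f map_idI intro!: map_idI[symmetric])
  then show "\<exists>zs. xs = map j zs" ..
qed (auto simp: alg_modelD(2)[OF D])

lemma from_model_map [simp]: "from_model D j e (map j zs) = j (e zs)"
  by (auto simp: from_model_def alg_modelD[OF D] comp_def)

lemma from_model_eqI:
  assumes "\<And>zs. f (map j zs) = j (e zs)" "\<And>xs. \<not> set xs \<subseteq> carrier D \<Longrightarrow> f xs = \<zero>\<^bsub>D\<^esub>"
  shows "f = from_model D j e"
proof
  fix xs show "f xs = from_model D j e xs"
  proof (cases "set xs \<subseteq> carrier D")
    case True
    then obtain zs where "xs = map j zs" using set_subset_carrier_iff by blast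
    then show ?thesis by (simp add: assms(1))
  next
    case False
    then show ?thesis by (simp add: assms(2)) (simp add: from_model_def)
  qed
qed

lemma from_model_outside: "\<not> set xs \<subseteq> carrier D \<Longrightarrow> from_model D j e xs = \<zero>\<^bsub>D\<^esub>"
  by (simp add: from_model_def)

lemma to_model_from_model [simp]: "to_model j (from_model D j e) = e"
  by (simp add: to_model_def fun_eq_iff alg_modelD[OF D])

lemma hoch_symbol_from_model [simp]: "hoch_symbol j (from_model D j e) = bar_symbol e"
  by (simp add: hoch_symbol_def)

lemma from_model_cochains:
  assumes "e \<in> dp_cochains"
  shows "from_model D j e \<in> hoch_cochains D"
proof -
  note [simp] = alg_modelD(3-)[OF D]
  let ?f = "from_model D j e"
  have "?f (xs @ (x \<oplus>\<^bsub>D\<^esub> y) # ys) = ?f (xs @ x # ys) \<oplus>\<^bsub>D\<^esub> ?f (xs @ y # ys)"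
    if sub: "set (xs @ x # y # ys) \<subseteq> carrier D" for xs ys x y
  proof -
    obtain us vs a b where *: "xs = map j us" "ys = map j vs" "x = j a" "y = j b"
      using sub set_subset_carrier_iff[of xs] set_subset_carrier_iff[of ys]
      by (auto simp: alg_modelD(2)[OF D])
    show ?thesis
      using from_model_map[of e "us @ (a + b) # vs"] from_model_map[of e "us @ a # vs"]
        from_model_map[of e "us @ b # vs"]
      by (simp add: * dp_cochains_add_arg[OF assms])
  qed
  moreover have "?f (xs @ (a \<odot>\<^bsub>D\<^esub> x) # ys) = a \<odot>\<^bsub>D\<^esub> ?f (xs @ x # ys)"
    if sub: "set (xs @ x # ys) \<subseteq> carrier D" for xs ys x a
  proof -
    obtain us vs b where *: "xs = map j us" "ys = map j vs" "x = j b"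
      using sub set_subset_carrier_iff[of xs] set_subset_carrier_iff[of ys]
      by (auto simp: alg_modelD(2)[OF D])
    show ?thesis
      using from_model_map[of e "us @ (dscal a * b) # vs"] from_model_map[of e "us @ b # vs"]
      by (simp add: * dp_cochains_scal_arg[OF assms])
  qed
  moreover have "?f xs \<in> carrier D" for xs
    by (auto simp: from_model_def alg_modelD(2)[OF D])
  moreover have "\<exists>N. \<forall>xs. length xs > N \<longrightarrow> ?f xs = \<zero>\<^bsub>D\<^esub>"
  proof -
    obtain N where "\<And>xs. length xs > N \<Longrightarrow> e xs = 0"
      using assms dp_cochains_bound by blast
    then show ?thesis by (intro exI[of _ N]) (simp add: from_model_def)
  qed
  ultimately show ?thesis
    by (simp add: hoch_cochains_def from_model_outside)
qed

lemma hoch_cochains_eq: "hoch_cochains D = from_model D j ` dp_cochains"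
proof
  show "from_model D j ` dp_cochains \<subseteq> hoch_cochains D"
    using from_model_cochains by blast
  show "hoch_cochains D \<subseteq> from_model D j ` dp_cochains"
  proof
    fix c assume c: "c \<in> hoch_cochains D"
    note [simp] = alg_modelD(3-)[OF D]
    have sub: "set (map j xs) \<subseteq> carrier D" for xs
      using set_subset_carrier_iff by blast
    then have "c (map j zs) \<in> range j" for zs
      using c alg_modelD(2)[OF D] unfolding hoch_cochains_def by blast
    then have cj: "c (map j zs) = j (to_model j c zs)" for zs
      by (simp add: to_model_def f_inv_into_f)
    have inj: "to_model j c zs = w" if "j (to_model j c zs) = j w" for zs w
      using that alg_modelD(1)[OF D] by (simp add: inj_eq)
    have add: "c (xs @ (x \<oplus>\<^bsub>D\<^esub> y) # ys) = c (xs @ x # ys) \<oplus>\<^bsub>D\<^esub> c (xs @ y # ys)"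
      if "set (xs @ x # y # ys) \<subseteq> carrier D" for xs x y ys
      using c that unfolding hoch_cochains_def by blast
    have scal: "c (xs @ (a \<odot>\<^bsub>D\<^esub> x) # ys) = a \<odot>\<^bsub>D\<^esub> c (xs @ x # ys)"
      if "set (xs @ x # ys) \<subseteq> carrier D" for xs x ys a
      using c that unfolding hoch_cochains_def by blast
    have "to_model j c \<in> dp_cochains"
    proof -
      obtain N where N: "\<forall>xs. length xs > N \<longrightarrow> c xs = \<zero>\<^bsub>D\<^esub>"
        using c by (auto simp: hoch_cochains_def)
      show ?thesis
      proof (rule dp_cochainsI)
        fix us vs :: "'k dp list" and a b s
        have "c (map j (us @ (a + b) # vs)) = c (map j (us @ a # vs)) \<oplus>\<^bsub>D\<^esub> c (map j (us @ b # vs))"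
          using add[of "map j us" "j a" "j b" "map j vs"] sub[of "us @ a # b # vs"] by simp
        then show "to_model j c (us @ (a + b) # vs) = to_model j c (us @ a # vs) + to_model j c (us @ b # vs)"
          unfolding cj by (intro inj) simp
        have "c (map j (us @ (dscal s * a) # vs)) = s \<odot>\<^bsub>D\<^esub> c (map j (us @ a # vs))"
          using scal[of "map j us" "j a" "map j vs" s] sub[of "us @ a # vs"] by simp
        then show "to_model j c (us @ (dscal s * a) # vs) = dscal s * to_model j c (us @ a # vs)"
          unfolding cj by (intro inj) simp
      next
        fix xs :: "'k dp list" assume "length xs > N"
        then show "to_model j c xs = 0"
          using N by (simp add: to_model_def)
      qed
    qed
    moreover have "c = from_model D j (to_model j c)"
      using cj c by (intro from_model_eqI) (auto simp: hoch_cochains_def)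
    ultimately show "c \<in> from_model D j ` dp_cochains" by blast
  qed
qed

lemma hoch_diff_from_model: "hoch_diff D (from_model D j e) = from_model D j (bar_diff e)"
proof (rule from_model_eqI)
  fix zs :: "'k dp list"
  note [simp] = alg_modelD(3-)[OF D]
  \<comment> \<open>All signs of the Hochschild differential become 1, so it agrees with the
    unsigned recursion.\<close>
  have minus_one: "(- 1) ^ n = (1::'k)" for n
    using two by (metis add_eq_0_iff one_add_one power_one)
  let ?f = "from_model D j e"
  show "hoch_diff D ?f (map j zs) = j (bar_diff e zs)"
  proof (cases zs)
    case (Cons z ws)
    let ?n = "length ws"
    let ?g = "\<lambda>i. e (take i zs @ (zs ! i * zs ! Suc i) # drop (i + 2) zs)"
    have sub: "set (map j zs) \<subseteq> carrier D"
      using set_subset_carrier_iff by blast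
    have "(\<Oplus>\<^bsub>D\<^esub>i\<in>{..<?n}. (- 1) ^ Suc i \<odot>\<^bsub>D\<^esub>
        ?f (take i (map j zs) @ (map j zs ! i \<otimes>\<^bsub>D\<^esub> map j zs ! Suc i) # drop (i + 2) (map j zs))) =
      (\<Oplus>\<^bsub>D\<^esub>i\<in>{..<?n}. j (?g i))"
    proof (rule finsum_cong')
      fix i assume "i \<in> {..<?n}"
      then have i: "i < length zs" "Suc i < length zs"
        using Cons by simp_all
      have "take i (map j zs) @ (map j zs ! i \<otimes>\<^bsub>D\<^esub> map j zs ! Suc i) # drop (i + 2) (map j zs) =
          map j (take i zs @ (zs ! i * zs ! Suc i) # drop (i + 2) zs)"
        using i by (simp add: take_map drop_map)
      then show "(- 1) ^ Suc i \<odot>\<^bsub>D\<^esub>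
        ?f (take i (map j zs) @ (map j zs ! i \<otimes>\<^bsub>D\<^esub> map j zs ! Suc i) # drop (i + 2) (map j zs)) = j (?g i)"
        by (simp only: from_model_map) (simp add: minus_one del: power_Suc)
    qed (auto simp: alg_modelD(2)[OF D])
    also have "\<dots> = j (\<Sum>i<?n. ?g i)"
      by (rule alg_model_finsum[OF D]) simp
    finally have sum: "(\<Oplus>\<^bsub>D\<^esub>i\<in>{..<?n}. (- 1) ^ Suc i \<odot>\<^bsub>D\<^esub>
        ?f (take i (map j zs) @ (map j zs ! i \<otimes>\<^bsub>D\<^esub> map j zs ! Suc i) # drop (i + 2) (map j zs))) =
      j (\<Sum>i<?n. ?g i)" .
    have "hoch_diff D ?f (map j zs) = hd (map j zs) \<otimes>\<^bsub>D\<^esub> ?f (tl (map j zs)) \<oplus>\<^bsub>D\<^esub> j (\<Sum>i<?n. ?g i)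
        \<oplus>\<^bsub>D\<^esub> (- 1) ^ Suc ?n \<odot>\<^bsub>D\<^esub> (?f (butlast (map j zs)) \<otimes>\<^bsub>D\<^esub> last (map j zs))"
      using sub unfolding sum[symmetric] by (simp add: hoch_diff_def Let_def Cons)
    also have "\<dots> = j (z * e ws) \<oplus>\<^bsub>D\<^esub> j (\<Sum>i<?n. ?g i) \<oplus>\<^bsub>D\<^esub> j (e (butlast zs) * last zs)"
      unfolding map_butlast[symmetric] minus_one
      by (simp only: from_model_map map_tl[symmetric]) (simp add: Cons last_map)
    also have "\<dots> = j (bar_diff e zs)"
      by (simp add: Cons bar_tail_sum add_ac)
    finally show ?thesis .
  qed (simp add: hoch_diff_def)
qed (auto simp: hoch_diff_def)

lemma from_model_zero: "from_model D j (\<lambda>_. 0) = (\<lambda>_. \<zero>\<^bsub>D\<^esub>)"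
  by (rule from_model_eqI[symmetric]) (simp_all add: alg_modelD[OF D])

lemma from_model_inj: "from_model D j e = from_model D j e' \<longleftrightarrow> e = e'"
  using to_model_from_model by metis

section \<open>The algebra of Hochschild cocycles in the model\<close>

lemma hoch_cocycles_carrier: "carrier (hoch_cocycles D) = from_model D j ` dp_cocycles"
  by (auto simp: hoch_cocycles_def hoch_cochains_eq dp_cocycles_def hoch_diff_from_model from_model_inj
      simp flip: from_model_zero)

lemma hoch_cocycles_add:
  "from_model D j a \<oplus>\<^bsub>hoch_cocycles D\<^esub> from_model D j b = from_model D j (\<lambda>l. a l + b l)"
  by (rule from_model_eqI) (simp_all add: hoch_cocycles_def from_model_outside alg_modelD[OF D])

lemma hoch_cocycles_smult:
  "s \<odot>\<^bsub>hoch_cocycles D\<^esub> from_model D j a = from_model D j (\<lambda>l. dscal s * a l)"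
  by (rule from_model_eqI) (simp_all add: hoch_cocycles_def from_model_outside alg_modelD[OF D])

lemma hoch_cocycles_zero: "\<zero>\<^bsub>hoch_cocycles D\<^esub> = from_model D j (\<lambda>_. 0)"
  by (simp add: hoch_cocycles_def from_model_zero)

lemma hoch_cocycles_one: "\<one>\<^bsub>hoch_cocycles D\<^esub> = from_model D j (\<lambda>l. if l = [] then 1 else 0)"
  by (rule from_model_eqI) (auto simp: hoch_cocycles_def alg_modelD[OF D])

lemma hoch_cocycles_mult:
  "from_model D j a \<otimes>\<^bsub>hoch_cocycles D\<^esub> from_model D j b = from_model D j (cup a b)"
proof (rule from_model_eqI)
  fix zs :: "'k dp list"
  have "set (map j zs) \<subseteq> carrier D"
    using set_subset_carrier_iff by blast
  then have "(from_model D j a \<otimes>\<^bsub>hoch_cocycles D\<^esub> from_model D j b) (map j zs) =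
     (\<Oplus>\<^bsub>D\<^esub>i\<in>{..length zs}. j (a (take i zs) * b (drop i zs)))"
    by (simp add: hoch_cocycles_def take_map drop_map alg_modelD(3)[OF D])
  then show "(from_model D j a \<otimes>\<^bsub>hoch_cocycles D\<^esub> from_model D j b) (map j zs) = j (cup a b zs)"
    by (simp add: alg_model_finsum[OF D] cup_def)
qed (simp add: hoch_cocycles_def)

lemma dp_cocyclesI: "e \<in> dp_cochains \<Longrightarrow> (\<And>l. bar_diff e l = 0) \<Longrightarrow> e \<in> dp_cocycles"
  by (auto simp: dp_cocycles_def)

lemma dp_cocyclesD: "e \<in> dp_cocycles \<Longrightarrow> e \<in> dp_cochains" "e \<in> dp_cocycles \<Longrightarrow> bar_diff e l = 0"
  by (auto simp: dp_cocycles_def)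

lemma dp_cocycles_add: "a \<in> dp_cocycles \<Longrightarrow> b \<in> dp_cocycles \<Longrightarrow> (\<lambda>l. a l + b l) \<in> dp_cocycles"
  by (intro dp_cocyclesI dp_cochains_add) (simp_all add: dp_cocyclesD bar_diff_add)

lemma bar_diff_mult: "bar_diff (\<lambda>l. s * e l) xs = s * bar_diff e xs"
  by (cases xs) (simp_all add: bar_tail_mult algebra_simps)

lemma dp_cocycles_mult: "a \<in> dp_cocycles \<Longrightarrow> (\<lambda>l. s * a l) \<in> dp_cocycles"
  by (intro dp_cocyclesI dp_cochains_mult) (simp_all add: dp_cocyclesD bar_diff_mult)

lemma dp_cocycles_zero: "(\<lambda>_. 0) \<in> dp_cocycles"
  by (intro dp_cocyclesI) (auto simp: dp_cochains_def bar_diff_zero)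

lemma dp_cocycles_cup:
  assumes "a \<in> dp_cocycles" "b \<in> dp_cocycles"
  shows "cup a b \<in> (dp_cocycles :: ('k dp list \<Rightarrow> 'k dp) set)"
proof (rule dp_cocyclesI)
  fix l
  have "bar_diff a = (\<lambda>_. 0)" "bar_diff b = (\<lambda>_. 0)"
    using assms by (auto simp: dp_cocyclesD)
  then show "bar_diff (cup a b) l = 0"
    by (simp add: bar_diff_cup[OF dp_two[OF two]] cup_def)
qed (simp add: assms cup_cochains dp_cocyclesD)

lemma power_cochain_cocycles: "power_cochain (dp_coeff p) \<in> (dp_cocycles :: ('k dp list \<Rightarrow> 'k dp) set)"
  by (intro dp_cocyclesI) (simp_all add: power_cochain_symbol bar_diff_power_cochain two)

text \<open>The unit is a power cochain, so its cocycle condition and its symbol need no separate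
  computation.\<close>

lemma unit_cochain: "(\<lambda>l. if l = [] then 1 else 0) = power_cochain (dp_coeff (1 :: 'k poly dp))"
  by (auto simp: fun_eq_iff power_cochain_def dp_eq_iff)

lemma dp_cocycles_coboundary: "e \<in> dp_cochains \<Longrightarrow> bar_diff e \<in> (dp_cocycles :: ('k dp list \<Rightarrow> 'k dp) set)"
  by (intro dp_cocyclesI) (simp_all add: bar_diff_cochains bar_diff_diff[OF dp_two[OF two]])

lemma bar_symbol_eq_0_iff:
  assumes "e \<in> (dp_cocycles :: ('k dp list \<Rightarrow> 'k dp) set)"
  shows "bar_symbol e = 0 \<longleftrightarrow> e \<in> bar_diff ` dp_cochains"
proof
  assume "bar_symbol e = 0"
  then have "bar_coeff e n = 0" for n
    using dp_coeff_bar_symbol[OF dp_cocyclesD(1)[OF assms], of n] by (simp add: dp_eq_iff)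
  then show "e \<in> bar_diff ` dp_cochains"
    using coboundary_if_bar_coeff_0[OF two dp_cocyclesD[OF assms]] by blast
next
  assume "e \<in> bar_diff ` dp_cochains"
  then show "bar_symbol e = 0"
    using bar_coeff_bar_diff[OF two] dp_coeff_bar_symbol[OF dp_cocyclesD(1)[OF assms]]
    by (intro dp_coeff_eqI) (auto simp: dp_eq_iff)
qed

section \<open>Cohomology classes as fibres of the symbol\<close>

abbreviation (input) hoch_class :: "'k poly dp \<Rightarrow> ('a list \<Rightarrow> 'a) set" where
  "hoch_class \<equiv> fib (hoch_cocycles D) (hoch_symbol j)"

lemma hoch_coboundaries_eq: "hoch_coboundaries D = hoch_class 0"
proof -
  have "hoch_coboundaries D = from_model D j ` bar_diff ` dp_cochains"
    by (auto simp: hoch_coboundaries_def hoch_cochains_eq hoch_diff_from_model image_iff)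
  also have "bar_diff ` dp_cochains = {e \<in> dp_cocycles. bar_symbol e = (0 :: 'k poly dp)}"
    using bar_symbol_eq_0_iff dp_cocycles_coboundary by blast
  finally show ?thesis
    by (auto simp: fib_def hoch_cocycles_carrier)
qed

lemma abelian_group_hoch_cocycles: "abelian_group (hoch_cocycles D)"
proof (rule abelian_groupI)
  fix x assume "x \<in> carrier (hoch_cocycles D)"
  then obtain e where e: "x = from_model D j e" "e \<in> dp_cocycles"
    by (auto simp: hoch_cocycles_carrier)
  then have "from_model D j (\<lambda>l. - 1 * e l) \<in> carrier (hoch_cocycles D)"
    unfolding hoch_cocycles_carrier by (intro imageI dp_cocycles_mult)
  moreover have "from_model D j (\<lambda>l. - 1 * e l) \<oplus>\<^bsub>hoch_cocycles D\<^esub> x = \<zero>\<^bsub>hoch_cocycles D\<^esub>"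
    unfolding e(1) hoch_cocycles_add hoch_cocycles_zero by simp
  ultimately show "\<exists>y\<in>carrier (hoch_cocycles D). y \<oplus>\<^bsub>hoch_cocycles D\<^esub> x = \<zero>\<^bsub>hoch_cocycles D\<^esub>"
    by blast
qed (auto simp: hoch_cocycles_carrier hoch_cocycles_add hoch_cocycles_zero dp_cocycles_zero
    intro!: imageI dp_cocycles_add simp: add_ac)

lemma HH_model: "alg_model dp_poly_scal hoch_class (HH D)"
  unfolding HH_def hoch_coboundaries_eq
proof (rule fib_model[OF abelian_group_hoch_cocycles])
  show "\<exists>x\<in>carrier (hoch_cocycles D). hoch_symbol j x = p" for p
    unfolding hoch_cocycles_carrier
    by (intro bexI[of _ "from_model D j (power_cochain (dp_coeff p))"] imageI power_cochain_cocycles)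
      (simp add: power_cochain_symbol)
  have smult: "bar_symbol (\<lambda>l. dscal c * e l) = dp_poly_scal c * bar_symbol e" if "e \<in> dp_cocycles" for c e
    using that
    by (intro dp_coeff_eqI) (simp add: dp_coeff_bar_symbol dp_cochains_mult dp_cocyclesD dp_eq_iff
        flip: bar_coeff_sel, simp add: dp_coeff_bar_symbol dp_cocyclesD flip: dp_coeff_sel)
  show "hoch_symbol j (c \<odot>\<^bsub>hoch_cocycles D\<^esub> x) = dp_poly_scal c * hoch_symbol j x"
    if "x \<in> carrier (hoch_cocycles D)" for c x
    using that by (auto simp: hoch_cocycles_carrier hoch_cocycles_smult smult)
  show "hoch_symbol j \<one>\<^bsub>hoch_cocycles D\<^esub> = 1"
    by (simp add: hoch_cocycles_one unit_cochain power_cochain_symbol)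
  show "\<one>\<^bsub>hoch_cocycles D\<^esub> \<in> carrier (hoch_cocycles D)"
    unfolding hoch_cocycles_one unit_cochain hoch_cocycles_carrier by (intro imageI power_cochain_cocycles)
qed (auto simp: hoch_cocycles_carrier hoch_cocycles_add hoch_cocycles_mult hoch_cocycles_smult
    bar_symbol_add bar_symbol_cup dp_cocyclesD intro!: imageI dp_cocycles_add dp_cocycles_cup dp_cocycles_mult)

lemma hoch_coset: "x \<in> carrier (hoch_cocycles D) \<Longrightarrow>
    hoch_coboundaries D +>\<^bsub>hoch_cocycles D\<^esub> x = hoch_class (hoch_symbol j x)"
  unfolding hoch_coboundaries_eq
  by (rule fib_coset[OF abelian_group_hoch_cocycles])
    (auto simp: hoch_cocycles_carrier hoch_cocycles_add bar_symbol_add dp_cocyclesD)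

text \<open>The power cochain of a symbol concentrated in one degree is itself concentrated there,
  so it serves as a homogeneous representative.\<close>

lemma HH_grade_eq: "HH_grade D n = hoch_class ` {p. \<forall>m. m \<noteq> n \<longrightarrow> dp_coeff p m = 0}"
proof
  show "HH_grade D n \<subseteq> hoch_class ` {p. \<forall>m. m \<noteq> n \<longrightarrow> dp_coeff p m = 0}"
  proof
    fix X assume "X \<in> HH_grade D n"
    then obtain c where c: "c \<in> carrier (hoch_cocycles D)" "\<forall>xs. length xs \<noteq> n \<longrightarrow> c xs = \<zero>\<^bsub>D\<^esub>"
        "X = hoch_class (hoch_symbol j c)"
      by (auto simp: HH_grade_def hoch_coset)
    then obtain e where e: "c = from_model D j e" "e \<in> dp_cocycles"
      by (auto simp: hoch_cocycles_carrier)
    have "e zs = 0" if "length zs \<noteq> n" for zs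
      using c(2) that e(1) alg_modelD[OF D] from_model_map[of e zs] length_map[of j zs] by (metis injD)
    then have "dp_coeff (bar_symbol e) m = 0" if "m \<noteq> n" for m
      using that by (simp add: dp_coeff_bar_symbol dp_cocyclesD e(2)) (simp add: dp_eq_iff)
    then show "X \<in> hoch_class ` {p. \<forall>m. m \<noteq> n \<longrightarrow> dp_coeff p m = 0}"
      by (auto simp: c(3) e(1))
  qed
  show "hoch_class ` {p. \<forall>m. m \<noteq> n \<longrightarrow> dp_coeff p m = 0} \<subseteq> HH_grade D n"
  proof
    fix X assume "X \<in> hoch_class ` {p. \<forall>m. m \<noteq> n \<longrightarrow> dp_coeff p m = 0}"
    then obtain p where p: "X = hoch_class p" "\<forall>m. m \<noteq> n \<longrightarrow> dp_coeff p m = 0" by blast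
    let ?c = "from_model D j (power_cochain (dp_coeff p))"
    have "?c \<in> carrier (hoch_cocycles D)"
      unfolding hoch_cocycles_carrier by (intro imageI power_cochain_cocycles)
    moreover have "hoch_symbol j ?c = p"
      by (simp add: power_cochain_symbol)
    moreover have "?c xs = \<zero>\<^bsub>D\<^esub>" if "length xs \<noteq> n" for xs
      using that p(2) by (simp add: from_model_def power_cochain_def alg_modelD[OF D])
    ultimately show "X \<in> HH_grade D n"
      unfolding HH_grade_def p(1) using hoch_coset by (intro CollectI exI[of _ ?c]) auto
  qed
qed

text \<open>The cocycle \<open>\<partial>/\<partial>\<epsilon>\<close> has the weight inverse to that of \<open>\<epsilon>\<close>.\<close>
lemma HH_act_eq:
  assumes \<kappa>: "\<kappa> \<noteq> 0" and "\<And>z. \<rho> t (j z) = j (dp_torus \<kappa> z)"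
    and "\<And>z. \<rho> (matrix_inv t) (j z) = j (dp_torus (1 / \<kappa>) z)"
  shows "HH_act D \<rho> t (hoch_class p) = hoch_class (dp_poly_torus \<kappa> p)"
proof -
  define act where "act = (\<lambda>\<kappa>::'k. \<lambda>e zs. dp_torus \<kappa> (e (map (dp_torus (1 / \<kappa>)) zs)))"
  have act: "cochain_act D \<rho> t (from_model D j e) = from_model D j (act \<kappa> e)" for e
  proof (rule from_model_eqI)
    fix zs
    have "map (\<rho> (matrix_inv t)) (map j zs) = map j (map (dp_torus (1 / \<kappa>)) zs)"
      by (simp add: assms)
    moreover have "set (map j zs) \<subseteq> carrier D"
      using set_subset_carrier_iff by blast
    ultimately show "cochain_act D \<rho> t (from_model D j e) (map j zs) = j (act \<kappa> e zs)"
      unfolding cochain_act_def by (simp only: from_model_map assms act_def if_True)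
  qed (simp add: cochain_act_def)
  have inv: "dp_torus \<kappa> (dp_torus (1 / \<kappa>) z) = z" if "\<kappa> \<noteq> 0" for \<kappa> :: 'k and z
    using that by (simp add: dp_eq_iff)
  have tail: "bar_tail (act \<kappa> e) x xs = dp_torus \<kappa> (bar_tail e (dp_torus (1 / \<kappa>) x) (map (dp_torus (1 / \<kappa>)) xs))"
    if "\<kappa> \<noteq> 0" for \<kappa> :: 'k and e x xs
  proof (induction xs arbitrary: e x)
    case Nil
    then show ?case by (simp add: act_def dp_torus_simps inv that)
  next
    case (Cons y ys)
    have "(\<lambda>l. act \<kappa> e (x # l)) = act \<kappa> (\<lambda>l. e (dp_torus (1 / \<kappa>) x # l))"
      by (simp add: act_def)
    then show ?case
      using Cons.IH by (simp add: dp_torus_simps) (simp add: act_def dp_torus_simps)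
  qed
  have diff: "bar_diff (act \<kappa> e) xs = act \<kappa> (bar_diff e) xs" if "\<kappa> \<noteq> 0" for \<kappa> :: 'k and e xs
    using that by (cases xs) (simp_all add: tail, simp_all add: act_def dp_torus_simps inv)
  have cocyc: "act \<kappa> e \<in> dp_cocycles" if "\<kappa> \<noteq> 0" and e: "e \<in> dp_cocycles" for \<kappa> :: 'k and e
  proof (rule dp_cocyclesI)
    obtain N where "\<And>xs. length xs > N \<Longrightarrow> e xs = 0"
      using dp_cochains_bound dp_cocyclesD(1)[OF e] by blast
    then show "act \<kappa> e \<in> dp_cochains"
      using dp_cochains_add_arg[OF dp_cocyclesD(1)[OF e]] dp_cochains_scal_arg[OF dp_cocyclesD(1)[OF e]]
      by (intro dp_cochainsI[where N = N]) (simp_all add: act_def dp_torus_simps dp_torus_dscal)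
    show "bar_diff (act \<kappa> e) l = 0" for l
      by (simp add: diff that) (simp add: e act_def dp_cocyclesD dp_torus_simps)
  qed
  have sym: "bar_symbol (act \<kappa> e) = dp_poly_torus \<kappa> (bar_symbol e)"
    if "\<kappa> \<noteq> 0" and e: "e \<in> dp_cocycles" for \<kappa> :: 'k and e
  proof (rule dp_coeff_eqI)
    fix n
    have rep: "e (replicate n (dscal c * z)) = dscal (c ^ n) * e (replicate n z)" for c z
    proof -
      \<comment> \<open>Multilinearity extracts the scalar from one entry at a time; the prefix
        holds the entries already treated.\<close>
      have "e (replicate m z @ replicate n (dscal c * z)) = dscal (c ^ n) * e (replicate m z @ replicate n z)" for m
      proof (induction n arbitrary: m)
        case (Suc n)
        have "e (replicate m z @ replicate (Suc n) (dscal c * z)) = dscal c * e (replicate m z @ z # replicate n (dscal c * z))"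
          using dp_cochains_scal_arg[OF dp_cocyclesD(1)[OF e]] by simp
        also have "e (replicate m z @ z # replicate n (dscal c * z)) = dscal (c ^ n) * e (replicate m z @ z # replicate n z)"
          using Suc[of "Suc m"] by (simp add: replicate_app_Cons_same)
        finally show ?case by (simp add: dscal_mult mult.assoc)
      qed simp
      from this[of 0] show ?thesis by simp
    qed
    \<comment> \<open>The inverse action multiplies the nilpotents by \<open>\<kappa>\<close>; n
      such arguments produce the weight \<open>\<kappa> ^ n\<close> of the n-th power of y.\<close>
    have "dp_torus (1 / \<kappa>) (DP 0 1 0 0) = dscal \<kappa> * DP 0 1 0 0" "dp_torus (1 / \<kappa>) (DP 0 0 0 1) = dscal \<kappa> * DP 0 0 0 1"
      by (simp_all add: dp_eq_iff)
    then have "bar_coeff (act \<kappa> e) n = dscal (\<kappa> ^ n) * dp_torus \<kappa> (bar_coeff e n)"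
      by (subst dp_eq_iff) (simp add: act_def rep dp_torus_simps)
    then show "dp_coeff (bar_symbol (act \<kappa> e)) n = dp_coeff (dp_poly_torus \<kappa> (bar_symbol e)) n"
      using that e cocyc by (simp add: dp_coeff_bar_symbol dp_cocyclesD dp_coeff_torus)
  qed
  show ?thesis
    unfolding HH_act_def
  proof (rule image_fib[where P' = "\<lambda>c. from_model D j (act (1 / \<kappa>) (to_model j c))" and star' = "dp_poly_torus (1 / \<kappa>)"])
    show "dp_poly_torus (1 / \<kappa>) (dp_poly_torus \<kappa> z) = z" for z
      using \<kappa> by (simp add: dp_poly_torus_simps(3) flip: dp_poly_torus_simps(4))
    have "act \<kappa> (act (1 / \<kappa>) e) = e" for e
      using \<kappa> by (simp add: act_def fun_eq_iff inv comp_def)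
    then show "cochain_act D \<rho> t (from_model D j (act (1 / \<kappa>) (to_model j x))) = x"
      if "x \<in> carrier (hoch_cocycles D)" for x
      using that by (auto simp: hoch_cocycles_carrier act)
  qed (use \<kappa> in \<open>auto simp: hoch_cocycles_carrier act sym cocyc\<close>)
qed

end

section \<open>Linear extension of maps on a basis\<close>

abbreviation (input) "single \<equiv> Poly_Mapping.single"
abbreviation (input) "keys \<equiv> Poly_Mapping.keys"
abbreviation (input) "lookup \<equiv> Poly_Mapping.lookup"

text \<open>The coefficient is an argument of \<open>f\<close>, so that targets with different
  scalars are covered: polynomials, dual numbers over them, and free vector spaces again. Linear
  extension proper is the case where each \<open>f m\<close> is additive.\<close>

definition lin_ext :: "('a \<Rightarrow> 'k \<Rightarrow> 'c) \<Rightarrow> ('a \<Rightarrow>\<^sub>0 'k::zero) \<Rightarrow> 'c::comm_monoid_add" where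
  "lin_ext f p = (\<Sum>m\<in>keys p. f m (lookup p m))"

lemma lin_ext_superset:
  assumes "finite S" "keys p \<subseteq> S" "\<And>m. f m 0 = 0"
  shows "lin_ext f p = (\<Sum>m\<in>S. f m (lookup p m))"
  unfolding lin_ext_def using assms by (intro sum.mono_neutral_left) (auto simp: in_keys_iff)

lemma lin_ext_0 [simp]: "lin_ext f 0 = 0"
  by (simp add: lin_ext_def)

lemma lin_ext_single: "f m 0 = 0 \<Longrightarrow> lin_ext f (single m c) = f m c"
  by (cases "c = 0") (simp_all add: lin_ext_def)

lemma lin_ext_add:
  fixes f :: "'a \<Rightarrow> 'k::ab_group_add \<Rightarrow> 'c::comm_monoid_add"
  assumes "\<And>m. f m 0 = 0" "\<And>m a b. f m (a + b) = f m a + f m b"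
  shows "lin_ext f (p + q) = lin_ext f p + lin_ext f q"
proof -
  let ?S = "keys p \<union> keys q"
  have "lin_ext f (p + q) = (\<Sum>m\<in>?S. f m (lookup (p + q) m))"
    by (rule lin_ext_superset) (use Poly_Mapping.keys_add[of p q] assms in auto)
  also have "\<dots> = (\<Sum>m\<in>?S. f m (lookup p m)) + (\<Sum>m\<in>?S. f m (lookup q m))"
    by (simp add: lookup_add assms sum.distrib)
  also have "\<dots> = lin_ext f p + lin_ext f q"
    using assms(1) by (simp add: lin_ext_superset[of ?S])
  finally show ?thesis .
qed

lemma sum_singles: "(\<Sum>m\<in>keys p. single m (lookup p m)) = p"
  by (rule poly_mapping_eqI) (auto simp: lookup_sum lookup_single when_def in_keys_iff sum.delta)

lemma poly_mapping_keys_induct [consumes 1, case_names zero single add]: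
  fixes p :: "'a \<Rightarrow>\<^sub>0 'k::comm_monoid_add"
  assumes "keys p \<subseteq> K" and "P 0" and "\<And>m c. m \<in> K \<Longrightarrow> P (single m c)"
    and "\<And>p q. keys p \<subseteq> K \<Longrightarrow> keys q \<subseteq> K \<Longrightarrow> P p \<Longrightarrow> P q \<Longrightarrow> P (p + q)"
  shows "P p"
proof -
  have "P (\<Sum>m\<in>S. single m (f m)) \<and> keys (\<Sum>m\<in>S. single m (f m)) \<subseteq> K"
    if "finite S" "S \<subseteq> K" for S f
    using that
  proof (induction S)
    case (insert x S)
    let ?p = "single x (f x)" and ?q = "\<Sum>m\<in>S. single m (f m)"
    have keys: "keys ?p \<subseteq> K" "keys ?q \<subseteq> K" and "P ?p" "P ?q"
      using insert assms(3) by auto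
    then have "P (?p + ?q)" "keys (?p + ?q) \<subseteq> K"
      using assms(4) Poly_Mapping.keys_add[of ?p ?q] by blast+
    then show ?case
      using insert by simp
  qed (simp add: assms(2))
  from this[of "keys p" "lookup p"] assms(1) show ?thesis
    by (simp add: sum_singles)
qed

lemma push_keys_lin_ext: "push_keys h = lin_ext (\<lambda>m. single (h m))"
  by (simp add: push_keys_def lin_ext_def fun_eq_iff)

lemma push_keys_simps:
  "push_keys h (single m c) = single (h m) c"
  "push_keys h (p + q) = push_keys h p + push_keys h q" "push_keys h 0 = 0"
  by (simp_all add: push_keys_lin_ext lin_ext_single lin_ext_add single_add)

lemma keys_push_keys: "keys (push_keys h p) \<subseteq> h ` keys p"
proof -
  have "keys (push_keys h p) \<subseteq>
      (\<Union>m\<in>keys p. keys (single (h m) (lookup p m)))"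
    unfolding push_keys_def by (rule Poly_Mapping.keys_sum)
  then show ?thesis by (auto split: if_splits)
qed

lemma push_keys_inverse:
  assumes "keys p \<subseteq> K" "\<And>m. m \<in> K \<Longrightarrow> h (h' m) = m"
  shows "push_keys h (push_keys h' p) = p"
  using assms(1) by (induction rule: poly_mapping_keys_induct) (simp_all add: push_keys_simps assms(2))

lemma map_mult_single: "Poly_Mapping.map ((*) c) (single m a) = single m (c * a :: 'k::semiring_0)"
  by (cases "a = 0") (auto intro!: poly_mapping_eqI simp: Poly_Mapping.map.rep_eq lookup_single when_def)

lemma map_mult_zero: "Poly_Mapping.map ((*) (c :: 'k::semiring_0)) 0 = 0"
  by (rule poly_mapping_eqI) (simp add: Poly_Mapping.map.rep_eq)

lemma map_mult_add: "Poly_Mapping.map ((*) c) (p + q) = Poly_Mapping.map ((*) c) p + Poly_Mapping.map ((*) (c :: 'k::semiring_0)) q"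
  by (rule poly_mapping_eqI) (auto simp: Poly_Mapping.map.rep_eq lookup_add when_def distrib_left simp flip: distrib_left)

lemma keys_map_mult: "keys (Poly_Mapping.map ((*) (c :: 'k::semiring_0)) p) \<subseteq> keys p"
  by (auto simp: in_keys_iff Poly_Mapping.map.rep_eq)

lemma ideal_fib:
  fixes H :: "'a \<Rightarrow> 'c::comm_ring_1"
  assumes "ring A"
    and add: "\<And>x y. x \<in> carrier A \<Longrightarrow> y \<in> carrier A \<Longrightarrow> H (x \<oplus>\<^bsub>A\<^esub> y) = H x + H y"
    and mult: "\<And>x y. x \<in> carrier A \<Longrightarrow> y \<in> carrier A \<Longrightarrow> H (x \<otimes>\<^bsub>A\<^esub> y) = H x * H y"
  shows "ideal (fib A H 0) A"
proof -
  interpret ring A by fact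
  have zero: "H \<zero>\<^bsub>A\<^esub> = 0"
    using add[of "\<zero>\<^bsub>A\<^esub>" "\<zero>\<^bsub>A\<^esub>"] by simp
  have neg: "H (\<ominus>\<^bsub>A\<^esub> x) = - H x" if "x \<in> carrier A" for x
    using add[of "\<ominus>\<^bsub>A\<^esub> x" x] that zero by (simp add: l_neg eq_neg_iff_add_eq_0)
  show ?thesis
  proof (rule idealI)
    show "subgroup (fib A H 0) (add_monoid A)"
      using neg zero by unfold_locales (auto simp: fib_def add a_inv_def[symmetric])
  qed (auto simp: fib_def mult intro: \<open>ring A\<close>)
qed

section \<open>The symmetric algebra of a line\<close>

context
  fixes V :: "('k::field, 'v) module" and \<xi> :: 'v and lam :: "'v \<Rightarrow> 'k"
  assumes \<xi>: "\<xi> \<in> carrier V" "lam \<xi> = 1"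
    and V_closed: "\<And>v w. v \<in> carrier V \<Longrightarrow> w \<in> carrier V \<Longrightarrow> v \<oplus>\<^bsub>V\<^esub> w \<in> carrier V"
      "\<And>c v. v \<in> carrier V \<Longrightarrow> c \<odot>\<^bsub>V\<^esub> v \<in> carrier V"
    and lam: "\<And>v w. v \<in> carrier V \<Longrightarrow> w \<in> carrier V \<Longrightarrow> lam (v \<oplus>\<^bsub>V\<^esub> w) = lam v + lam w"
      "\<And>c v. v \<in> carrier V \<Longrightarrow> lam (c \<odot>\<^bsub>V\<^esub> v) = c * lam v"
    and line: "\<And>v. v \<in> carrier V \<Longrightarrow> v = lam v \<odot>\<^bsub>V\<^esub> \<xi>"
begin

abbreviation (input) "FV \<equiv> free_comm_algebra V"

text \<open>The homomorphism that substitutes \<open>lam v\<close> times the polynomial variable for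
  the variable of \<open>v\<close>.\<close>

definition sym_symbol :: "('v multiset \<Rightarrow>\<^sub>0 'k) \<Rightarrow> 'k poly" where
  "sym_symbol = lin_ext (\<lambda>m c. monom (c * prod_mset (image_mset lam m)) (size m))"

lemma sym_symbol_simps:
  "sym_symbol (single m c) = monom (c * prod_mset (image_mset lam m)) (size m)"
  "sym_symbol (p + q) = sym_symbol p + sym_symbol q" "sym_symbol 0 = 0"
  by (simp_all add: sym_symbol_def lin_ext_single lin_ext_add add_monom distrib_right)

lemma sym_symbol_diff: "sym_symbol (p - q) = sym_symbol p - sym_symbol q"
  using sym_symbol_simps(2)[of "p - q" q] by simp

lemma sym_symbol_mult: "sym_symbol (p * q) = sym_symbol p * sym_symbol q"
proof -
  have single: "sym_symbol (single m c * q) = sym_symbol (single m c) * sym_symbol q" for m c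
    using subset_UNIV
    by (induction q rule: poly_mapping_keys_induct)
      (simp_all add: mult_single sym_symbol_simps mult_monom algebra_simps)
  show ?thesis
    using subset_UNIV
    by (induction p rule: poly_mapping_keys_induct) (simp_all add: sym_symbol_simps single distrib_right)
qed

lemma FV_carrier: "p \<in> carrier FV \<longleftrightarrow> keys p \<subseteq> {m. set_mset m \<subseteq> carrier V}"
  by (auto simp: free_comm_algebra_def)

lemma FV_simps [simp]:
  "mult FV = (*)" "one FV = 1" "zero FV = 0" "add FV = (+)" "c \<odot>\<^bsub>FV\<^esub> p = Poly_Mapping.map ((*) c) p"
  by (simp_all add: free_comm_algebra_def)

lemma FV_closed:
  "p \<in> carrier FV \<Longrightarrow> q \<in> carrier FV \<Longrightarrow> p + q \<in> carrier FV"
  "p \<in> carrier FV \<Longrightarrow> - p \<in> carrier FV"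
  "p \<in> carrier FV \<Longrightarrow> q \<in> carrier FV \<Longrightarrow> p * q \<in> carrier FV"
  "p \<in> carrier FV \<Longrightarrow> Poly_Mapping.map ((*) c) p \<in> carrier FV"
  "set_mset m \<subseteq> carrier V \<Longrightarrow> single m c \<in> carrier FV"
  "0 \<in> carrier FV" "1 \<in> carrier FV"
proof -
  show "p + q \<in> carrier FV" if "p \<in> carrier FV" "q \<in> carrier FV"
    using that Poly_Mapping.keys_add[of p q] unfolding FV_carrier by blast
  show "p * q \<in> carrier FV" if "p \<in> carrier FV" "q \<in> carrier FV"
  proof -
    have "set_mset (a + b) \<subseteq> carrier V"
      if "a \<in> keys p" "b \<in> keys q" for a b
      using that \<open>p \<in> _\<close> \<open>q \<in> _\<close> unfolding FV_carrier set_mset_union by blast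
    then show ?thesis
      using keys_mult[of p q] unfolding FV_carrier by blast
  qed
  show "Poly_Mapping.map ((*) c) p \<in> carrier FV" if "p \<in> carrier FV"
    using that keys_map_mult[of c p] unfolding FV_carrier by blast
qed (simp_all add: FV_carrier)

lemma ring_FV: "ring FV"
proof (rule ringI)
  show "abelian_group FV"
  proof (rule abelian_groupI)
    fix p assume "p \<in> carrier FV"
    then show "\<exists>q\<in>carrier FV. q \<oplus>\<^bsub>FV\<^esub> p = \<zero>\<^bsub>FV\<^esub>"
      by (intro bexI[of _ "- p"]) (simp_all add: FV_closed)
  qed (simp_all add: FV_closed add_ac)
  show "monoid FV"
    by (rule monoidI) (simp_all add: FV_closed mult_ac)
qed (simp_all add: algebra_simps)

lemma linear_relations_subset: "linear_relations V \<subseteq> fib FV sym_symbol 0"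
proof -
  have minus: "p - q \<in> carrier FV" if "p \<in> carrier FV" "q \<in> carrier FV" for p q
    using that FV_closed(1)[of p "- q"] by (simp add: FV_closed)
  show ?thesis
    by (auto simp: linear_relations_def fib_def sym_symbol_diff sym_symbol_simps map_mult_single lam
        add_monom[symmetric] intro!: minus FV_closed V_closed)
qed

text \<open>For the harder inclusion, each variable is congruent to a multiple of the variable of
  \<open>\<xi>\<close>. Hence every element reduces to a combination of powers of this one variable,
  and on such combinations the symbol is injective.\<close>

lemma sym_ideal_eq: "sym_ideal V = fib FV sym_symbol 0"
proof -
  interpret ring FV by (rule ring_FV)
  have fib: "ideal (fib FV sym_symbol 0) FV"
    by (rule ideal_fib[OF ring_FV]) (simp_all add: sym_symbol_simps sym_symbol_mult)
  have rel: "linear_relations V \<subseteq> carrier FV"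
    using linear_relations_subset by (auto simp: fib_def)
  interpret J: ideal "sym_ideal V" FV
    unfolding sym_ideal_def by (rule genideal_ideal[OF rel])
  have J_add: "p + q \<in> sym_ideal V" if "p \<in> sym_ideal V" "q \<in> sym_ideal V" for p q
    using J.a_closed[OF that] by simp
  have J_mult: "p * q \<in> sym_ideal V" if "p \<in> sym_ideal V" "q \<in> carrier FV" for p q
    using J.I_r_closed[OF that] by simp
  have var: "gen_var v - single {#\<xi>#} (lam v) \<in> sym_ideal V" if "v \<in> carrier V" for v
  proof -
    have "gen_var v - single {#\<xi>#} (lam v) \<in> linear_relations V"
      using \<xi>(1) line[OF that] unfolding linear_relations_def
      by (intro UnI2 CollectI exI[of _ "lam v"] exI[of _ \<xi>]) (simp add: map_mult_single)
    then show ?thesis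
      unfolding sym_ideal_def using genideal_self[OF rel] by blast
  qed
  define nf where "nf = (\<lambda>m c. single (replicate_mset (size m) \<xi>) (c * prod_mset (image_mset lam m)))"
  have nf: "single m c - nf m c \<in> sym_ideal V" if "set_mset m \<subseteq> carrier V" for m c
    using that
  proof (induction m)
    case (add v m)
    \<comment> \<open>Replace the variable of \<open>v\<close> while the remaining monomial is kept,
      then reduce the remaining monomial.\<close>
    have "single (add_mset v m) c - nf (add_mset v m) c =
      (gen_var v - single {#\<xi>#} (lam v)) * single m c +
      (single m c - nf m c) * single {#\<xi>#} (lam v)"
      by (simp add: nf_def algebra_simps mult_single)
    then show ?case
      using add \<xi>(1) by (auto intro!: J_add J_mult var FV_closed)
  qed (use J.zero_closed in \<open>simp add: nf_def\<close>)
  let ?N = "{replicate_mset i \<xi> | i. True}"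
  have reduce: "\<exists>q. keys q \<subseteq> ?N \<and> p - q \<in> sym_ideal V" if "p \<in> carrier FV" for p
    using that unfolding FV_carrier
  proof (induction rule: poly_mapping_keys_induct)
    case zero
    then show ?case using J.zero_closed by (intro exI[of _ 0]) simp
  next
    case (single m c)
    then show ?case
      using nf[of m c] by (intro exI[of _ "nf m c"]) (auto simp: nf_def)
  next
    case (add p p')
    then obtain q q' where "keys q \<subseteq> ?N" "p - q \<in> sym_ideal V"
        "keys q' \<subseteq> ?N" "p' - q' \<in> sym_ideal V" by blast
    then show ?case
      using Poly_Mapping.keys_add[of q q'] J_add[of "p - q" "p' - q'"]
      by (intro exI[of _ "q + q'"]) (auto simp: algebra_simps)
  qed
  have nf_inj: "q = 0" if q: "keys q \<subseteq> ?N" "sym_symbol q = 0" for q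
  proof (rule poly_mapping_eqI)
    fix m
    show "lookup q m = lookup 0 m"
    proof (cases "m \<in> keys q")
      case True
      then obtain i where i: "m = replicate_mset i \<xi>" using q(1) by auto
      \<comment> \<open>Powers of \<open>\<xi>\<close> are told apart by their size, and
        \<open>lam \<xi> = 1\<close> makes the product of coordinates 1; so one coefficient of the
        symbol isolates one key.\<close>
      have *: "coeff (monom (c * prod_mset (image_mset lam m')) (size m')) i = (if m' = m then c else 0)"
        if m': "m' \<in> keys q" for m' c
      proof -
        obtain i' where "m' = replicate_mset i' \<xi>" using q(1) m' by auto
        then show ?thesis
          using \<xi>(2) i by (auto dest: arg_cong[where f = size])
      qed
      have "0 = coeff (sym_symbol q) i" by (simp add: q(2))
      also have "\<dots> = (\<Sum>m'\<in>keys q. if m' = m then lookup q m' else 0)"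
        unfolding sym_symbol_def lin_ext_def coeff_sum by (intro sum.cong refl *)
      finally show ?thesis
        using True by simp
    qed (simp add: in_keys_iff)
  qed
  show ?thesis
  proof
    show sub: "sym_ideal V \<subseteq> fib FV sym_symbol 0"
      unfolding sym_ideal_def by (rule genideal_minimal[OF fib linear_relations_subset])
    show "fib FV sym_symbol 0 \<subseteq> sym_ideal V"
    proof
      fix p assume p: "p \<in> fib FV sym_symbol 0"
      then have "p \<in> carrier FV" by (simp add: fib_def)
      from reduce[OF this] obtain q where q: "keys q \<subseteq> ?N" "p - q \<in> sym_ideal V"
        by blast
      have "sym_symbol (p - q) = 0"
        using q(2) sub by (auto simp: fib_def)
      then have "sym_symbol q = 0"
        using p by (simp add: fib_def sym_symbol_diff)
      then have "q = 0"
        by (rule nf_inj[OF q(1)])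
      then show "p \<in> sym_ideal V" using q(2) by simp
    qed
  qed
qed

lemma sym_symbol_scal: "sym_symbol (Poly_Mapping.map ((*) c) p) = poly_scal c * sym_symbol p"
  using subset_UNIV
  by (induction p rule: poly_mapping_keys_induct)
    (simp_all add: sym_symbol_simps map_mult_single map_mult_add map_mult_zero smult_monom mult.assoc smult_add_right)

definition poly_lift :: "'k poly \<Rightarrow> ('v multiset \<Rightarrow>\<^sub>0 'k)" where
  "poly_lift r = (\<Sum>i\<le>degree r. single (replicate_mset i \<xi>) (coeff r i))"

lemma poly_lift: "poly_lift r \<in> carrier FV" "sym_symbol (poly_lift r) = r"
proof -
  have "(\<Sum>i\<in>S. single (replicate_mset i \<xi>) (coeff r i)) \<in> carrier FV \<and>
    sym_symbol (\<Sum>i\<in>S. single (replicate_mset i \<xi>) (coeff r i)) = (\<Sum>i\<in>S. monom (coeff r i) i)"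
    if "finite S" for S
    using that by (induction S) (auto intro!: FV_closed simp: sym_symbol_simps \<xi> split: if_splits)
  then show "poly_lift r \<in> carrier FV" "sym_symbol (poly_lift r) = r"
    by (simp_all add: poly_lift_def poly_as_sum_of_monoms)
qed

abbreviation (input) "sym_class \<equiv> fib FV sym_symbol"

lemma sym_model: "alg_model poly_scal sym_class (sym_algebra V)"
  unfolding sym_algebra_def sym_ideal_eq
proof (rule fib_model)
  show "abelian_group FV" using ring_FV by (simp add: ring_def)
  show "\<exists>x\<in>carrier FV. sym_symbol x = z" for z using poly_lift by blast
  show "sym_symbol \<one>\<^bsub>FV\<^esub> = 1"
    using sym_symbol_simps(1)[of "{#}" 1] by (simp del: single_one add: single_one[symmetric] monom_0)
qed (simp_all add: FV_closed sym_symbol_simps sym_symbol_mult sym_symbol_scal)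

lemma sym_grade_eq: "sym_grade V n = sym_class ` {r. \<forall>i. i \<noteq> n \<longrightarrow> coeff r i = 0}"
proof -
  have coset: "sym_ideal V +>\<^bsub>FV\<^esub> p = sym_class (sym_symbol p)" if "p \<in> carrier FV" for p
    unfolding sym_ideal_eq using ring_FV that by (intro fib_coset) (simp_all add: sym_symbol_simps ring_def)
  show ?thesis
  proof
    show "sym_grade V n \<subseteq> sym_class ` {r. \<forall>i. i \<noteq> n \<longrightarrow> coeff r i = 0}"
      by (auto simp: sym_grade_def coset sym_symbol_def lin_ext_def coeff_sum intro!: imageI sum.neutral)
    show "sym_class ` {r. \<forall>i. i \<noteq> n \<longrightarrow> coeff r i = 0} \<subseteq> sym_grade V n"
    proof
      fix X assume "X \<in> sym_class ` {r. \<forall>i. i \<noteq> n \<longrightarrow> coeff r i = 0}"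
      then obtain r where r: "X = sym_class r" "\<forall>i. i \<noteq> n \<longrightarrow> coeff r i = 0" by blast
      let ?p = "single (replicate_mset n \<xi>) (coeff r n)"
      have "sym_symbol ?p = r" "?p \<in> carrier FV"
        using r(2) \<xi> by (auto simp: sym_symbol_simps poly_eq_iff intro!: FV_closed split: if_splits)
      then show "X \<in> sym_grade V n"
        unfolding sym_grade_def r(1) using coset by (intro CollectI exI[of _ ?p]) (auto split: if_splits)
    qed
  qed
qed

lemma sym_act_eq:
  assumes \<kappa>: "\<kappa> \<noteq> 0" and closed: "\<And>v. v \<in> carrier V \<Longrightarrow> \<rho> t v \<in> carrier V"
    and weight: "\<And>v. v \<in> carrier V \<Longrightarrow> lam (\<rho> t v) = \<kappa> * lam v"
  shows "sym_act \<rho> t (sym_class r) = sym_class (poly_torus \<kappa> r)"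
  unfolding sym_act_def
proof (rule image_fib[where star' = "poly_torus (1 / \<kappa>)"])
  \<comment> \<open>On a line the inverse of the action is division by the weight, so nothing has to
    be known about the inverse group element.\<close>
  define \<rho>' where "\<rho>' = (\<lambda>v. (1 / \<kappa>) \<odot>\<^bsub>V\<^esub> v)"
  let ?K = "{m. set_mset m \<subseteq> carrier V}"
  have \<rho>': "\<rho>' v \<in> carrier V" "lam (\<rho>' v) = 1 / \<kappa> * lam v" if "v \<in> carrier V" for v
    using that by (simp_all add: \<rho>'_def V_closed lam)
  have inv: "\<rho> t (\<rho>' v) = v" if "v \<in> carrier V" for v
  proof -
    have "\<rho> t (\<rho>' v) = lam (\<rho> t (\<rho>' v)) \<odot>\<^bsub>V\<^esub> \<xi>"
      by (rule line) (simp add: closed \<rho>' that)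
    also have "lam (\<rho> t (\<rho>' v)) = lam v"
      using \<kappa> that by (simp add: weight \<rho>')
    finally show ?thesis
      using line[OF that] by simp
  qed
  have sym: "sym_symbol (push_keys (image_mset h) p) = poly_torus c (sym_symbol p)"
    if "p \<in> carrier FV" and h: "\<And>v. v \<in> carrier V \<Longrightarrow> lam (h v) = c * lam v" for h p c
    using that(1) unfolding FV_carrier
  proof (induction rule: poly_mapping_keys_induct)
    case (single m a)
    then have "prod_mset (image_mset lam (image_mset h m)) = c ^ size m * prod_mset (image_mset lam m)"
      by (induction m) (auto simp: h)
    then show ?case
      by (simp add: push_keys_simps sym_symbol_simps poly_eq_iff)
  qed (simp_all add: push_keys_simps sym_symbol_simps poly_torus_simps)
  have car: "push_keys (image_mset h) p \<in> carrier FV"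
    if "p \<in> carrier FV" and h: "\<And>v. v \<in> carrier V \<Longrightarrow> h v \<in> carrier V" for h p
    using that(1) keys_push_keys[of "image_mset h" p] h unfolding FV_carrier by fastforce
  have "image_mset (\<rho> t) (image_mset \<rho>' m) = m" if "m \<in> ?K" for m
  proof -
    have "image_mset (\<lambda>v. \<rho> t (\<rho>' v)) m = image_mset (\<lambda>v. v) m"
      using that inv by (intro image_mset_cong) blast
    then show ?thesis by (simp add: image_mset.compositionality comp_def)
  qed
  then show "push_keys (image_mset (\<rho> t)) (push_keys (image_mset \<rho>') p) = p" if "p \<in> carrier FV" for p
    using that unfolding FV_carrier by (intro push_keys_inverse[where K = ?K])
  show "push_keys (image_mset (\<rho> t)) p \<in> carrier FV" "push_keys (image_mset \<rho>') p \<in> carrier FV"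
    if "p \<in> carrier FV" for p
    by (intro car that closed \<rho>'(1); assumption)+
  show "sym_symbol (push_keys (image_mset (\<rho> t)) p) = poly_torus \<kappa> (sym_symbol p)"
    "sym_symbol (push_keys (image_mset \<rho>') p) = poly_torus (1 / \<kappa>) (sym_symbol p)" if "p \<in> carrier FV" for p
    by (intro sym that weight \<rho>'(2); assumption)+
  show "poly_torus (1 / \<kappa>) (poly_torus \<kappa> z) = z" for z
    using \<kappa> by (simp add: poly_torus_simps(3) flip: poly_torus_simps(4))
qed

end

section \<open>The tensor product of a polynomial ring and a pair of dual numbers\<close>

lemma lin_ext_fun_add: "lin_ext (\<lambda>m c. f m c + g m c) p = lin_ext f p + lin_ext g p"
  by (simp add: lin_ext_def sum.distrib)

lemma lin_ext_fun_zero: "lin_ext (\<lambda>_ _. 0) p = 0"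
  by (simp add: lin_ext_def)

text \<open>The image of the pure tensor of \<open>r\<close> and \<open>z\<close>.\<close>

definition poly_dp :: "'k::comm_ring_1 poly \<Rightarrow> 'k dp \<Rightarrow> 'k poly dp" where
  "poly_dp r z = DP (Polynomial.smult (re0 z) r) (Polynomial.smult (ep0 z) r)
     (Polynomial.smult (re1 z) r) (Polynomial.smult (ep1 z) r)"

lemma poly_dp_sel [simp]:
  "re0 (poly_dp r z) = Polynomial.smult (re0 z) r" "ep0 (poly_dp r z) = Polynomial.smult (ep0 z) r"
  "re1 (poly_dp r z) = Polynomial.smult (re1 z) r" "ep1 (poly_dp r z) = Polynomial.smult (ep1 z) r"
  by (simp_all add: poly_dp_def)

lemma poly_dp_simps:
  "poly_dp (r + r') z = poly_dp r z + poly_dp r' z" "poly_dp r (z + z') = poly_dp r z + poly_dp r z'"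
  "poly_dp (poly_scal c * r) z = dp_poly_scal c * poly_dp r z"
  "poly_dp r (dscal c * z) = dp_poly_scal c * poly_dp r z"
  "poly_dp (r * r') (z * z') = poly_dp r z * poly_dp r' z'" "poly_dp 1 1 = 1"
  by (simp_all add: dp_eq_iff smult_add_left smult_add_right mult_ac)

lemma poly_dp_torus: "poly_dp (poly_torus \<kappa> r) (dp_torus \<kappa> z) = dp_poly_torus \<kappa> (poly_dp r z)"
  by (simp add: dp_eq_iff poly_torus_simps)

lemma bilinear_relationsI:
  "x \<in> carrier A \<Longrightarrow> x' \<in> carrier A \<Longrightarrow> y \<in> carrier B \<Longrightarrow>
    gen_pair (x \<oplus>\<^bsub>A\<^esub> x') y - gen_pair x y - gen_pair x' y \<in> bilinear_relations A B"
  "x \<in> carrier A \<Longrightarrow> y \<in> carrier B \<Longrightarrow> y' \<in> carrier B \<Longrightarrow>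
    gen_pair x (y \<oplus>\<^bsub>B\<^esub> y') - gen_pair x y - gen_pair x y' \<in> bilinear_relations A B"
  "x \<in> carrier A \<Longrightarrow> y \<in> carrier B \<Longrightarrow>
    gen_pair (c \<odot>\<^bsub>A\<^esub> x) y - Poly_Mapping.map ((*) c) (gen_pair x y) \<in> bilinear_relations A B"
  "x \<in> carrier A \<Longrightarrow> y \<in> carrier B \<Longrightarrow>
    gen_pair x (c \<odot>\<^bsub>B\<^esub> y) - Poly_Mapping.map ((*) c) (gen_pair x y) \<in> bilinear_relations A B"
  unfolding bilinear_relations_def by blast+

context
  fixes S :: "('k::field, 's) module" and \<alpha> :: "'k poly \<Rightarrow> 's"
    and D :: "('k, 'd) module" and j :: "'k dp \<Rightarrow> 'd"
  assumes S: "alg_model poly_scal \<alpha> S" and D: "alg_model dscal j D"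
begin

abbreviation (input) "PA \<equiv> pair_algebra S D"
abbreviation (input) "PK \<equiv> carrier S \<times> carrier D"

text \<open>The product of \<open>pair_algebra\<close> as a double linear extension, which reduces
  its laws to basis elements.\<close>

definition pair_mult :: "('s \<times> 'd \<Rightarrow>\<^sub>0 'k) \<Rightarrow> ('s \<times> 'd \<Rightarrow>\<^sub>0 'k) \<Rightarrow> ('s \<times> 'd \<Rightarrow>\<^sub>0 'k)" where
  "pair_mult p q = lin_ext (\<lambda>x a. lin_ext (\<lambda>y b.
     single (fst x \<otimes>\<^bsub>S\<^esub> fst y, snd x \<otimes>\<^bsub>D\<^esub> snd y) (a * b)) q) p"

lemma PA_simps:
  "mult PA = pair_mult" "one PA = gen_pair \<one>\<^bsub>S\<^esub> \<one>\<^bsub>D\<^esub>" "zero PA = 0" "add PA = (+)"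
  "c \<odot>\<^bsub>PA\<^esub> p = Poly_Mapping.map ((*) c) p"
  by (simp_all add: pair_algebra_def pair_mult_def lin_ext_def fun_eq_iff)

lemma PA_carrier: "p \<in> carrier PA \<longleftrightarrow> keys p \<subseteq> PK"
  by (simp add: pair_algebra_def)

lemma pair_mult_add_left: "pair_mult (p + p') q = pair_mult p q + pair_mult p' q"
  unfolding pair_mult_def
  by (rule lin_ext_add) (simp_all add: lin_ext_fun_zero distrib_right single_add lin_ext_fun_add)

lemma pair_mult_add_right: "pair_mult p (q + q') = pair_mult p q + pair_mult p q'"
  unfolding pair_mult_def lin_ext_fun_add[symmetric]
  by (simp add: lin_ext_add distrib_left single_add)

lemma pair_mult_0: "pair_mult 0 q = 0" "pair_mult p 0 = 0"
  by (simp_all add: pair_mult_def lin_ext_fun_zero)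

lemma pair_mult_single:
  "pair_mult (single (x, y) a) (single (x', y') b) =
    single (x \<otimes>\<^bsub>S\<^esub> x', y \<otimes>\<^bsub>D\<^esub> y') (a * b)"
  by (simp add: pair_mult_def lin_ext_single lin_ext_fun_zero)

lemmas pair_mult_simps = pair_mult_add_left pair_mult_add_right pair_mult_0 pair_mult_single

lemma PA_closed:
  "p \<in> carrier PA \<Longrightarrow> q \<in> carrier PA \<Longrightarrow> p + q \<in> carrier PA"
  "p \<in> carrier PA \<Longrightarrow> - p \<in> carrier PA"
  "p \<in> carrier PA \<Longrightarrow> Poly_Mapping.map ((*) c) p \<in> carrier PA"
  "x \<in> carrier S \<Longrightarrow> y \<in> carrier D \<Longrightarrow> single (x, y) c \<in> carrier PA"
  "0 \<in> carrier PA"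
proof -
  show "p + q \<in> carrier PA" if "p \<in> carrier PA" "q \<in> carrier PA"
    using that Poly_Mapping.keys_add[of p q] unfolding PA_carrier by blast
  show "Poly_Mapping.map ((*) c) p \<in> carrier PA" if "p \<in> carrier PA"
    using that keys_map_mult[of c p] unfolding PA_carrier by blast
qed (simp_all add: PA_carrier)

lemma PA_diff_closed: "p \<in> carrier PA \<Longrightarrow> q \<in> carrier PA \<Longrightarrow> p - q \<in> carrier PA"
  using PA_closed(1)[of p "- q"] by (simp add: PA_closed)

interpretation S: cring S using S by (rule alg_model_cring)
interpretation D: cring D using D by (rule alg_model_cring)

lemma PA_induct [consumes 1, case_names zero single add]:
  assumes "p \<in> carrier PA" "P 0"
    and "\<And>x y c. x \<in> carrier S \<Longrightarrow> y \<in> carrier D \<Longrightarrow> P (single (x, y) c)"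
    and "\<And>p q. p \<in> carrier PA \<Longrightarrow> q \<in> carrier PA \<Longrightarrow> P p \<Longrightarrow> P q \<Longrightarrow> P (p + q)"
  shows "P p"
  using assms(1) unfolding PA_carrier
  by (induction rule: poly_mapping_keys_induct) (auto simp: assms(2) PA_carrier intro: assms(3,4))

lemma pair_mult_closed:
  assumes "p \<in> carrier PA" "q \<in> carrier PA"
  shows "pair_mult p q \<in> carrier PA"
  using assms(1)
proof (induction p rule: PA_induct)
  case (single x y c)
  show ?case
    using assms(2)
    by (induction q rule: PA_induct) (simp_all add: pair_mult_simps PA_closed single)
qed (simp_all add: pair_mult_simps PA_closed)

lemma pair_mult_assoc:
  assumes "p \<in> carrier PA" "q \<in> carrier PA" "r \<in> carrier PA"
  shows "pair_mult (pair_mult p q) r = pair_mult p (pair_mult q r)"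
  using assms(1)
proof (induction p rule: PA_induct)
  case x: (single x y c)
  show ?case
    using assms(2)
  proof (induction q rule: PA_induct)
    case y: (single x y c)
    show ?case
      using assms(3)
      by (induction r rule: PA_induct) (simp_all add: pair_mult_simps x y S.m_assoc D.m_assoc mult.assoc)
  qed (simp_all add: pair_mult_simps)
qed (simp_all add: pair_mult_simps)

lemma pair_mult_comm:
  assumes "p \<in> carrier PA" "q \<in> carrier PA"
  shows "pair_mult p q = pair_mult q p"
  using assms(1)
proof (induction p rule: PA_induct)
  case (single x y c)
  show ?case
    using assms(2)
    by (induction q rule: PA_induct) (simp_all add: pair_mult_simps single S.m_comm D.m_comm mult.commute)
qed (simp_all add: pair_mult_simps)

lemma pair_mult_one:
  assumes "p \<in> carrier PA"
  shows "pair_mult (gen_pair \<one>\<^bsub>S\<^esub> \<one>\<^bsub>D\<^esub>) p = p"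
  using assms by (induction p rule: PA_induct) (simp_all add: pair_mult_simps)

lemma ring_PA: "ring PA"
proof (rule ringI)
  show "abelian_group PA"
  proof (rule abelian_groupI)
    fix p assume "p \<in> carrier PA"
    then show "\<exists>q\<in>carrier PA. q \<oplus>\<^bsub>PA\<^esub> p = \<zero>\<^bsub>PA\<^esub>"
      by (intro bexI[of _ "- p"]) (simp_all add: PA_closed PA_simps)
  qed (simp_all add: PA_closed PA_simps add_ac)
  have one: "gen_pair \<one>\<^bsub>S\<^esub> \<one>\<^bsub>D\<^esub> \<in> carrier PA"
    by (simp add: PA_closed)
  show "monoid PA"
    by (rule monoidI)
      (simp_all add: PA_simps pair_mult_closed pair_mult_assoc pair_mult_one one pair_mult_comm[OF _ one])
qed (simp_all add: PA_simps pair_mult_simps)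

section \<open>The symbol on the free vector space and the tensor ideal\<close>

definition pair_symbol :: "('s \<times> 'd \<Rightarrow>\<^sub>0 'k) \<Rightarrow> 'k poly dp" where
  "pair_symbol = lin_ext (\<lambda>x c. dp_poly_scal c * poly_dp (inv_into UNIV \<alpha> (fst x)) (inv_into UNIV j (snd x)))"

lemma dp_poly_scal_add: "dp_poly_scal (a + b) = dp_poly_scal a + dp_poly_scal (b :: 'k)"
  by (simp add: dp_eq_iff)

lemma pair_symbol_simps:
  "pair_symbol (single (\<alpha> r, j z) c) = dp_poly_scal c * poly_dp r z"
  "pair_symbol (p + q) = pair_symbol p + pair_symbol q" "pair_symbol 0 = 0"
proof -
  have 0: "dp_poly_scal (0::'k) = 0"
    by (simp add: dp_eq_iff)
  show "pair_symbol (single (\<alpha> r, j z) c) = dp_poly_scal c * poly_dp r z"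
    by (simp add: pair_symbol_def lin_ext_single 0 alg_modelD[OF S] alg_modelD[OF D])
  show "pair_symbol (p + q) = pair_symbol p + pair_symbol q"
    unfolding pair_symbol_def by (rule lin_ext_add) (simp_all only: 0 dp_poly_scal_add distrib_right mult_zero_left)
qed (simp add: pair_symbol_def)

lemma pair_symbol_diff: "pair_symbol (p - q) = pair_symbol p - pair_symbol q"
  using pair_symbol_simps(2)[of "p - q" q] by simp

lemma in_carrier_S: "x \<in> carrier S \<Longrightarrow> \<exists>r. x = \<alpha> r" and in_carrier_D: "y \<in> carrier D \<Longrightarrow> \<exists>z. y = j z"
  by (auto simp: alg_modelD[OF S] alg_modelD[OF D])

lemma model_carrier [simp]: "\<alpha> r \<in> carrier S" "j z \<in> carrier D"
  by (simp_all add: alg_modelD[OF S] alg_modelD[OF D])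

lemmas model_ops = alg_modelD(3-7)[OF S] alg_modelD(3-7)[OF D]

lemma pair_symbol_mult:
  assumes "p \<in> carrier PA" "q \<in> carrier PA"
  shows "pair_symbol (pair_mult p q) = pair_symbol p * pair_symbol q"
  using assms(1)
proof (induction p rule: PA_induct)
  case (single x y c)
  then obtain r z where *: "x = \<alpha> r" "y = j z" using in_carrier_S in_carrier_D by blast
  have scal: "dp_poly_scal (a * b) = dp_poly_scal a * dp_poly_scal (b :: 'k)" for a b
    by (simp add: dp_eq_iff)
  show ?case
    using assms(2)
  proof (induction q rule: PA_induct)
    case (single x' y' c')
    then obtain r' z' where "x' = \<alpha> r'" "y' = j z'" using in_carrier_S in_carrier_D by blast
    then show ?case
      by (simp only: * pair_mult_single model_ops pair_symbol_simps poly_dp_simps scal mult_ac)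
  qed (simp_all add: pair_mult_simps pair_symbol_simps distrib_left)
qed (simp_all add: pair_mult_simps pair_symbol_simps distrib_right)

lemma pair_symbol_scal:
  assumes "p \<in> carrier PA"
  shows "pair_symbol (Poly_Mapping.map ((*) c) p) = dp_poly_scal c * pair_symbol p"
  using assms
proof (induction p rule: PA_induct)
  case (single x y a)
  then obtain r z where "x = \<alpha> r" "y = j z" using in_carrier_S in_carrier_D by blast
  then show ?case
    by (simp add: map_mult_single pair_symbol_simps) (simp add: dp_eq_iff mult_ac)
qed (simp_all add: pair_symbol_simps map_mult_add map_mult_zero distrib_left)

lemma bilinear_relations_subset: "bilinear_relations S D \<subseteq> fib PA pair_symbol 0"
proof -
  have 1: "dp_poly_scal (1::'k) = 1" by (simp add: dp_eq_iff one_pCons)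
  have "bilinear_relations S D \<subseteq> carrier PA"
    unfolding bilinear_relations_def
    by (auto simp: map_mult_single intro!: PA_diff_closed PA_closed S.a_closed D.a_closed
        dest!: in_carrier_S in_carrier_D simp: model_ops)
  moreover have "pair_symbol p = 0" if "p \<in> bilinear_relations S D" for p
    using that unfolding bilinear_relations_def
    by (auto simp: map_mult_single dest!: in_carrier_S in_carrier_D simp: model_ops pair_symbol_diff
        pair_symbol_simps poly_dp_simps 1 simp del: mult_pCons_left)
  ultimately show ?thesis by (auto simp: fib_def)
qed

text \<open>A section of the symbol, from the basis of the pair of dual numbers: a tensor is given
  by four polynomial coefficients. It is additive only modulo the tensor ideal.\<close>

definition pair_lift :: "'k poly dp \<Rightarrow> ('s \<times> 'd \<Rightarrow>\<^sub>0 'k)" where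
  "pair_lift p = gen_pair (\<alpha> (re0 p)) (j idem0) + gen_pair (\<alpha> (ep0 p)) (j eps0) +
    gen_pair (\<alpha> (re1 p)) (j idem1) + gen_pair (\<alpha> (ep1 p)) (j eps1)"

lemma pair_lift: "pair_lift p \<in> carrier PA" "pair_symbol (pair_lift p) = p"
proof -
  have 1: "dp_poly_scal (1::'k) = 1" by (simp add: dp_eq_iff one_pCons)
  show "pair_lift p \<in> carrier PA"
    unfolding pair_lift_def by (intro PA_closed model_carrier)
  show "pair_symbol (pair_lift p) = p"
    by (simp add: pair_lift_def pair_symbol_simps 1) (simp add: dp_eq_iff)
qed

text \<open>Modulo the bilinear relations every element is congruent to the lift of its symbol, so
  elements with symbol 0 lie in the ideal.\<close>

lemma tensor_ideal_eq: "tensor_ideal S D = fib PA pair_symbol 0"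
proof -
  interpret ring PA by (rule ring_PA)
  have fib: "ideal (fib PA pair_symbol 0) PA"
    by (rule ideal_fib[OF ring_PA]) (simp_all add: PA_simps pair_symbol_simps pair_symbol_mult)
  have rel: "bilinear_relations S D \<subseteq> carrier PA"
    using bilinear_relations_subset by (auto simp: fib_def)
  interpret J: ideal "tensor_ideal S D" PA
    unfolding tensor_ideal_def by (rule genideal_ideal[OF rel])
  define eqv (infix "\<approx>" 50) where "p \<approx> q \<longleftrightarrow> p - q \<in> tensor_ideal S D" for p q
  have J_add: "p + q \<in> tensor_ideal S D" if "p \<in> tensor_ideal S D" "q \<in> tensor_ideal S D" for p q
    using J.a_closed[OF that] by (simp add: PA_simps)
  have J_0: "0 \<in> tensor_ideal S D"
    using J.zero_closed by (simp add: PA_simps)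
  have J_minus: "- p \<in> tensor_ideal S D" if "p \<in> tensor_ideal S D" for p
  proof -
    have p: "p \<in> carrier PA" using J.a_subset that by blast
    have "\<ominus>\<^bsub>PA\<^esub> p = - p"
      by (rule minus_equality) (use p in \<open>simp_all add: PA_simps PA_closed\<close>)
    then show ?thesis using J.a_inv_closed[OF that] by simp
  qed
  have refl: "p \<approx> p" for p
    by (simp add: eqv_def J_0)
  have trans [trans]: "p \<approx> r" if "p \<approx> q" "q \<approx> r" for p q r
    using J_add[of "p - q" "q - r"] that by (simp add: eqv_def)
  have sym: "p \<approx> q" if "q \<approx> p" for p q
    using J_minus[of "q - p"] that by (simp add: eqv_def)
  have add: "p + p' \<approx> q + q'" if "p \<approx> q" "p' \<approx> q'" for p p' q q'
    using J_add[of "p - q" "p' - q'"] that by (simp add: eqv_def add_diff_add)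
  have relJ: "p \<in> bilinear_relations S D \<Longrightarrow> p \<in> tensor_ideal S D" for p
    unfolding tensor_ideal_def using genideal_self[OF rel] by blast
  have add1: "gen_pair (\<alpha> (r + r')) (j z) \<approx> gen_pair (\<alpha> r) (j z) + gen_pair (\<alpha> r') (j z)" for r r' z
    unfolding eqv_def diff_diff_eq[symmetric] alg_modelD(5)[OF S, symmetric]
    by (intro relJ bilinear_relationsI model_carrier)
  have add2: "gen_pair (\<alpha> r) (j (z + z')) \<approx> gen_pair (\<alpha> r) (j z) + gen_pair (\<alpha> r) (j z')" for r z z'
    unfolding eqv_def diff_diff_eq[symmetric] alg_modelD(5)[OF D, symmetric]
    by (intro relJ bilinear_relationsI model_carrier)
  have scal1: "gen_pair (\<alpha> (poly_scal c * r)) (j z) \<approx> single (\<alpha> r, j z) c" for c r z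
  proof -
    have "gen_pair (c \<odot>\<^bsub>S\<^esub> \<alpha> r) (j z) - Poly_Mapping.map ((*) c) (gen_pair (\<alpha> r) (j z)) \<in> bilinear_relations S D"
      by (intro bilinear_relationsI model_carrier)
    from relJ[OF this] show ?thesis
      unfolding eqv_def alg_modelD(7)[OF S] map_mult_single mult_1_right .
  qed
  have scal2: "gen_pair (\<alpha> r) (j (dscal c * z)) \<approx> single (\<alpha> r, j z) c" for c r z
  proof -
    have "gen_pair (\<alpha> r) (c \<odot>\<^bsub>D\<^esub> j z) - Poly_Mapping.map ((*) c) (gen_pair (\<alpha> r) (j z)) \<in> bilinear_relations S D"
      by (intro bilinear_relationsI model_carrier)
    from relJ[OF this] show ?thesis
      unfolding eqv_def alg_modelD(7)[OF D] map_mult_single mult_1_right .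
  qed
  have lift_add: "pair_lift (p + q) \<approx> pair_lift p + pair_lift q" for p q
  proof -
    have "pair_lift (p + q) \<approx> (gen_pair (\<alpha> (re0 p)) (j idem0) + gen_pair (\<alpha> (re0 q)) (j idem0)) +
        (gen_pair (\<alpha> (ep0 p)) (j eps0) + gen_pair (\<alpha> (ep0 q)) (j eps0)) +
        (gen_pair (\<alpha> (re1 p)) (j idem1) + gen_pair (\<alpha> (re1 q)) (j idem1)) +
        (gen_pair (\<alpha> (ep1 p)) (j eps1) + gen_pair (\<alpha> (ep1 q)) (j eps1))"
      unfolding pair_lift_def dp_sel by (intro add add1)
    then show ?thesis by (simp add: pair_lift_def add_ac)
  qed
  have reduce: "p \<approx> pair_lift (pair_symbol p)" if "p \<in> carrier PA" for p
    using that
  proof (induction p rule: PA_induct)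
    case zero
    \<comment> \<open>The lift of 0 is a nonzero combination of basis elements such as the pair of
      two zeros; additivity of the lift at 0 + 0 places it in the ideal.\<close>
    have "pair_lift (0 + 0) \<approx> pair_lift 0 + pair_lift 0" by (rule lift_add)
    then have "pair_lift 0 \<approx> pair_lift 0 + pair_lift 0" by simp
    then have "- pair_lift 0 \<in> tensor_ideal S D" by (simp add: eqv_def)
    then show ?case by (simp add: eqv_def pair_symbol_simps)
  next
    case (add p q)
    have "p + q \<approx> pair_lift (pair_symbol p) + pair_lift (pair_symbol q)"
      by (rule \<open>\<And>p p' q q'. _ \<Longrightarrow> _ \<Longrightarrow> p + p' \<approx> q + q'\<close>) (fact add)+
    also have "\<dots> \<approx> pair_lift (pair_symbol p + pair_symbol q)"
      by (rule sym, rule lift_add)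
    finally show ?case by (simp add: pair_symbol_simps)
  next
    case (single x y c)
    then obtain r z where *: "x = \<alpha> r" "y = j z" using in_carrier_S in_carrier_D by blast
    let ?r = "poly_scal c * r"
    let ?g = "\<lambda>b. gen_pair (\<alpha> ?r) (j b)"
    \<comment> \<open>Scalars cross the tensor sign; thus \<open>z\<close> can be expanded in the
      basis and its four coordinates collected in the polynomial factor.\<close>
    have move: "?g (dscal s * b) \<approx> gen_pair (\<alpha> (poly_scal s * ?r)) (j b)" for s b
      using scal2 sym[OF scal1] by (rule trans)
    have "z = dscal (re0 z) * idem0 + dscal (ep0 z) * eps0 + dscal (re1 z) * idem1 + dscal (ep1 z) * eps1"
      by (simp add: dp_eq_iff)
    then have "single (x, y) c \<approx>
        ?g (dscal (re0 z) * idem0 + dscal (ep0 z) * eps0 + dscal (re1 z) * idem1 + dscal (ep1 z) * eps1)"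
      unfolding * using sym[OF scal1, of r z c] by simp
    also have "\<dots> \<approx> ?g (dscal (re0 z) * idem0) + ?g (dscal (ep0 z) * eps0) + ?g (dscal (re1 z) * idem1) + ?g (dscal (ep1 z) * eps1)"
      by (intro trans[OF add2] \<open>\<And>p p' q q'. _ \<Longrightarrow> _ \<Longrightarrow> p + p' \<approx> q + q'\<close> refl)
    also have "\<dots> \<approx> pair_lift (poly_dp ?r z)"
      unfolding pair_lift_def poly_dp_sel
      by (intro \<open>\<And>p p' q q'. _ \<Longrightarrow> _ \<Longrightarrow> p + p' \<approx> q + q'\<close>; rule trans[OF move]; simp add: refl mult.commute[of c])
    finally show ?case
      by (simp add: * pair_symbol_simps poly_dp_simps del: mult_pCons_left)
  qed
  show ?thesis
  proof
    show "tensor_ideal S D \<subseteq> fib PA pair_symbol 0"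
      unfolding tensor_ideal_def by (rule genideal_minimal[OF fib bilinear_relations_subset])
    show "fib PA pair_symbol 0 \<subseteq> tensor_ideal S D"
    proof
      fix p assume "p \<in> fib PA pair_symbol 0"
      then have "p \<approx> pair_lift 0" using reduce[of p] by (simp add: fib_def)
      also have "pair_lift 0 \<approx> 0"
        using sym[OF reduce[of 0]] by (simp add: PA_closed pair_symbol_simps)
      finally show "p \<in> tensor_ideal S D" by (simp add: eqv_def)
    qed
  qed
qed

abbreviation (input) "tensor_class \<equiv> fib PA pair_symbol"

lemma tensor_model: "alg_model dp_poly_scal tensor_class (tensor_algebra S D)"
  unfolding tensor_algebra_def tensor_ideal_eq
proof (rule fib_model)
  have 1: "dp_poly_scal (1::'k) = 1" by (simp add: dp_eq_iff one_pCons)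
  show "abelian_group PA" using ring_PA by (simp add: ring_def)
  show "\<exists>x\<in>carrier PA. pair_symbol x = z" for z using pair_lift by blast
  show "pair_symbol \<one>\<^bsub>PA\<^esub> = 1"
    by (simp add: PA_simps model_ops pair_symbol_simps poly_dp_simps 1)
qed (simp_all add: PA_closed PA_simps pair_mult_closed pair_symbol_simps pair_symbol_mult pair_symbol_scal)

text \<open>If the symbol is homogeneous, so are its four polynomial coefficients, and the lift
  provides a homogeneous representative.\<close>

lemma tensor_grade_eq:
  assumes gr: "gr n = \<alpha> ` {r. \<forall>i. i \<noteq> n \<longrightarrow> coeff r i = 0}"
  shows "tensor_grade S D gr n = tensor_class ` {p. \<forall>m. m \<noteq> n \<longrightarrow> dp_coeff p m = 0}"
proof -
  have coset: "tensor_ideal S D +>\<^bsub>PA\<^esub> p = tensor_class (pair_symbol p)" if "p \<in> carrier PA" for p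
    unfolding tensor_ideal_eq using ring_PA that
    by (intro fib_coset) (simp_all add: PA_simps pair_symbol_simps ring_def)
  show ?thesis
  proof
    have "dp_coeff (pair_symbol p) m = 0" if "keys p \<subseteq> gr n \<times> carrier D" and m: "m \<noteq> n" for p m
      using that(1)
    proof (induction p rule: poly_mapping_keys_induct)
      case (single x c)
      then obtain r z where "x = (\<alpha> r, j z)" "coeff r m = 0"
        using gr m in_carrier_D[of "snd x"] by (cases x) auto
      then show ?case
        by (simp add: pair_symbol_simps dp_eq_iff)
    qed (simp_all add: pair_symbol_simps dp_coeff_add, simp add: dp_eq_iff)
    then show "tensor_grade S D gr n \<subseteq> tensor_class ` {p. \<forall>m. m \<noteq> n \<longrightarrow> dp_coeff p m = 0}"
      by (auto simp: tensor_grade_def coset intro!: imageI)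
    show "tensor_class ` {p. \<forall>m. m \<noteq> n \<longrightarrow> dp_coeff p m = 0} \<subseteq> tensor_grade S D gr n"
    proof
      fix X assume "X \<in> tensor_class ` {p. \<forall>m. m \<noteq> n \<longrightarrow> dp_coeff p m = 0}"
      then obtain p where p: "X = tensor_class p" "\<forall>m. m \<noteq> n \<longrightarrow> dp_coeff p m = 0" by blast
      let ?K = "gr n \<times> carrier D"
      have add: "keys (a + b) \<subseteq> ?K" if "keys a \<subseteq> ?K" "keys b \<subseteq> ?K"
        for a b :: "'s \<times> 'd \<Rightarrow>\<^sub>0 'k"
        using that Poly_Mapping.keys_add[of a b] by blast
      have "keys (pair_lift p) \<subseteq> ?K"
        unfolding pair_lift_def using p(2) by (intro add) (auto simp: gr dp_eq_iff)
      then show "X \<in> tensor_grade S D gr n"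
        unfolding tensor_grade_def p(1) using coset pair_lift by (intro CollectI exI[of _ "pair_lift p"]) auto
    qed
  qed
qed

lemma tensor_act_eq:
  assumes \<kappa>: "\<kappa> \<noteq> 0" and \<rho>: "\<And>r. \<rho> t (\<alpha> r) = \<alpha> (poly_torus \<kappa> r)" and \<sigma>: "\<And>z. \<sigma> t (j z) = j (dp_torus \<kappa> z)"
  shows "tensor_act \<rho> \<sigma> t (tensor_class p) = tensor_class (dp_poly_torus \<kappa> p)"
  unfolding tensor_act_def
proof (rule image_fib[where star' = "dp_poly_torus (1 / \<kappa>)"])
  define inv_act where "inv_act = map_prod (\<lambda>x. \<alpha> (poly_torus (1 / \<kappa>) (inv_into UNIV \<alpha> x)))
    (\<lambda>y. j (dp_torus (1 / \<kappa>) (inv_into UNIV j y)))"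
  have inv_act: "inv_act (\<alpha> r, j z) = (\<alpha> (poly_torus (1 / \<kappa>) r), j (dp_torus (1 / \<kappa>) z))" for r z
    by (simp add: inv_act_def alg_modelD[OF S] alg_modelD[OF D])
  have act: "map_prod (\<rho> t) (\<sigma> t) (\<alpha> r, j z) = (\<alpha> (poly_torus \<kappa> r), j (dp_torus \<kappa> z))" for r z
    by (simp add: \<rho> \<sigma>)
  have sym: "push_keys h p \<in> carrier PA \<and> pair_symbol (push_keys h p) = dp_poly_torus c (pair_symbol p)"
    if "p \<in> carrier PA" and h: "\<And>r z. h (\<alpha> r, j z) = (\<alpha> (poly_torus c r), j (dp_torus c z))" for h p c
    using that(1)
  proof (induction rule: PA_induct)
    case (single x y a)
    then obtain r z where "x = \<alpha> r" "y = j z" using in_carrier_S in_carrier_D by blast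
    then show ?case
      by (simp add: push_keys_simps pair_symbol_simps PA_closed h poly_dp_torus dp_poly_torus_simps(2))
  qed (simp_all add: push_keys_simps pair_symbol_simps dp_poly_torus_simps PA_closed)
  show "push_keys (map_prod (\<rho> t) (\<sigma> t)) (push_keys inv_act p) = p" if "p \<in> carrier PA" for p
  proof (rule push_keys_inverse[where K = PK])
    fix x assume "x \<in> PK"
    then show "map_prod (\<rho> t) (\<sigma> t) (inv_act x) = x"
    proof (elim SigmaE)
      fix a b assume "x = (a, b)" "a \<in> carrier S" "b \<in> carrier D"
      moreover from this obtain r z where "a = \<alpha> r" "b = j z"
        using in_carrier_S in_carrier_D by blast
      ultimately show ?thesis
        using \<kappa> by (simp add: inv_act \<rho> \<sigma> poly_torus_simps(3) dp_torus_simps(3)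
            flip: poly_torus_simps(4) dp_torus_simps(4))
    qed
  qed (use that in \<open>simp add: PA_carrier\<close>)
  show "push_keys (map_prod (\<rho> t) (\<sigma> t)) p \<in> carrier PA"
    "pair_symbol (push_keys (map_prod (\<rho> t) (\<sigma> t)) p) = dp_poly_torus \<kappa> (pair_symbol p)" if "p \<in> carrier PA" for p
    using sym[OF that act] by blast+
  show "push_keys inv_act p \<in> carrier PA"
    "pair_symbol (push_keys inv_act p) = dp_poly_torus (1 / \<kappa>) (pair_symbol p)" if "p \<in> carrier PA" for p
    using sym[OF that inv_act] by blast+
  show "dp_poly_torus (1 / \<kappa>) (dp_poly_torus \<kappa> z) = z" for z
    using \<kappa> by (simp add: dp_poly_torus_simps(3) flip: dp_poly_torus_simps(4))
qed

end

section \<open>Regular functions on subsets of the matrices\<close>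

text \<open>Elements of the coordinate ring are functions extended by zero. This predicate speaks of
  the formula before truncation, which lets formulas be combined freely.\<close>

definition reg :: "'k::field mat2 set \<Rightarrow> ('k mat2 \<Rightarrow> 'k) \<Rightarrow> bool" where
  "reg G f \<longleftrightarrow> restr G f \<in> coord_ring G"

lemma restr_in [simp]: "x \<in> G \<Longrightarrow> restr G f x = f x" and restr_out [simp]: "x \<notin> G \<Longrightarrow> restr G f x = 0"
  by (simp_all add: restr_def)

lemma restr_cong: "(\<And>x. x \<in> G \<Longrightarrow> f x = f' x) \<Longrightarrow> restr G f = restr G f'"
  by (auto simp: restr_def)

lemma reg_cong: "(\<And>x. x \<in> G \<Longrightarrow> f x = f' x) \<Longrightarrow> reg G f \<longleftrightarrow> reg G f'"
  unfolding reg_def using restr_cong[of G f f'] by simp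

lemma reg_const: "reg G (\<lambda>_. c)"
  by (simp add: reg_def coord_ring.const)

lemma reg_entry: "reg G (\<lambda>x. x $ i $ j)"
  by (simp add: reg_def coord_ring.entry)

lemma restr_add: "restr G (\<lambda>x. f x + f' x) = (\<lambda>x. restr G f x + restr G f' x)"
  and restr_mult: "restr G (\<lambda>x. f x * f' x) = (\<lambda>x. restr G f x * restr G f' x)"
  and restr_scale: "restr G (\<lambda>x. c * f x) = (\<lambda>x. c * restr G f x)"
  by (auto simp: restr_def)

lemma reg_add: "reg G f \<Longrightarrow> reg G f' \<Longrightarrow> reg G (\<lambda>x. f x + f' x)"
  by (simp add: reg_def restr_add coord_ring.add)

lemma reg_mult: "reg G f \<Longrightarrow> reg G f' \<Longrightarrow> reg G (\<lambda>x. f x * f' x)"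
  by (simp add: reg_def restr_mult coord_ring.mult)

lemma reg_power: "reg G f \<Longrightarrow> reg G (\<lambda>x. f x ^ n)"
  by (induction n) (simp_all add: reg_const reg_mult)

lemmas reg_intros = reg_const reg_entry reg_add reg_mult reg_power

lemma coord_ring_out: "F \<in> coord_ring G \<Longrightarrow> x \<notin> G \<Longrightarrow> F x = 0"
  by (induction rule: coord_ring.induct) auto

lemma coord_ring_restr: "F \<in> coord_ring G \<Longrightarrow> restr G F = F"
  using coord_ring_out by (fastforce simp: restr_def)

lemma coord_ring_reg: "F \<in> coord_ring G \<Longrightarrow> reg G F"
  by (simp add: reg_def coord_ring_restr)

lemma reg_coord_ring: "reg G f \<Longrightarrow> restr G f \<in> coord_ring G"
  by (simp add: reg_def)

text \<open>Induction over untruncated formulas; the case \<open>cong\<close> absorbs the passage to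
  functions extended by zero.\<close>

lemma coord_ring_reg_induct [consumes 1, case_names const entry add mult cong]:
  assumes "F \<in> coord_ring G"
    and "\<And>c. P (\<lambda>_. c)" "\<And>i j. P (\<lambda>x. x $ i $ j)"
    and "\<And>f f'. reg G f \<Longrightarrow> reg G f' \<Longrightarrow> P f \<Longrightarrow> P f' \<Longrightarrow> P (\<lambda>x. f x + f' x)"
    and "\<And>f f'. reg G f \<Longrightarrow> reg G f' \<Longrightarrow> P f \<Longrightarrow> P f' \<Longrightarrow> P (\<lambda>x. f x * f' x)"
    and cong: "\<And>f f'. (\<And>x. x \<in> G \<Longrightarrow> f x = f' x) \<Longrightarrow> P f \<Longrightarrow> P f'"
  shows "P F"
  using assms(1)
proof (induction rule: coord_ring.induct)
  case (const c)
  show ?case by (rule cong[OF _ assms(2)]) simp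
next
  case (entry i j)
  show ?case by (rule cong[OF _ assms(3)]) simp
qed (auto intro: assms(4,5) coord_ring_reg)

lemma reg_comp:
  assumes "F \<in> coord_ring G'" "\<And>x. x \<in> G \<Longrightarrow> \<phi> x \<in> G'" "\<And>i j. reg G (\<lambda>x. \<phi> x $ i $ j)"
  shows "reg G (\<lambda>x. F (\<phi> x))"
  using assms(1)
proof (induction rule: coord_ring_reg_induct)
  case (cong f f')
  then show ?case using reg_cong[of G "\<lambda>x. f (\<phi> x)" "\<lambda>x. f' (\<phi> x)"] assms(2) by blast
qed (simp_all add: reg_const assms(3) reg_add reg_mult)

lemma mat2_mult: "(X ** Y) $ i $ j = X $ i $ 1 * Y $ 1 $ j + X $ i $ 2 * (Y :: 'k::field mat2) $ 2 $ j"
  by (simp add: matrix_matrix_mult_def sum_2)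

lemma reg_matrix_mult:
  fixes \<phi> \<psi> :: "'k::field mat2 \<Rightarrow> 'k mat2"
  assumes "\<And>i j. reg G (\<lambda>x. \<phi> x $ i $ j)" "\<And>i j. reg G (\<lambda>x. \<psi> x $ i $ j)"
  shows "reg G (\<lambda>x. (\<phi> x ** \<psi> x) $ i $ j)"
  unfolding mat2_mult by (intro reg_intros assms)

lemma mat2_eqI:
  "X $ 1 $ 1 = Y $ 1 $ 1 \<Longrightarrow> X $ 1 $ 2 = Y $ 1 $ 2 \<Longrightarrow> X $ 2 $ 1 = Y $ 2 $ 1 \<Longrightarrow> X $ 2 $ 2 = Y $ 2 $ 2 \<Longrightarrow>
    X = (Y :: 'k mat2)"
  by (simp add: vec_eq_iff forall_2)

lemma matrix_inv_eqI:
  fixes X Y :: "'k::field mat2"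
  assumes "X ** Y = mat 1" "Y ** X = mat 1"
  shows "matrix_inv X = Y"
proof -
  have "X ** matrix_inv X = mat 1 \<and> matrix_inv X ** X = mat 1"
    unfolding matrix_inv_def by (rule someI[of _ Y]) (use assms in simp)
  then show ?thesis
    using assms by (metis matrix_mul_assoc matrix_mul_lid matrix_mul_rid)
qed

lemma functionals_add:
  "\<mu> \<in> functionals G \<Longrightarrow> reg G f \<Longrightarrow> reg G f' \<Longrightarrow> \<mu> (restr G (\<lambda>x. f x + f' x)) = \<mu> (restr G f) + \<mu> (restr G f')"
  by (simp add: restr_add functionals_def reg_def)

lemma functionals_scale:
  "\<mu> \<in> functionals G \<Longrightarrow> reg G f \<Longrightarrow> \<mu> (restr G (\<lambda>x. c * f x)) = c * \<mu> (restr G f)"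
  by (simp add: restr_scale functionals_def reg_def)

lemma functionalsI:
  assumes "\<And>f. f \<notin> coord_ring G \<Longrightarrow> \<mu> f = 0"
    and "\<And>f f'. f \<in> coord_ring G \<Longrightarrow> f' \<in> coord_ring G \<Longrightarrow> \<mu> (\<lambda>x. f x + f' x) = \<mu> f + \<mu> f'"
    and "\<And>c f. f \<in> coord_ring G \<Longrightarrow> \<mu> (\<lambda>x. c * f x) = c * \<mu> f"
  shows "\<mu> \<in> functionals G"
  using assms by (simp add: functionals_def)

lemma coord_ring_scale:
  assumes "f \<in> coord_ring G"
  shows "(\<lambda>x. c * f x) \<in> coord_ring G"
  using reg_mult[OF reg_const coord_ring_reg[OF assms], of c] coord_ring_restr[OF assms]
  by (simp add: reg_def restr_scale)

section \<open>The Borel subgroup and its coordinate ring\<close>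

definition lower :: "'k::field \<Rightarrow> 'k \<Rightarrow> 'k mat2" where
  "lower a c = (\<chi> i j. if i = 1 then (if j = 1 then a else 0) else (if j = 1 then c else 1 / a))"

lemma lower_entries [simp]:
  "lower a c $ 1 $ 1 = a" "lower a c $ 1 $ 2 = 0" "lower a c $ 2 $ 1 = c" "lower a c $ 2 $ 2 = 1 / a"
  by (simp_all add: lower_def)

lemma lower_mult: "lower a c ** lower a' c' = lower (a * a') (c * a' + c' / a)"
  by (rule mat2_eqI) (simp_all add: mat2_mult)

lemma lower_one: "lower 1 0 = mat 1"
  by (rule mat2_eqI) (simp_all add: mat_def)

lemma det_lower: "a \<noteq> 0 \<Longrightarrow> det (lower a c) = 1"
  by (simp add: det_2)

lemma lower_borel_eq: "lower_borel = {lower a c | a c. a \<noteq> (0::'k::field)}"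
proof -
  have "\<exists>a c. x = lower a c \<and> a \<noteq> 0" if "x \<in> lower_borel" for x :: "'k mat2"
  proof (intro exI conjI)
    have *: "x $ 1 $ 1 * x $ 2 $ 2 = 1" "x $ 1 $ 2 = 0"
      using that by (auto simp: lower_borel_def SL2_def det_2)
    then show "x $ 1 $ 1 \<noteq> 0" by auto
    then show "x = lower (x $ 1 $ 1) (x $ 2 $ 1)"
      using * by (intro mat2_eqI) (simp_all add: field_simps)
  qed
  then show ?thesis
    by (auto simp: lower_borel_def SL2_def det_lower)
qed

lemma lower_unipotent_eq: "lower_unipotent = {lower (1::'k::field) c | c. True}"
proof -
  have "x = lower 1 (x $ 2 $ 1)" if "x \<in> lower_unipotent" for x :: "'k mat2"
    using that by (intro mat2_eqI) (auto simp: lower_unipotent_def)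
  then show ?thesis
    by (auto simp: lower_unipotent_def)
qed

lemma diag_torus_eq: "diag_torus = {lower a 0 | a. a \<noteq> (0::'k::field)}"
proof -
  have "\<exists>a. x = lower a 0 \<and> a \<noteq> 0" if x: "x \<in> diag_torus" for x :: "'k mat2"
  proof -
    have "x \<in> lower_borel" using x by (auto simp: diag_torus_def lower_borel_def)
    then obtain a c where ac: "x = lower a c" "a \<noteq> 0" using lower_borel_eq by blast
    then show ?thesis using x by (auto simp: diag_torus_def)
  qed
  then show ?thesis
    by (auto simp: diag_torus_def SL2_def det_lower)
qed

text \<open>The inverse of the conjugating matrix is a parameter of its own, so that cancellation is
  plain rewriting with \<open>gh\<close> and \<open>hg\<close>.\<close>

locale conjugate_borel =
  fixes g h :: "'k::alg_closed_field mat2"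
  assumes gh: "g ** h = mat 1" and hg: "h ** g = mat 1" and two: "(2::'k) = 0"
begin

definition pt :: "'k \<Rightarrow> 'k \<Rightarrow> 'k mat2" where
  "pt a c = g ** lower a c ** h"

definition borel :: "'k mat2 set" where "borel = {pt a c | a c. a \<noteq> 0}"
definition unip :: "'k mat2 set" where "unip = {pt 1 c | c. True}"
definition torus :: "'k mat2 set" where "torus = {pt a 0 | a. a \<noteq> 0}"

lemma groups_eq:
  "conj_by g ` lower_borel = borel" "conj_by g ` lower_unipotent = unip" "conj_by g ` diag_torus = torus"
  using matrix_inv_eqI[OF gh hg]
  by (auto simp: conj_by_def borel_def unip_def torus_def pt_def lower_borel_eq lower_unipotent_eq diag_torus_eq)

lemma hgx: "h ** (g ** x) = x"
  by (simp add: matrix_mul_assoc hg)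

lemma pt_mult: "pt a c ** pt a' c' = pt (a * a') (c * a' + c' / a)"
proof -
  have "pt a c ** pt a' c' = g ** (lower a c ** lower a' c') ** h"
    by (simp add: pt_def hgx flip: matrix_mul_assoc)
  then show ?thesis by (simp add: lower_mult pt_def)
qed

lemma pt_one: "pt 1 0 = mat 1"
  by (simp add: pt_def lower_one gh)

lemma pt_inv: "a \<noteq> 0 \<Longrightarrow> matrix_inv (pt a 0) = pt (1 / a) 0"
  by (rule matrix_inv_eqI) (simp_all add: pt_mult pt_one)

text \<open>The origin of all weights: the torus acts on the lower left coordinate by an inverse
  square, that is, through the Frobenius morphism.\<close>

lemma conj_pt: "u \<noteq> 0 \<Longrightarrow> conj_by (pt u 0) (pt a c) = pt a (c / u\<^sup>2)"
  by (simp add: conj_by_def pt_inv pt_mult power2_eq_square)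

text \<open>Coordinates of the matrix conjugated back to lower triangular form. They are linear in
  the entries, hence regular on any set of matrices.\<close>

definition cA :: "'k mat2 \<Rightarrow> 'k" where "cA x = (h ** x ** g) $ 1 $ 1"
definition cC :: "'k mat2 \<Rightarrow> 'k" where "cC x = (h ** x ** g) $ 2 $ 1"
definition cD :: "'k mat2 \<Rightarrow> 'k" where "cD x = (h ** x ** g) $ 2 $ 2"

lemma unconj_pt: "h ** pt a c ** g = lower a c"
  by (simp add: pt_def hgx hg flip: matrix_mul_assoc)

lemma coords_pt [simp]: "cA (pt a c) = a" "cC (pt a c) = c" "cD (pt a c) = 1 / a"
  by (simp_all add: cA_def cC_def cD_def unconj_pt)

lemma reg_coords: "reg G cA" "reg G cC" "reg G cD"
  unfolding cA_def[abs_def] cC_def[abs_def] cD_def[abs_def]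
  by (intro reg_matrix_mult reg_intros)+

lemma pt_entry: "pt a c $ i $ j = g $ i $ 1 * h $ 1 $ j * a + g $ i $ 2 * h $ 1 $ j * c + g $ i $ 2 * h $ 2 $ j * (1 / a)"
  by (simp add: pt_def mat2_mult algebra_simps)

lemma gh_entry: "g $ i $ 1 * h $ 1 $ j + g $ i $ 2 * h $ 2 $ j = (if i = j then 1 else 0)"
  using gh by (simp add: mat2_mult[symmetric] mat_def)

lemma borelE: "x \<in> borel \<Longrightarrow> (\<And>a c. x = pt a c \<Longrightarrow> a \<noteq> 0 \<Longrightarrow> thesis) \<Longrightarrow> thesis"
  by (auto simp: borel_def)

lemma pt_borel: "a \<noteq> 0 \<Longrightarrow> pt a c \<in> borel"
  by (auto simp: borel_def)

lemma mat1_borel: "mat 1 \<in> borel"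
  using pt_borel[of 1 0] by (simp add: pt_one)

lemma borel_mult: "x \<in> borel \<Longrightarrow> y \<in> borel \<Longrightarrow> x ** y \<in> borel"
  by (auto simp: pt_mult intro!: pt_borel elim!: borelE)

lemma coords_one: "cA (mat 1) = 1" "cC (mat 1) = 0"
  using coords_pt[of 1 0] by (simp_all add: pt_one del: coords_pt)

lemma coords_borel:
  assumes "x \<in> borel"
  shows "cA x * cD x = 1"
    "x $ i $ j = g $ i $ 1 * h $ 1 $ j * cA x + g $ i $ 2 * h $ 1 $ j * cC x + g $ i $ 2 * h $ 2 $ j * cD x"
  using assms by (auto elim!: borelE simp: pt_entry)

lemma coords_mult:
  assumes "x \<in> borel" "y \<in> borel"
  shows "cA (x ** y) = cA x * cA y" "cC (x ** y) = cC x * cA y + cD x * cC y"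
  using assms by (auto elim!: borelE simp: pt_mult)

section \<open>Characteristic 2 and the Frobenius morphism\<close>

lemma add_self [simp]: "(x::'k) + x = 0" and add_self' [simp]: "(x::'k) + (x + y) = y"
  using double[OF two] double'[OF two] by auto

lemma uminus_char2 [simp]: "- (x::'k) = x"
  by (simp add: minus_unique)

lemma diff_char2 [simp]: "(x::'k) - y = x + y"
  using uminus_char2[of y] by (metis add_uminus_conv_diff)

lemma square_add: "((x::'k) + y)\<^sup>2 = x\<^sup>2 + y\<^sup>2"
  by (simp add: power2_sum two)

lemma frob_mult: "frob (x ** y) = frob x ** frob (y :: 'k mat2)"
  by (rule mat2_eqI) (simp_all add: frob_def mat2_mult square_add power_mult_distrib)

lemma frob_one: "frob (mat 1) = (mat 1 :: 'k mat2)"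
  by (rule mat2_eqI) (simp_all add: frob_def mat_def)

lemma frob_SL2: "det x = 1 \<Longrightarrow> frob x \<in> (SL2 :: 'k mat2 set)"
proof -
  assume "det x = 1"
  have "det (frob x) = (det x)\<^sup>2"
    by (simp add: det_2 frob_def square_add power_mult_distrib)
  with \<open>det x = 1\<close> show ?thesis by (simp add: SL2_def)
qed

lemma det_pt: "a \<noteq> 0 \<Longrightarrow> det (pt a c) = 1"
proof -
  have "det g * det h = 1"
    using det_mul[of g h] gh by simp
  then show "a \<noteq> 0 \<Longrightarrow> det (pt a c) = 1"
    by (simp add: pt_def det_mul det_lower)
qed

text \<open>Regular functions are polynomial in c and Laurent in a; a power of a clears the
  denominators. \<open>P\<close> is a polynomial in c over polynomials in a, whence the evaluation
  at the constant \<open>[:c:]\<close> before that at \<open>a\<close>.\<close>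

lemma coord_ring_poly:
  assumes "F \<in> coord_ring borel"
  shows "\<exists>(P :: 'k poly poly) n. \<forall>a c. a \<noteq> 0 \<longrightarrow> a ^ n * F (pt a c) = poly (poly P [:c:]) a"
  using assms
proof (induction rule: coord_ring_reg_induct)
  case (const k)
  show ?case by (intro exI[of _ "[:[:k:]:]"] exI[of _ 0]) simp
next
  case (entry i j)
  show ?case
    by (intro exI[of _ "[:[:g $ i $ 2 * h $ 2 $ j, 0, g $ i $ 1 * h $ 1 $ j:], [:0, g $ i $ 2 * h $ 1 $ j:]:]"] exI[of _ 1])
      (simp add: pt_entry field_simps)
next
  case (add f f')
  then obtain P P' :: "'k poly poly" and n n' where
    *: "\<forall>a c. a \<noteq> 0 \<longrightarrow> a ^ n * f (pt a c) = poly (poly P [:c:]) a"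
    "\<forall>a c. a \<noteq> 0 \<longrightarrow> a ^ n' * f' (pt a c) = poly (poly P' [:c:]) a" by blast
  have "a ^ (n + n') * (f (pt a c) + f' (pt a c)) =
      poly (poly ([:monom 1 n':] * P + [:monom 1 n:] * P') [:c:]) a" if "a \<noteq> 0" for a c
    using *[rule_format, OF that, of c, symmetric] by (simp add: poly_monom power_add algebra_simps)
  then show ?case by blast
next
  case (mult f f')
  then obtain P P' :: "'k poly poly" and n n' where
    *: "\<forall>a c. a \<noteq> 0 \<longrightarrow> a ^ n * f (pt a c) = poly (poly P [:c:]) a"
    "\<forall>a c. a \<noteq> 0 \<longrightarrow> a ^ n' * f' (pt a c) = poly (poly P' [:c:]) a" by blast
  have "a ^ (n + n') * (f (pt a c) * f' (pt a c)) = poly (poly (P * P') [:c:]) a" if "a \<noteq> 0" for a c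
    using *[rule_format, OF that, of c, symmetric] by (simp add: power_add mult_ac)
  then show ?case by blast
next
  case (cong f f')
  then show ?case using pt_borel by metis
qed

text \<open>Over a finite field the product of all linear factors plus 1 is nonconstant and takes
  only the value 1, which algebraic closedness forbids.\<close>

lemma infinite_field: "infinite (UNIV :: 'k set)"
proof
  assume fin: "finite (UNIV :: 'k set)"
  define p :: "'k poly" where "p = (\<Prod>a\<in>UNIV. [:- a, 1:]) + 1"
  have "poly (\<Prod>a\<in>UNIV. [:- a, 1:]) x = 0" for x :: 'k
    using fin by (auto simp: poly_prod prod_zero_iff intro!: exI[of _ x])
  then have no_root: "poly p x \<noteq> 0" for x
    by (simp add: p_def)
  have "degree (\<Prod>a\<in>UNIV. [:- a, 1 :: 'k:]) = card (UNIV :: 'k set)"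
    by (subst degree_prod_eq_sum_degree) auto
  then have "degree p = card (UNIV :: 'k set)"
    using fin by (simp add: p_def degree_add_eq_left card_gt_0_iff)
  then have "degree p > 0"
    using fin by (simp add: card_gt_0_iff)
  then show False
    using alg_closed_imp_poly_has_root no_root by blast
qed

lemma poly_eq_0_if_nonzero: "(\<And>a. a \<noteq> 0 \<Longrightarrow> poly p a = (0::'k)) \<Longrightarrow> p = 0"
proof (rule ccontr)
  assume *: "\<And>a. a \<noteq> 0 \<Longrightarrow> poly p a = 0" "p \<noteq> 0"
  then have "finite {a. poly p a = 0}" by (simp add: poly_roots_finite)
  moreover have "UNIV - {0} \<subseteq> {a. poly p a = 0}" using * by auto
  ultimately have "finite (UNIV - {0::'k})" using finite_subset by blast
  then show False using infinite_field by simp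
qed

text \<open>Each constant polynomial \<open>[:c:]\<close> is a root of \<open>P\<close>, and there
  are infinitely many of them.\<close>

lemma poly_poly_eq_0:
  assumes "\<And>a c. a \<noteq> 0 \<Longrightarrow> poly (poly P [:c:]) a = (0::'k)"
  shows "P = 0"
proof (rule ccontr)
  assume "P \<noteq> 0"
  then have "finite {r. poly P r = 0}" by (simp add: poly_roots_finite)
  moreover have "range (\<lambda>c. [:c:]) \<subseteq> {r. poly P r = 0}"
    using poly_eq_0_if_nonzero assms by blast
  ultimately have "finite (range (\<lambda>c::'k. [:c:]))" using finite_subset by blast
  then show False
    using infinite_field by (subst (asm) finite_image_iff) (auto simp: inj_on_def)
qed

section \<open>The ideal of the Frobenius kernel\<close>

text \<open>The ideal generated by A^2 - 1 and C^2, with the sign dropped. Only values on the group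
  are compared, so untruncated formulas qualify.\<close>

definition in_ideal :: "('k mat2 \<Rightarrow> 'k) \<Rightarrow> bool" where
  "in_ideal f \<longleftrightarrow> (\<exists>p q. reg borel p \<and> reg borel q \<and>
     (\<forall>x\<in>borel. f x = ((cA x)\<^sup>2 + 1) * p x + (cC x)\<^sup>2 * q x))"

lemma in_idealI:
  assumes "reg borel p" "reg borel q" "\<And>x. x \<in> borel \<Longrightarrow> f x = ((cA x)\<^sup>2 + 1) * p x + (cC x)\<^sup>2 * q x"
  shows "in_ideal f"
  using assms unfolding in_ideal_def by blast

lemma in_ideal_cong: "(\<And>x. x \<in> borel \<Longrightarrow> f x = f' x) \<Longrightarrow> in_ideal f \<Longrightarrow> in_ideal f'"
  unfolding in_ideal_def by metis

lemma in_ideal_add: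
  assumes "in_ideal f" "in_ideal f'"
  shows "in_ideal (\<lambda>x. f x + f' x)"
proof -
  obtain p q p' q' where *: "reg borel p" "reg borel q" "reg borel p'" "reg borel q'"
    "\<forall>x\<in>borel. f x = ((cA x)\<^sup>2 + 1) * p x + (cC x)\<^sup>2 * q x"
    "\<forall>x\<in>borel. f' x = ((cA x)\<^sup>2 + 1) * p' x + (cC x)\<^sup>2 * q' x"
    using assms unfolding in_ideal_def by metis
  show ?thesis
    by (rule in_idealI[of "\<lambda>x. p x + p' x" "\<lambda>x. q x + q' x"])
      (simp_all add: * reg_add algebra_simps)
qed

lemma in_ideal_mult:
  assumes "in_ideal f" "reg borel r"
  shows "in_ideal (\<lambda>x. r x * f x)"
proof -
  obtain p q where *: "reg borel p" "reg borel q"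
    "\<forall>x\<in>borel. f x = ((cA x)\<^sup>2 + 1) * p x + (cC x)\<^sup>2 * q x"
    using assms unfolding in_ideal_def by metis
  show ?thesis
    by (rule in_idealI[of "\<lambda>x. r x * p x" "\<lambda>x. r x * q x"])
      (simp_all add: * reg_mult assms(2) algebra_simps)
qed

lemma in_ideal_gens: "in_ideal (\<lambda>x. (cA x)\<^sup>2 + 1)" "in_ideal (\<lambda>x. (cC x)\<^sup>2)"
  using in_idealI[of "\<lambda>_. 1" "\<lambda>_. 0"] in_idealI[of "\<lambda>_. 0" "\<lambda>_. 1"] by (simp_all add: reg_const)

lemma in_ideal_D: "in_ideal (\<lambda>x. (cD x)\<^sup>2 + 1)"
proof (rule in_ideal_cong[OF _ in_ideal_mult[OF in_ideal_gens(1) reg_power[OF reg_coords(3)]]])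
  fix x assume "x \<in> borel"
  then show "(cD x)\<^sup>2 * ((cA x)\<^sup>2 + 1) = (cD x)\<^sup>2 + 1"
    using coords_borel(1)[of x] by (simp add: distrib_left add.commute mult.commute flip: power_mult_distrib)
qed

lemma in_ideal_zero: "in_ideal (\<lambda>_. 0)"
  using in_idealI[of "\<lambda>_. 0" "\<lambda>_. 0"] by (simp add: reg_const)

text \<open>The entries of the Frobenius image are linear in A^2, C^2 and D^2, which are congruent
  to 1, 0 and 1; hence a pulled back function is congruent to its value at the identity. Regularity
  is carried along for the product case.\<close>

lemma frob_pullback:
  assumes "f \<in> coord_ring SL2"
  shows "in_ideal (\<lambda>x. f (frob x) + f (mat 1)) \<and> reg borel (\<lambda>x. f (frob x))"
  using assms
proof (induction rule: coord_ring_reg_induct)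
  case (const c)
  then show ?case using in_ideal_zero by (simp add: reg_const)
next
  case (entry i j)
  have "in_ideal (\<lambda>x. (g $ i $ 1 * h $ 1 $ j)\<^sup>2 * ((cA x)\<^sup>2 + 1) + (g $ i $ 2 * h $ 1 $ j)\<^sup>2 * (cC x)\<^sup>2 +
      (g $ i $ 2 * h $ 2 $ j)\<^sup>2 * ((cD x)\<^sup>2 + 1))"
    by (intro in_ideal_add in_ideal_mult in_ideal_gens in_ideal_D reg_const)
  then have "in_ideal (\<lambda>x. frob x $ i $ j + mat 1 $ i $ j)"
  proof (rule in_ideal_cong[rotated])
    fix x assume x: "x \<in> borel"
    have "mat 1 $ i $ j = (g $ i $ 1 * h $ 1 $ j)\<^sup>2 + (g $ i $ 2 * h $ 2 $ j)\<^sup>2"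
      unfolding square_add[symmetric] gh_entry by (simp add: mat_def)
    then show "(g $ i $ 1 * h $ 1 $ j)\<^sup>2 * ((cA x)\<^sup>2 + 1) + (g $ i $ 2 * h $ 1 $ j)\<^sup>2 * (cC x)\<^sup>2 +
      (g $ i $ 2 * h $ 2 $ j)\<^sup>2 * ((cD x)\<^sup>2 + 1) = frob x $ i $ j + mat 1 $ i $ j"
      unfolding frob_def using coords_borel(2)[OF x, of i j]
      by (simp add: square_add power_mult_distrib distrib_left add_ac)
  qed
  moreover have "reg borel (\<lambda>x. frob x $ i $ j)"
    unfolding frob_def by (simp add: reg_intros)
  ultimately show ?case by simp
next
  case (add f f')
  then show ?case
    using in_ideal_add[of "\<lambda>x. f (frob x) + f (mat 1)" "\<lambda>x. f' (frob x) + f' (mat 1)"]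
    by (simp add: reg_add add_ac)
next
  case (mult f f')
  \<comment> \<open>The mixed product \<open>f (frob x) * f' (mat 1)\<close> occurs twice and
    cancels.\<close>
  have "in_ideal (\<lambda>x. f (frob x) * (f' (frob x) + f' (mat 1)) + f' (mat 1) * (f (frob x) + f (mat 1)))"
    using mult(3,4) by (intro in_ideal_add[OF in_ideal_mult in_ideal_mult] reg_const) (rule conjunct1 conjunct2, assumption)+
  then show ?case
    using mult by (simp add: reg_mult algebra_simps)
next
  case (cong f f')
  have "frob x \<in> SL2" if "x \<in> borel" for x
    using that det_pt frob_SL2 by (auto elim!: borelE)
  moreover have "mat 1 \<in> (SL2 :: 'k mat2 set)"
    by (simp add: SL2_def)
  ultimately have "f (frob x) = f' (frob x)" "f (mat 1) = f' (mat 1)" if "x \<in> borel" for x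
    using cong(1) that by auto
  moreover have "f (mat 1) = f' (mat 1)"
    using cong(1) \<open>mat 1 \<in> SL2\<close> by auto
  ultimately show ?case
    using cong(2) in_ideal_cong[of "\<lambda>x. f (frob x) + f (mat 1)" "\<lambda>x. f' (frob x) + f' (mat 1)"]
      reg_cong[of borel "\<lambda>x. f (frob x)" "\<lambda>x. f' (frob x)"] by auto
qed

lemma frob_kernel_ideal_eq: "frob_kernel_ideal borel = {F \<in> coord_ring borel. in_ideal F}"
proof (intro equalityI subsetI)
  fix F assume "F \<in> frob_kernel_ideal borel"
  then show "F \<in> {F \<in> coord_ring borel. in_ideal F}"
  proof (induction rule: frob_kernel_ideal.induct)
    case (gen f)
    then have "in_ideal (\<lambda>x. f (frob x))" "reg borel (\<lambda>x. f (frob x))"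
      using frob_pullback[of f] by (auto simp: augmentation_ideal_def)
    then show ?case
      using in_ideal_cong[of "\<lambda>x. f (frob x)" "restr borel (\<lambda>x. f (frob x))"] by (simp add: reg_coord_ring)
  next
    case (add f f')
    then show ?case by (simp add: coord_ring.add in_ideal_add)
  next
    case (mult f f')
    then show ?case by (simp add: coord_ring.mult in_ideal_mult coord_ring_reg)
  qed
next
  fix F assume "F \<in> {F \<in> coord_ring borel. in_ideal F}"
  then obtain p q where F: "F \<in> coord_ring borel" and pq: "reg borel p" "reg borel q"
    "\<forall>x\<in>borel. F x = ((cA x)\<^sup>2 + 1) * p x + (cC x)\<^sup>2 * q x"
    unfolding in_ideal_def by blast
  have entry: "restr borel (\<lambda>x. frob (h ** x ** g) $ i $ j + e) \<in> frob_kernel_ideal borel"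
    if "e = (mat 1 :: 'k mat2) $ i $ j" for i j e
  proof -
    \<comment> \<open>Conjugating back with \<open>frob h\<close> and \<open>frob g\<close> yields a
      function on the whole of \<open>SL2\<close> whose pullback is the square of a coordinate,
      normalised to vanish at the identity.\<close>
    let ?f = "restr SL2 (\<lambda>y. (frob h ** y ** frob g) $ i $ j + e)"
    have "?f \<in> coord_ring SL2"
      by (intro reg_coord_ring reg_add reg_matrix_mult reg_intros)
    moreover have "frob h ** mat 1 ** frob g = mat 1"
      by (simp add: hg frob_one flip: frob_mult)
    then have "?f (mat 1) = 0"
      by (simp add: SL2_def that)
    ultimately have "restr borel (\<lambda>x. ?f (frob x)) \<in> frob_kernel_ideal borel"
      by (intro frob_kernel_ideal.gen) (simp add: augmentation_ideal_def)
    moreover have "frob x \<in> SL2" if "x \<in> borel" for x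
      using that det_pt frob_SL2 by (auto elim!: borelE)
    then have "restr borel (\<lambda>x. ?f (frob x)) = restr borel (\<lambda>x. frob (h ** x ** g) $ i $ j + e)"
      by (intro restr_cong) (simp add: frob_mult)
    ultimately show ?thesis by simp
  qed
  have "restr borel (\<lambda>x. (cA x)\<^sup>2 + 1) \<in> frob_kernel_ideal borel" "restr borel (\<lambda>x. (cC x)\<^sup>2) \<in> frob_kernel_ideal borel"
    using entry[of 1 1 1] entry[of 0 2 1] by (simp_all add: frob_def cA_def cC_def mat_def)
  then have "(\<lambda>x. restr borel p x * restr borel (\<lambda>x. (cA x)\<^sup>2 + 1) x + restr borel q x * restr borel (\<lambda>x. (cC x)\<^sup>2) x)
    \<in> frob_kernel_ideal borel"
    using pq by (intro frob_kernel_ideal.add frob_kernel_ideal.mult reg_coord_ring)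
  moreover have "(\<lambda>x. restr borel p x * restr borel (\<lambda>x. (cA x)\<^sup>2 + 1) x + restr borel q x * restr borel (\<lambda>x. (cC x)\<^sup>2) x) = F"
    using pq(3) coord_ring_out[OF F] by (auto simp: restr_def fun_eq_iff mult.commute)
  ultimately show "F \<in> frob_kernel_ideal borel" by simp
qed

section \<open>The distribution algebra of the Frobenius kernel\<close>

definition nf :: "'k dp \<Rightarrow> 'k mat2 \<Rightarrow> 'k" where
  "nf e x = re0 e + ep0 e * (cA x * cC x) + re1 e * cA x + ep1 e * cC x"

lemma nf_simps: "nf (e + e') x = nf e x + nf e' x" "nf (dscal c * e) x = c * nf e x" "nf 0 x = 0"
  by (simp_all add: nf_def algebra_simps)

lemma reg_nf: "reg borel (nf e)"
  unfolding nf_def[abs_def] by (intro reg_intros reg_coords)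

lemma in_ideal_DA: "in_ideal (\<lambda>x. cD x + cA x)"
proof (rule in_ideal_cong[OF _ in_ideal_mult[OF in_ideal_gens(1) reg_coords(3)]])
  fix x assume "x \<in> borel"
  then have "cD x * (cA x * cA x) = cA x"
    using coords_borel(1)[of x] by (metis mult.assoc mult.commute mult_1)
  then show "cD x * ((cA x)\<^sup>2 + 1) = cD x + cA x"
    by (simp add: distrib_left power2_eq_square add.commute)
qed

lemma nf_mult:
  "\<exists>e''. in_ideal (\<lambda>x. nf e x * nf e' x + nf e'' x)"
proof -
  obtain p q r s where e: "e = DP p q r s" by (cases e)
  obtain p' q' r' s' where e': "e' = DP p' q' r' s'" by (cases e')
  have "in_ideal (\<lambda>x. nf e x * nf e' x +
      nf (DP (p * p' + r * r') (p * q' + q * p' + r * s' + s * r') (p * r' + r * p') (p * s' + s * p' + q * r' + r * q')) x)"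
    \<comment> \<open>The witnesses collect what is lost on replacing A^2 by 1 and C^2 by 0 in the
      product.\<close>
    by (rule in_idealI[of "\<lambda>x. r * r' + (q * r' + r * q') * cC x"
          "\<lambda>x. q * q' * (cA x)\<^sup>2 + (q * s' + s * q') * cA x + s * s'"])
      (intro reg_intros reg_coords, intro reg_intros reg_coords,
        simp add: nf_def e e' algebra_simps power2_eq_square)
  then show ?thesis by blast
qed

lemma nf_exists:
  assumes "F \<in> coord_ring borel"
  shows "\<exists>e. in_ideal (\<lambda>x. F x + nf e x)"
  using assms
proof (induction rule: coord_ring_reg_induct)
  case (const c)
  show ?case
    by (rule exI[of _ "DP c 0 0 0"], rule in_ideal_cong[OF _ in_ideal_zero]) (simp add: nf_def)
next
  case (entry i j)
  \<comment> \<open>The coefficient of D, which is congruent to A and therefore adds to the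
    coefficient of A.\<close>
  let ?\<gamma> = "g $ i $ 2 * h $ 2 $ j"
  show ?case
  proof (rule exI[of _ "DP 0 0 (g $ i $ 1 * h $ 1 $ j + ?\<gamma>) (g $ i $ 2 * h $ 1 $ j)"],
      rule in_ideal_cong[OF _ in_ideal_mult[OF in_ideal_DA reg_const[of borel "?\<gamma>"]]])
    fix x assume "x \<in> borel"
    from coords_borel(2)[OF this, of i j] show "?\<gamma> * (cD x + cA x) =
        x $ i $ j + nf (DP 0 0 (g $ i $ 1 * h $ 1 $ j + ?\<gamma>) (g $ i $ 2 * h $ 1 $ j)) x"
      by (simp add: nf_def distrib_left distrib_right add_ac)
  qed
next
  case (add f f')
  then obtain e e' where "in_ideal (\<lambda>x. f x + nf e x)" "in_ideal (\<lambda>x. f' x + nf e' x)" by blast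
  from in_ideal_add[OF this] show ?case
    by (intro exI[of _ "e + e'"]) (simp add: nf_simps add_ac)
next
  case (mult f f')
  then obtain e e' where e: "in_ideal (\<lambda>x. f x + nf e x)" "in_ideal (\<lambda>x. f' x + nf e' x)" by blast
  obtain e'' where e'': "in_ideal (\<lambda>x. nf e x * nf e' x + nf e'' x)" using nf_mult by blast
  have "in_ideal (\<lambda>x. f x * (f' x + nf e' x) + nf e' x * (f x + nf e x) + (nf e x * nf e' x + nf e'' x))"
    using mult(1) by (intro in_ideal_add in_ideal_mult e e'' reg_nf)
  then have "in_ideal (\<lambda>x. f x * f' x + nf e'' x)"
    by (rule in_ideal_cong[rotated]) (simp add: algebra_simps)
  then show ?case by blast
next
  case (cong f f')
  then obtain e where "in_ideal (\<lambda>x. f x + nf e x)" by blast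
  then have "in_ideal (\<lambda>x. f' x + nf e x)"
    by (rule in_ideal_cong[rotated]) (simp add: cong)
  then show ?case by blast
qed

text \<open>The variable X is a unit modulo 1 + X^2, since f is (1 + X^2) f minus X times X
  f.\<close>

lemma dvd_monom_mult_cancel: "[:1, 0, 1:] dvd monom 1 n * f \<Longrightarrow> [:1, 0, 1:] dvd (f :: 'k poly)"
proof (induction n arbitrary: f)
  case (Suc n)
  have "monom 1 (Suc n) * f = monom 1 n * ([:0, 1:] * f)"
    by (simp add: monom_Suc)
  then have "[:1, 0, 1:] dvd [:0, 1:] * f"
    using Suc by metis
  then have "[:1, 0, 1:] dvd [:1, 0, 1:] * f - [:0, 1:] * ([:0, 1:] * f)"
    by (rule dvd_diff[OF dvd_triv_left dvd_mult])
  also have "[:1, 0, 1:] * f - [:0, 1:] * ([:0, 1:] * f) = f"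
    by simp
  finally show ?case .
qed (simp add: monom_0)

lemma linear_dvd_eq_0:
  assumes "[:1, 0, 1:] dvd [:a, b:]"
  shows "a = (0::'k) \<and> b = 0"
proof -
  have "[:a, b:] = 0"
  proof (rule ccontr)
    assume "[:a, b:] \<noteq> 0"
    then have "degree [:1, 0, 1::'k:] \<le> degree [:a, b:]"
      using assms by (intro dvd_imp_degree_le)
    then show False by (simp split: if_splits)
  qed
  then show ?thesis by simp
qed

text \<open>Clearing denominators turns the relation into a polynomial identity in a and c. Its
  coefficients at c^0 and c^1 do not see the C^2 term, so 1 + a^2 divides a power of a times a
  polynomial of degree at most 1; cancelling the power leaves only zero.\<close>

lemma nf_unique:
  assumes "in_ideal (nf e)"
  shows "e = 0"
proof -
  obtain p q where pq: "reg borel p" "reg borel q"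
    "\<forall>x\<in>borel. nf e x = ((cA x)\<^sup>2 + 1) * p x + (cC x)\<^sup>2 * q x"
    using assms unfolding in_ideal_def by blast
  obtain P Q :: "'k poly poly" and n m where
    P: "\<forall>a c. a \<noteq> 0 \<longrightarrow> a ^ n * restr borel p (pt a c) = poly (poly P [:c:]) a" and
    Q: "\<forall>a c. a \<noteq> 0 \<longrightarrow> a ^ m * restr borel q (pt a c) = poly (poly Q [:c:]) a"
    using coord_ring_poly[OF reg_coord_ring[OF pq(1)]] coord_ring_poly[OF reg_coord_ring[OF pq(2)]] by blast
  define M where "M = monom (1::'k) (n + m)"
  define K :: "'k poly" where "K = [:1, 0, 1:]"
  \<comment> \<open>Both sides of the relation, times \<open>a ^ (n + m)\<close>, are added up,
    which is the same as subtracting them. The two explicit coefficients belong to c^0 and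
    c^1.\<close>
  define R where "R = [:M * [:re0 e, re1 e:], M * [:ep1 e, ep0 e:]:] + [:K * monom 1 m:] * P
    + [:0, 0, monom 1 n:] * Q"
  have "R = 0"
  proof (rule poly_poly_eq_0)
    fix a c :: 'k assume a: "a \<noteq> 0"
    have "poly (poly R [:c:]) a = a ^ (n + m) * nf e (pt a c) +
        (a\<^sup>2 + 1) * a ^ m * (a ^ n * restr borel p (pt a c)) + c\<^sup>2 * a ^ n * (a ^ m * restr borel q (pt a c))"
      using P[rule_format, OF a, of c] Q[rule_format, OF a, of c]
      by (simp add: R_def K_def M_def poly_monom nf_def power2_eq_square algebra_simps)
    also have "\<dots> = a ^ (n + m) * (nf e (pt a c) + ((a\<^sup>2 + 1) * p (pt a c) + c\<^sup>2 * q (pt a c)))"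
      using pt_borel[OF a] by (simp add: power_add algebra_simps)
    also have "\<dots> = 0"
      using pq(3) pt_borel[OF a] by simp
    finally show "poly (poly R [:c:]) a = 0" .
  qed
  have *: "K dvd u" if "u + K * v = 0" for u v :: "'k poly"
  proof -
    have "u = K * (- v)"
      using that by (simp add: eq_neg_iff_add_eq_0)
    then show ?thesis by (metis dvd_triv_left)
  qed
  have "coeff R 0 = M * [:re0 e, re1 e:] + K * (monom 1 m * coeff P 0)"
    "coeff R 1 = M * [:ep1 e, ep0 e:] + K * (monom 1 m * coeff P 1)"
    by (simp_all add: R_def mult.assoc)
  then have "K dvd M * [:re0 e, re1 e:]" "K dvd M * [:ep1 e, ep0 e:]"
    using * \<open>R = 0\<close> by simp_all
  then have "K dvd [:re0 e, re1 e:]" "K dvd [:ep1 e, ep0 e:]"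
    unfolding M_def K_def by (auto dest: dvd_monom_mult_cancel simp del: mult_pCons_right)
  then show ?thesis
    unfolding K_def using linear_dvd_eq_0 by (auto simp: dp_eq_iff)
qed

section \<open>Normal forms and the functionals dual to them\<close>

definition dec :: "('k mat2 \<Rightarrow> 'k) \<Rightarrow> 'k dp" where
  "dec F = (SOME e. in_ideal (\<lambda>x. F x + nf e x))"

lemma dec_eqI:
  assumes "in_ideal (\<lambda>x. F x + nf e x)"
  shows "dec F = e"
proof -
  have "in_ideal (\<lambda>x. F x + nf (dec F) x)"
    unfolding dec_def using assms by (rule someI)
  from in_ideal_add[OF this assms] have "in_ideal (nf (dec F + e))"
    by (rule in_ideal_cong[rotated]) (simp add: nf_simps add_ac)
  then have "dec F + e = 0" by (rule nf_unique)
  moreover have "(2 :: 'k dp) = 0" using two by (rule dp_two)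
  ultimately show ?thesis
    using add_eq_iff_char2 by (metis add_0_left)
qed

lemma dec: "F \<in> coord_ring borel \<Longrightarrow> in_ideal (\<lambda>x. F x + nf (dec F) x)"
  using nf_exists dec_eqI by blast

lemma dec_form:
  assumes "F \<in> coord_ring borel"
  obtains p q where "reg borel p" "reg borel q"
    "\<And>x. x \<in> borel \<Longrightarrow> F x = nf (dec F) x + (((cA x)\<^sup>2 + 1) * p x + (cC x)\<^sup>2 * q x)"
proof -
  obtain p q where *: "reg borel p" "reg borel q"
    "\<forall>x\<in>borel. F x + nf (dec F) x = ((cA x)\<^sup>2 + 1) * p x + (cC x)\<^sup>2 * q x"
    using dec[OF assms] unfolding in_ideal_def by blast
  have "F x = nf (dec F) x + (((cA x)\<^sup>2 + 1) * p x + (cC x)\<^sup>2 * q x)" if "x \<in> borel" for x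
    using *(3) that by (metis add.commute add_self')
  then show ?thesis using that * by blast
qed

lemma dec_add:
  assumes "F \<in> coord_ring borel" "F' \<in> coord_ring borel"
  shows "dec (\<lambda>x. F x + F' x) = dec F + dec F'"
  by (rule dec_eqI, rule in_ideal_cong[OF _ in_ideal_add[OF assms[THEN dec]]]) (simp add: nf_simps add_ac)

lemma dec_scale:
  assumes "F \<in> coord_ring borel"
  shows "dec (\<lambda>x. c * F x) = dscal c * dec F"
  by (rule dec_eqI, rule in_ideal_cong[OF _ in_ideal_mult[OF dec[OF assms] reg_const]])
    (simp add: nf_simps distrib_left)

definition dp_pair :: "'k dp \<Rightarrow> 'k dp \<Rightarrow> 'k" where
  "dp_pair z e = re0 z * re0 e + ep0 z * ep0 e + re1 z * re1 e + ep1 z * ep1 e"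

text \<open>The functional whose values on 1, AC, A, C are the components of \<open>z\<close>, in
  this order.\<close>

definition dist :: "'k dp \<Rightarrow> 'k fnl" where
  "dist z F = (if F \<in> coord_ring borel then dp_pair z (dec F) else 0)"

lemma dist_functional: "dist z \<in> functionals borel"
  by (rule functionalsI)
    (simp_all add: dist_def coord_ring.add coord_ring_scale dec_add dec_scale dp_pair_def algebra_simps)

lemma dist_ideal: "F \<in> frob_kernel_ideal borel \<Longrightarrow> dist z F = 0"
proof -
  assume F: "F \<in> frob_kernel_ideal borel"
  then have "dec F = 0"
    by (intro dec_eqI) (simp add: nf_simps frob_kernel_ideal_eq)
  then show ?thesis by (simp add: dist_def dp_pair_def)
qed

text \<open>The augmentation ideal is generated by A + 1 and C: vanishing at the identity makes the
  constant coefficient of the normal form equal to that of A.\<close>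

lemma augmentation_form:
  assumes "f \<in> augmentation_ideal borel"
  obtains p q where "reg borel p" "reg borel q" "\<And>x. x \<in> borel \<Longrightarrow> f x = (cA x + 1) * p x + cC x * q x"
proof -
  have f: "f \<in> coord_ring borel" "f (mat 1) = 0"
    using assms by (auto simp: augmentation_ideal_def)
  obtain p q where pq: "reg borel p" "reg borel q"
    "\<And>x. x \<in> borel \<Longrightarrow> f x = nf (dec f) x + (((cA x)\<^sup>2 + 1) * p x + (cC x)\<^sup>2 * q x)"
    using dec_form[OF f(1)] by blast
  have "re0 (dec f) + re1 (dec f) = 0"
    using pq(3)[OF mat1_borel] f(2) by (simp add: coords_one nf_def)
  then have re: "re1 (dec f) = re0 (dec f)"
    by (metis add.commute add_0_right add_self')
  show ?thesis
  proof (rule that[of "\<lambda>x. re0 (dec f) + (cA x + 1) * p x" "\<lambda>x. ep0 (dec f) * cA x + ep1 (dec f) + cC x * q x"])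
    fix x assume "x \<in> borel"
    then show "f x = (cA x + 1) * (re0 (dec f) + (cA x + 1) * p x) +
        cC x * (ep0 (dec f) * cA x + ep1 (dec f) + cC x * q x)"
      by (simp add: pq(3) nf_def re algebra_simps power2_eq_square)
  qed (intro reg_intros reg_coords pq)+
qed

text \<open>Among three generators A + 1 or C one occurs twice, and both (A + 1)^2 = A^2 + 1 and C^2
  are in the ideal. This provides the power required in \<open>Dist1\<close>.\<close>

lemma augmentation_cube:
  assumes "length fs = Suc 2" "set fs \<subseteq> augmentation_ideal borel"
  shows "restr borel (\<lambda>x. \<Prod>f\<leftarrow>fs. f x) \<in> frob_kernel_ideal borel"
proof -
  obtain f1 f2 f3 where fs: "fs = [f1, f2, f3]"
    using assms(1) by (auto simp: length_Suc_conv numeral_2_eq_2)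
  have mem: "f1 \<in> augmentation_ideal borel" "f2 \<in> augmentation_ideal borel" "f3 \<in> augmentation_ideal borel"
    using assms(2) by (auto simp: fs)
  obtain p1 q1 where 1: "reg borel p1" "reg borel q1" "\<And>x. x \<in> borel \<Longrightarrow> f1 x = (cA x + 1) * p1 x + cC x * q1 x"
    using augmentation_form[OF mem(1)] by blast
  obtain p2 q2 where 2: "reg borel p2" "reg borel q2" "\<And>x. x \<in> borel \<Longrightarrow> f2 x = (cA x + 1) * p2 x + cC x * q2 x"
    using augmentation_form[OF mem(2)] by blast
  obtain p3 q3 where 3: "reg borel p3" "reg borel q3" "\<And>x. x \<in> borel \<Longrightarrow> f3 x = (cA x + 1) * p3 x + cC x * q3 x"
    using augmentation_form[OF mem(3)] by blast
  have "in_ideal (\<lambda>x. f1 x * (f2 x * f3 x))"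
  proof (rule in_idealI)
    fix x assume x: "x \<in> borel"
    have "(u * a + c * b) * ((u * a' + c * b') * (u * a'' + c * b'')) =
        u\<^sup>2 * (u * (a * a' * a'') + c * (a * a' * b'' + a * b' * a'' + b * a' * a'')) +
        c\<^sup>2 * (u * (a * b' * b'' + b * a' * b'' + b * b' * a'') + c * (b * b' * b''))" for u c a b a' b' a'' b'' :: 'k
      by (simp add: power2_eq_square distrib_left distrib_right mult_ac add_ac)
    from this[of "cA x + 1"]
    show "f1 x * (f2 x * f3 x) = ((cA x)\<^sup>2 + 1) *
        ((cA x + 1) * (p1 x * p2 x * p3 x) + cC x * (p1 x * p2 x * q3 x + p1 x * q2 x * p3 x + q1 x * p2 x * p3 x)) +
        (cC x)\<^sup>2 * ((cA x + 1) * (p1 x * q2 x * q3 x + q1 x * p2 x * q3 x + q1 x * q2 x * p3 x) + cC x * (q1 x * q2 x * q3 x))"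
      using x by (simp only: 1 2 3 square_add one_power2)
  qed (intro reg_intros reg_coords 1 2 3)+
  then have "in_ideal (restr borel (\<lambda>x. \<Prod>f\<leftarrow>fs. f x))"
    by (rule in_ideal_cong[rotated]) (simp add: fs)
  moreover have "reg borel f1" "reg borel f2" "reg borel f3"
    using mem by (auto simp: augmentation_ideal_def intro: coord_ring_reg)
  then have "reg borel (\<lambda>x. \<Prod>f\<leftarrow>fs. f x)"
    by (simp add: fs reg_mult)
  ultimately show ?thesis
    by (simp add: frob_kernel_ideal_eq reg_coord_ring)
qed

lemma Dist1_carrier: "carrier (Dist1 borel) = range dist"
proof
  show "range dist \<subseteq> carrier (Dist1 borel)"
    using augmentation_cube by (auto simp: Dist1_def dist_functional dist_ideal intro!: exI[of _ 2])
  show "carrier (Dist1 borel) \<subseteq> range dist"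
  proof
    fix \<mu> assume "\<mu> \<in> carrier (Dist1 borel)"
    then have \<mu>: "\<mu> \<in> functionals borel" "\<And>F. F \<in> frob_kernel_ideal borel \<Longrightarrow> \<mu> F = 0"
      by (auto simp: Dist1_def)
    \<comment> \<open>The components are forced to be the values on the basis 1, AC, A, C.\<close>
    define z where "z = DP (\<mu> (restr borel (\<lambda>_. 1))) (\<mu> (restr borel (\<lambda>x. cA x * cC x)))
      (\<mu> (restr borel cA)) (\<mu> (restr borel cC))"
    have "\<mu> F = dist z F" for F
    proof (cases "F \<in> coord_ring borel")
      case True
      let ?e = "dec F"
      let ?i = "\<lambda>x. F x + nf ?e x"
      have reg: "reg borel ?i"
        using True by (intro reg_add reg_nf coord_ring_reg)
      have "in_ideal (restr borel ?i)"
        by (rule in_ideal_cong[OF _ dec[OF True]]) simp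
      then have i: "\<mu> (restr borel ?i) = 0"
        using reg by (intro \<mu>(2)) (simp add: frob_kernel_ideal_eq reg_coord_ring)
      have "F = restr borel (\<lambda>x. nf ?e x + ?i x)"
        by (subst coord_ring_restr[OF True, symmetric], rule restr_cong) (simp add: add_ac)
      then have "\<mu> F = \<mu> (restr borel (\<lambda>x. nf ?e x + ?i x))"
        by (rule arg_cong)
      also have "\<dots> = \<mu> (restr borel (nf ?e))"
        unfolding functionals_add[OF \<mu>(1) reg_nf reg] i by simp
      also have "nf ?e = (\<lambda>x. re0 ?e * 1 + ep0 ?e * (cA x * cC x) + re1 ?e * cA x + ep1 ?e * cC x)"
        by (simp add: nf_def fun_eq_iff)
      also have "\<mu> (restr borel \<dots>) = re0 ?e * re0 z + ep0 ?e * ep0 z + re1 ?e * re1 z + ep1 ?e * ep1 z"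
        by (simp only: functionals_add[OF \<mu>(1)] functionals_scale[OF \<mu>(1)] reg_intros reg_coords z_def dp.sel)
      also have "\<dots> = dist z F"
        using True by (simp add: dist_def dp_pair_def mult.commute)
      finally show ?thesis .
    qed (use \<mu>(1) in \<open>simp add: dist_def functionals_def\<close>)
    then show "\<mu> \<in> range dist" by (intro range_eqI[of _ _ z]) auto
  qed
qed

lemma nf_coord: "restr borel (nf e) \<in> coord_ring borel" "dec (restr borel (nf e)) = e"
proof -
  show "restr borel (nf e) \<in> coord_ring borel"
    by (intro reg_coord_ring reg_nf)
  show "dec (restr borel (nf e)) = e"
    by (rule dec_eqI, rule in_ideal_cong[OF _ in_ideal_zero]) simp
qed

lemma inj_dist: "inj dist"
proof (rule injI)
  fix z w assume *: "dist z = dist w"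
  have "dp_pair z e = dp_pair w e" for e
    using fun_cong[OF *, of "restr borel (nf e)"] by (simp add: dist_def nf_coord)
  from this[of "DP 1 0 0 0"] this[of "DP 0 1 0 0"] this[of "DP 0 0 1 0"] this[of "DP 0 0 0 1"]
  show "z = w" by (simp add: dp_pair_def dp_eq_iff)
qed

text \<open>The tensor square of the coordinate ring, as functions of two variables. Convolution
  applies the inner functional first, and its result has to be regular in the remaining
  variable.\<close>

inductive_set biregular :: "('k mat2 \<Rightarrow> 'k mat2 \<Rightarrow> 'k) set" where
  prod: "p \<in> coord_ring borel \<Longrightarrow> q \<in> coord_ring borel \<Longrightarrow> (\<lambda>x y. p x * q y) \<in> biregular"
| add: "M \<in> biregular \<Longrightarrow> M' \<in> biregular \<Longrightarrow> (\<lambda>x y. M x y + M' x y) \<in> biregular"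

lemma biregular_mult:
  assumes "M \<in> biregular" "M' \<in> biregular"
  shows "(\<lambda>x y. M x y * M' x y) \<in> biregular"
  using assms(1)
proof induction
  case (prod p q)
  show ?case
    using assms(2)
  proof induction
    case (prod p' q')
    have "(\<lambda>x y. (p x * p' x) * (q y * q' y)) \<in> biregular"
      by (intro biregular.prod coord_ring.mult prod \<open>p \<in> _\<close> \<open>q \<in> _\<close>)
    then show ?case by (simp add: mult_ac)
  next
    case (add M M')
    then show ?case using biregular.add by (fastforce simp: distrib_left)
  qed
next
  case (add M M')
  then show ?case using biregular.add by (fastforce simp: distrib_right)
qed

lemma biregular_comult:
  assumes "F \<in> coord_ring borel"
  shows "\<exists>M\<in>biregular. \<forall>x\<in>borel. \<forall>y\<in>borel. F (x ** y) = M x y"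
  using assms
proof (induction rule: coord_ring_reg_induct)
  case (const c)
  show ?case
    by (rule bexI[OF _ biregular.prod[OF coord_ring.const[of borel c] coord_ring.const[of borel 1]]]) simp
next
  case (entry i j)
  show ?case
    by (rule bexI[OF _ biregular.add[OF biregular.prod[OF coord_ring.entry[of borel i 1] coord_ring.entry[of borel 1 j]]
            biregular.prod[OF coord_ring.entry[of borel i 2] coord_ring.entry[of borel 2 j]]]])
      (simp add: mat2_mult)
next
  case (add f f')
  then obtain M M' where "M \<in> biregular" "M' \<in> biregular" "\<forall>x\<in>borel. \<forall>y\<in>borel. f (x ** y) = M x y"
    "\<forall>x\<in>borel. \<forall>y\<in>borel. f' (x ** y) = M' x y" by blast
  then show ?case by (intro bexI[of _ "\<lambda>x y. M x y + M' x y"] biregular.add) auto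
next
  case (mult f f')
  then obtain M M' where "M \<in> biregular" "M' \<in> biregular" "\<forall>x\<in>borel. \<forall>y\<in>borel. f (x ** y) = M x y"
    "\<forall>x\<in>borel. \<forall>y\<in>borel. f' (x ** y) = M' x y" by blast
  then show ?case by (intro bexI[of _ "\<lambda>x y. M x y * M' x y"] biregular_mult) auto
next
  case (cong f f')
  then show ?case by (metis borel_mult)
qed

lemma biregular_slice: "M \<in> biregular \<Longrightarrow> reg borel (M x)"
  by (induction rule: biregular.induct) (auto intro: reg_intros coord_ring_reg)

lemma biregular_functional:
  assumes "M \<in> biregular" and \<nu>: "\<nu> \<in> functionals borel"
  shows "reg borel (\<lambda>x. \<nu> (restr borel (M x)))"
  using assms(1)
proof induction
  case (prod p q)
  then show ?case
    by (auto simp: functionals_scale[OF \<nu>] coord_ring_reg intro!: reg_intros)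
next
  case (add M M')
  then show ?case
    by (auto simp: functionals_add[OF \<nu>] biregular_slice intro!: reg_intros)
qed

section \<open>The coproduct in normal form and the product of functionals\<close>

definition partial :: "'k dp \<Rightarrow> ('k mat2 \<Rightarrow> 'k) \<Rightarrow> 'k mat2 \<Rightarrow> 'k" where
  "partial w F x = dist w (restr borel (\<lambda>y. F (x ** y)))"

lemma reg_translate:
  assumes "F \<in> coord_ring borel" "x \<in> borel"
  shows "reg borel (\<lambda>y. F (x ** y))"
  using assms by (intro reg_comp[OF assms(1)] borel_mult reg_matrix_mult reg_intros)

lemma reg_partial:
  assumes "F \<in> coord_ring borel"
  shows "reg borel (partial w F)"
proof -
  obtain M where M: "M \<in> biregular" "\<forall>x\<in>borel. \<forall>y\<in>borel. F (x ** y) = M x y"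
    using biregular_comult[OF assms] by blast
  have "restr borel (\<lambda>y. F (x ** y)) = restr borel (M x)" if "x \<in> borel" for x
    using M(2) that by (intro restr_cong) auto
  then show ?thesis
    using biregular_functional[OF M(1) dist_functional, of w] unfolding partial_def
    by (subst reg_cong[of _ _ "\<lambda>x. dist w (restr borel (M x))"]) auto
qed

text \<open>The coproduct modulo the ideal, with \<open>w\<close> applied to the second leg: 1 and A
  are group-like, AC goes to AC (x) 1 + 1 (x) AC, and C goes to C (x) A + A (x) C. In the last
  summand the matrix product gives D in place of A, which \<open>in_ideal_DA\<close>
  corrects.\<close>

lemma partial_nf:
  assumes F: "F \<in> coord_ring borel"
  defines "e \<equiv> dec F"
  shows "in_ideal (\<lambda>x. partial w F x + nf (DP (re0 e * re0 w + ep0 e * ep0 w) (ep0 e * re0 w)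
    (re1 e * re1 w + ep1 e * ep1 w) (ep1 e * re1 w)) x)"
proof -
  obtain p q where pq: "reg borel p" "reg borel q"
    "\<And>x. x \<in> borel \<Longrightarrow> F x = nf e x + (((cA x)\<^sup>2 + 1) * p x + (cC x)\<^sup>2 * q x)"
    using dec_form[OF F] unfolding e_def by blast
  let ?p = "restr borel p" and ?q = "restr borel q"
  note CR = reg_coord_ring[OF pq(1)] reg_coord_ring[OF pq(2)]
  \<comment> \<open>Reduction in the second variable with \<open>x\<close> fixed; the terms lying in
    the ideal as functions of \<open>x\<close> are kept with explicit factors and dropped
    afterwards.\<close>
  have partial: "partial w F x = dp_pair w (DP (re0 e + ep0 e * (cA x * cC x)) (ep0 e) (re1 e * cA x + ep1 e * cC x) (ep1 e * cD x)) +
      (((cA x)\<^sup>2 + 1) * partial w ?p x + (cC x)\<^sup>2 * partial w ?q x)" if x: "x \<in> borel" for x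
  proof -
    let ?e = "DP (re0 e + ep0 e * (cA x * cC x)) (ep0 e) (re1 e * cA x + ep1 e * cC x) (ep1 e * cD x)"
    let ?px = "restr borel (\<lambda>y. ?p (x ** y))" and ?qx = "restr borel (\<lambda>y. ?q (x ** y))"
    have CRx: "?px \<in> coord_ring borel" "?qx \<in> coord_ring borel"
      by (intro reg_coord_ring reg_translate CR x)+
    \<comment> \<open>The coefficients come from A(xy)^2 + 1 = A(x)^2 (A(y)^2 + 1) + (A(x)^2 + 1)
      and C(xy)^2 = C(x)^2 (A(y)^2 + 1) + C(x)^2 + D(x)^2 C(y)^2.\<close>
    have "in_ideal (\<lambda>y. ((cA y)\<^sup>2 + 1) * ((cA x)\<^sup>2 * ?px y + (cC x)\<^sup>2 * ?qx y + ep0 e * (cA x * cC x)) + (cC y)\<^sup>2 * ((cD x)\<^sup>2 * ?qx y))"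
      by (rule in_idealI[OF _ _ HOL.refl]) (intro reg_intros coord_ring_reg CRx)+
    from in_ideal_add[OF this in_ideal_add[OF in_ideal_mult[OF dec[OF CRx(1)] reg_const] in_ideal_mult[OF dec[OF CRx(2)] reg_const]]]
    have "in_ideal (\<lambda>y. restr borel (\<lambda>y. F (x ** y)) y +
        nf (?e + (dscal ((cA x)\<^sup>2 + 1) * dec ?px + dscal ((cC x)\<^sup>2) * dec ?qx)) y)"
    proof (rule in_ideal_cong[rotated])
      fix y assume y: "y \<in> borel"
      have AD: "cA x * (cD x * u) = u" "cD x * (cA x * u) = u" "cA x * (u * (v * cD x)) = u * v" for u v
        using coords_borel(1)[OF x] by (metis mult.assoc mult.commute mult_1)+
      show "((cA y)\<^sup>2 + 1) * ((cA x)\<^sup>2 * ?px y + (cC x)\<^sup>2 * ?qx y + ep0 e * (cA x * cC x)) + (cC y)\<^sup>2 * ((cD x)\<^sup>2 * ?qx y) +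
        (((cA x)\<^sup>2 + 1) * (?px y + nf (dec ?px) y) + (cC x)\<^sup>2 * (?qx y + nf (dec ?qx) y)) =
        restr borel (\<lambda>y. F (x ** y)) y +
        nf (?e + (dscal ((cA x)\<^sup>2 + 1) * dec ?px + dscal ((cC x)\<^sup>2) * dec ?qx)) y"
        using x y borel_mult[OF x y]
        by (simp add: pq(3) nf_simps(1,2))
          (simp add: nf_def[of e] nf_def[of "DP a b c d" for a b c d] coords_mult[OF x y] square_add power_mult_distrib
            distrib_left distrib_right mult_ac add_ac power2_eq_square AD)
    qed
    then have "dec (restr borel (\<lambda>y. F (x ** y))) = ?e + (dscal ((cA x)\<^sup>2 + 1) * dec ?px + dscal ((cC x)\<^sup>2) * dec ?qx)"
      by (rule dec_eqI)
    then show ?thesis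
      using reg_coord_ring[OF reg_translate[OF F x]] CRx
      by (simp add: partial_def dist_def dp_pair_def distrib_left mult_ac add_ac)
  qed
  show ?thesis
  proof (rule in_ideal_cong[OF _ in_ideal_add[OF in_ideal_mult[OF in_ideal_DA reg_const[of borel "ep1 e * ep1 w"]]
          in_idealI[OF reg_partial[OF CR(1), of w] reg_partial[OF CR(2), of w] HOL.refl]]])
    fix x assume "x \<in> borel"
    then show "ep1 e * ep1 w * (cD x + cA x) + (((cA x)\<^sup>2 + 1) * partial w ?p x + (cC x)\<^sup>2 * partial w ?q x) =
      partial w F x + nf (DP (re0 e * re0 w + ep0 e * ep0 w) (ep0 e * re0 w) (re1 e * re1 w + ep1 e * ep1 w) (ep1 e * re1 w)) x"
      by (simp only: partial) (simp add: nf_def dp_pair_def distrib_left distrib_right mult_ac add_ac)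
  qed
qed

lemma Dist1_model: "alg_model dscal dist (Dist1 borel)"
proof -
  have "dist z \<otimes>\<^bsub>Dist1 borel\<^esub> dist w = dist (z * w)" for z w
  proof
    fix F
    show "(dist z \<otimes>\<^bsub>Dist1 borel\<^esub> dist w) F = dist (z * w) F"
    proof (cases "F \<in> coord_ring borel")
      case True
      let ?e = "dec F"
      let ?e' = "DP (re0 ?e * re0 w + ep0 ?e * ep0 w) (ep0 ?e * re0 w) (re1 ?e * re1 w + ep1 ?e * ep1 w) (ep1 ?e * re1 w)"
      have "(dist z \<otimes>\<^bsub>Dist1 borel\<^esub> dist w) F = dist z (restr borel (partial w F))"
        using True by (simp add: Dist1_def partial_def[abs_def])
      also have "\<dots> = dp_pair z (dec (restr borel (partial w F)))"
        by (simp add: dist_def reg_coord_ring[OF reg_partial[OF True]])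
      also have "dec (restr borel (partial w F)) = ?e'"
        by (rule dec_eqI, rule in_ideal_cong[OF _ partial_nf[OF True]]) simp
      also have "dp_pair z ?e' = dist (z * w) F"
        using True by (simp add: dist_def dp_pair_def algebra_simps)
      finally show ?thesis .
    qed (simp add: Dist1_def dist_def)
  qed
  moreover have "\<one>\<^bsub>Dist1 borel\<^esub> = dist 1"
  proof
    fix F
    show "\<one>\<^bsub>Dist1 borel\<^esub> F = dist 1 F"
    proof (cases "F \<in> coord_ring borel")
      case True
      obtain p q where "\<And>x. x \<in> borel \<Longrightarrow> F x = nf (dec F) x + (((cA x)\<^sup>2 + 1) * p x + (cC x)\<^sup>2 * q x)"
        using dec_form[OF True] by blast
      from this[OF mat1_borel] show ?thesis
        using True by (simp add: Dist1_def dist_def dp_pair_def nf_def coords_one)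
    qed (simp add: Dist1_def dist_def)
  qed
  ultimately show ?thesis
    unfolding alg_model_def using inj_dist Dist1_carrier
    by (auto simp: Dist1_def dist_def dp_pair_def fun_eq_iff algebra_simps)
qed

text \<open>Conjugation fixes A and scales C, hence also AC, so only the nilpotent components
  change.\<close>

lemma Ad_dist:
  assumes u: "u \<noteq> 0"
  shows "Ad borel (pt u 0) (dist z) = dist (dp_torus (u\<^sup>2) z)"
proof
  fix F
  show "Ad borel (pt u 0) (dist z) F = dist (dp_torus (u\<^sup>2) z) F"
  proof (cases "F \<in> coord_ring borel")
    case True
    let ?c = "conj_by (pt u 0)"
    have c: "?c x \<in> borel" "cA (?c x) = cA x" "cC (?c x) = cC x / u\<^sup>2" if "x \<in> borel" for x
      using that u by (auto elim!: borelE simp: conj_pt intro: pt_borel)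
    have comp: "reg borel (\<lambda>x. f (?c x))" if "f \<in> coord_ring borel" for f
      by (rule reg_comp[OF that c(1)]) (auto simp: conj_by_def intro!: reg_matrix_mult reg_intros)
    obtain p q where pq: "reg borel p" "reg borel q"
      "\<And>x. x \<in> borel \<Longrightarrow> F x = nf (dec F) x + (((cA x)\<^sup>2 + 1) * p x + (cC x)\<^sup>2 * q x)"
      using dec_form[OF True] by blast
    let ?e = "DP (re0 (dec F)) (ep0 (dec F) / u\<^sup>2) (re1 (dec F)) (ep1 (dec F) / u\<^sup>2)"
    have "in_ideal (\<lambda>x. restr borel (\<lambda>x. F (?c x)) x + nf ?e x)"
    proof (rule in_idealI)
      \<comment> \<open>The factor \<open>1 / u ^ 4\<close> is the scaling of C^2 under
        conjugation.\<close>
      show "reg borel (\<lambda>x. restr borel p (?c x))" "reg borel (\<lambda>x. 1 / u ^ 4 * restr borel q (?c x))"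
        by (intro reg_intros comp reg_coord_ring pq)+
      fix x assume x: "x \<in> borel"
      show "restr borel (\<lambda>x. F (?c x)) x + nf ?e x =
          ((cA x)\<^sup>2 + 1) * restr borel p (?c x) + (cC x)\<^sup>2 * (1 / u ^ 4 * restr borel q (?c x))"
        using u by (simp add: x c(1)[OF x] pq(3))
          (simp add: nf_def c[OF x] power_divide algebra_simps flip: power_mult)
    qed
    then have "dec (restr borel (\<lambda>x. F (?c x))) = ?e" by (rule dec_eqI)
    then show ?thesis
      using True reg_coord_ring[OF comp[OF True]]
      by (simp add: Ad_def dist_def dp_pair_def)
  qed (simp add: Ad_def dist_def)
qed

section \<open>The Lie algebra of the unipotent radical\<close>

lemma unip_poly:
  assumes "F \<in> coord_ring unip"
  shows "\<exists>P. \<forall>c. F (pt 1 c) = poly P c"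
  using assms
proof (induction rule: coord_ring_reg_induct)
  case (const c)
  show ?case by (rule exI[of _ "[:c:]"]) simp
next
  case (entry i j)
  show ?case
    by (rule exI[of _ "[:g $ i $ 1 * h $ 1 $ j + g $ i $ 2 * h $ 2 $ j, g $ i $ 2 * h $ 1 $ j:]"])
      (simp add: pt_entry algebra_simps)
next
  case (add f f')
  then show ?case by (metis poly_add)
next
  case (mult f f')
  then show ?case by (metis poly_mult)
next
  case (cong f f')
  then show ?case by (auto simp: unip_def) metis
qed

text \<open>The derivative at the identity in the coordinate c. The chosen polynomial is unique
  because the field is infinite.\<close>

definition unip_deriv :: "'k fnl" where
  "unip_deriv F = (if F \<in> coord_ring unip then coeff (SOME P. \<forall>c. F (pt 1 c) = poly P c) 1 else 0)"

lemma unip_deriv_eqI: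
  assumes "F \<in> coord_ring unip" "\<And>c. F (pt 1 c) = poly P c"
  shows "unip_deriv F = coeff P 1"
proof -
  have "(SOME P. \<forall>c. F (pt 1 c) = poly P c) = P"
  proof (rule some_equality)
    fix Q assume "\<forall>c. F (pt 1 c) = poly Q c"
    then have "Q - P = 0"
      using assms(2) by (intro poly_eq_0_if_nonzero) (simp add: poly_diff del: diff_char2)
    then show "Q = P" by simp
  qed (use assms(2) in simp)
  then show ?thesis using assms(1) by (simp add: unip_deriv_def)
qed

lemma Lie_memI:
  assumes "\<delta> \<in> functionals G"
    and "\<And>f f'. f \<in> coord_ring G \<Longrightarrow> f' \<in> coord_ring G \<Longrightarrow> \<delta> (\<lambda>x. f x * f' x) = f (mat 1) * \<delta> f' + \<delta> f * f' (mat 1)"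
  shows "\<delta> \<in> carrier (Lie G)"
  using assms by (simp add: Lie_def)

lemma Lie_simps:
  "\<delta> \<in> carrier (Lie G) \<Longrightarrow> f \<in> coord_ring G \<Longrightarrow> f' \<in> coord_ring G \<Longrightarrow> \<delta> (\<lambda>x. f x + f' x) = \<delta> f + \<delta> f'"
  "\<delta> \<in> carrier (Lie G) \<Longrightarrow> f \<in> coord_ring G \<Longrightarrow> \<delta> (\<lambda>x. c * f x) = c * \<delta> f"
  "\<delta> \<in> carrier (Lie G) \<Longrightarrow> f \<in> coord_ring G \<Longrightarrow> f' \<in> coord_ring G \<Longrightarrow>
    \<delta> (\<lambda>x. f x * f' x) = f (mat 1) * \<delta> f' + \<delta> f * f' (mat 1)"
  "\<delta> \<in> carrier (Lie G) \<Longrightarrow> f \<notin> coord_ring G \<Longrightarrow> \<delta> f = 0"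
  by (simp_all add: Lie_def functionals_def)

lemma Lie_ops: "\<delta> \<oplus>\<^bsub>Lie G\<^esub> \<delta>' = (\<lambda>f. \<delta> f + \<delta>' f)" "c \<odot>\<^bsub>Lie G\<^esub> \<delta> = (\<lambda>f. c * \<delta> f)"
  by (simp_all add: Lie_def)

lemma Lie_scale: "\<delta> \<in> carrier (Lie G) \<Longrightarrow> (\<lambda>f. c * \<delta> f) \<in> carrier (Lie G)"
  by (intro Lie_memI functionalsI) (simp_all add: Lie_simps algebra_simps)

lemma unip_deriv_Lie: "unip_deriv \<in> carrier (Lie unip)"
proof (intro Lie_memI functionalsI)
  fix f f' :: "'k mat2 \<Rightarrow> 'k" and c
  assume f: "f \<in> coord_ring unip"
  then obtain P where P: "\<forall>c. f (pt 1 c) = poly P c" using unip_poly by blast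
  show "unip_deriv (\<lambda>x. c * f x) = c * unip_deriv f"
    using unip_deriv_eqI[of "\<lambda>x. c * f x" "Polynomial.smult c P"] unip_deriv_eqI[of f P] f P
    by (simp add: coord_ring_scale)
  assume f': "f' \<in> coord_ring unip"
  then obtain P' where P': "\<forall>c. f' (pt 1 c) = poly P' c" using unip_poly by blast
  show "unip_deriv (\<lambda>x. f x + f' x) = unip_deriv f + unip_deriv f'"
    using unip_deriv_eqI[of "\<lambda>x. f x + f' x" "P + P'"] unip_deriv_eqI[of f P] unip_deriv_eqI[of f' P'] f f' P P'
    by (simp add: coord_ring.add)
  show "unip_deriv (\<lambda>x. f x * f' x) = f (mat 1) * unip_deriv f' + unip_deriv f * f' (mat 1)"
    using unip_deriv_eqI[of "\<lambda>x. f x * f' x" "P * P'"] unip_deriv_eqI[of f P] unip_deriv_eqI[of f' P'] f f'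
      P P' P[rule_format, of 0] P'[rule_format, of 0]
    by (simp add: coord_ring.mult coeff_mult pt_one poly_0_coeff_0)
qed (simp add: unip_deriv_def)

abbreviation (input) "unip_coord \<equiv> restr unip cC"

lemma unip_coord: "unip_coord \<in> coord_ring unip" "unip_deriv unip_coord = 1"
proof -
  show *: "unip_coord \<in> coord_ring unip"
    by (intro reg_coord_ring reg_coords)
  show "unip_deriv unip_coord = 1"
  proof -
    have "pt 1 c \<in> unip" for c by (auto simp: unip_def)
    then show ?thesis using unip_deriv_eqI[OF *, of "[:0, 1:]"] by simp
  qed
qed

lemma mat1_unip: "mat 1 \<in> unip"
  unfolding unip_def using pt_one[symmetric] by blast

lemma Lie_unip_const:
  assumes \<delta>: "\<delta> \<in> carrier (Lie unip)"
  shows "\<delta> (restr unip (\<lambda>_. c)) = 0"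
proof -
  let ?one = "restr unip (\<lambda>_. 1)"
  have one: "?one \<in> coord_ring unip" by (rule coord_ring.const)
  note mat1_unip
  moreover have "(\<lambda>x. ?one x * ?one x) = ?one" by (auto simp: restr_def)
  ultimately have "\<delta> ?one = 0"
    using Lie_simps(3)[OF \<delta> one one] by simp
  moreover have "restr unip (\<lambda>_. c) = (\<lambda>x. c * ?one x)" by (auto simp: restr_def)
  ultimately show ?thesis using Lie_simps(2)[OF \<delta> one] by simp
qed

text \<open>A point derivation is determined by its values on the matrix entries, each of which is a
  constant plus a multiple of the coordinate c. So the Lie algebra is a line.\<close>

lemma Lie_unip_eq:
  assumes \<delta>: "\<delta> \<in> carrier (Lie unip)"
  shows "\<delta> F = \<delta> unip_coord * unip_deriv F"
proof (cases "F \<in> coord_ring unip")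
  case True
  then show ?thesis
  proof (induction rule: coord_ring.induct)
    case (const c)
    show ?case by (simp add: Lie_unip_const \<delta> unip_deriv_Lie)
  next
    case (entry i j)
    let ?k = "restr unip (\<lambda>_. g $ i $ 1 * h $ 1 $ j + g $ i $ 2 * h $ 2 $ j)"
    let ?b = "g $ i $ 2 * h $ 1 $ j"
    have *: "restr unip (\<lambda>x. x $ i $ j) = (\<lambda>x. ?k x + ?b * unip_coord x)"
    proof
      fix x
      show "restr unip (\<lambda>x. x $ i $ j) x = ?k x + ?b * unip_coord x"
      proof (cases "x \<in> unip")
        case True
        then obtain c where "x = pt 1 c" by (auto simp: unip_def)
        with True show ?thesis by (simp add: pt_entry algebra_simps)
      qed simp
    qed
    show ?case
      unfolding * Lie_simps(1)[OF \<delta> coord_ring.const coord_ring_scale[OF unip_coord(1)]]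
        Lie_simps(1)[OF unip_deriv_Lie coord_ring.const coord_ring_scale[OF unip_coord(1)]]
        Lie_simps(2)[OF \<delta> unip_coord(1)] Lie_simps(2)[OF unip_deriv_Lie unip_coord(1)]
      by (simp add: Lie_unip_const \<delta> unip_deriv_Lie unip_coord)
  next
    case (add f f')
    then show ?case using \<delta> unip_deriv_Lie by (simp add: Lie_simps distrib_left)
  next
    case (mult f f')
    then show ?case using \<delta> unip_deriv_Lie by (simp add: Lie_simps algebra_simps)
  qed
qed (simp add: Lie_simps(4)[OF \<delta>] unip_deriv_def)

section \<open>The dual line and its coadjoint weight\<close>

abbreviation (input) "u_dual \<equiv> dual_space (Lie unip)"

definition dual_gen :: "'k fnl \<Rightarrow> 'k" where
  "dual_gen \<delta> = (if \<delta> \<in> carrier (Lie unip) then \<delta> unip_coord else 0)"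

definition dual_coord :: "('k fnl \<Rightarrow> 'k) \<Rightarrow> 'k" where
  "dual_coord \<eta> = \<eta> unip_deriv"

lemma Lie_add: "\<delta> \<in> carrier (Lie G) \<Longrightarrow> \<delta>' \<in> carrier (Lie G) \<Longrightarrow> (\<lambda>f. \<delta> f + \<delta>' f) \<in> carrier (Lie G)"
  by (intro Lie_memI functionalsI) (simp_all add: Lie_simps algebra_simps)

lemma u_dual_carrier: "\<eta> \<in> carrier u_dual \<longleftrightarrow>
    (\<forall>\<delta>. \<delta> \<notin> carrier (Lie unip) \<longrightarrow> \<eta> \<delta> = 0) \<and>
    (\<forall>\<delta>\<in>carrier (Lie unip). \<forall>\<delta>'\<in>carrier (Lie unip). \<eta> (\<lambda>f. \<delta> f + \<delta>' f) = \<eta> \<delta> + \<eta> \<delta>') \<and>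
    (\<forall>c. \<forall>\<delta>\<in>carrier (Lie unip). \<eta> (\<lambda>f. c * \<delta> f) = c * \<eta> \<delta>)"
  by (simp add: dual_space_def Lie_ops)

lemma u_dual_ops: "\<xi> \<oplus>\<^bsub>u_dual\<^esub> \<eta> = (\<lambda>v. \<xi> v + \<eta> v)" "c \<odot>\<^bsub>u_dual\<^esub> \<xi> = (\<lambda>v. c * \<xi> v)"
  by (simp_all add: dual_space_def)

lemma dual_gen: "dual_gen \<in> carrier u_dual" "dual_coord dual_gen = 1"
  by (simp_all add: u_dual_carrier dual_gen_def Lie_add Lie_scale dual_coord_def unip_deriv_Lie unip_coord)

lemma u_dual_closed:
  "\<xi> \<in> carrier u_dual \<Longrightarrow> \<eta> \<in> carrier u_dual \<Longrightarrow> \<xi> \<oplus>\<^bsub>u_dual\<^esub> \<eta> \<in> carrier u_dual"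
  "\<xi> \<in> carrier u_dual \<Longrightarrow> c \<odot>\<^bsub>u_dual\<^esub> \<xi> \<in> carrier u_dual"
  by (simp_all add: u_dual_ops u_dual_carrier algebra_simps)

lemma dual_coord:
  "dual_coord (\<xi> \<oplus>\<^bsub>u_dual\<^esub> \<eta>) = dual_coord \<xi> + dual_coord \<eta>" "dual_coord (c \<odot>\<^bsub>u_dual\<^esub> \<xi>) = c * dual_coord \<xi>"
  by (simp_all add: u_dual_ops dual_coord_def)

lemma u_dual_line:
  assumes "\<eta> \<in> carrier u_dual"
  shows "\<eta> = dual_coord \<eta> \<odot>\<^bsub>u_dual\<^esub> dual_gen"
proof
  fix \<delta>
  show "\<eta> \<delta> = (dual_coord \<eta> \<odot>\<^bsub>u_dual\<^esub> dual_gen) \<delta>"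
  proof (cases "\<delta> \<in> carrier (Lie unip)")
    case True
    then have "\<delta> = (\<lambda>f. \<delta> unip_coord * unip_deriv f)"
      using Lie_unip_eq by blast
    then have "\<eta> \<delta> = \<eta> (\<lambda>f. \<delta> unip_coord * unip_deriv f)"
      by (rule arg_cong)
    also have "\<dots> = \<delta> unip_coord * \<eta> unip_deriv"
      using assms unip_deriv_Lie by (simp add: u_dual_carrier)
    finally show ?thesis
      using True by (simp add: u_dual_ops dual_gen_def dual_coord_def)
  qed (use assms in \<open>simp add: u_dual_carrier u_dual_ops dual_gen_def\<close>)
qed

lemma Ad_Lie:
  assumes u: "u \<noteq> 0" and \<delta>: "\<delta> \<in> carrier (Lie unip)"
  shows "Ad unip (pt u 0) \<delta> \<in> carrier (Lie unip)" "Ad unip (pt u 0) \<delta> unip_coord = \<delta> unip_coord / u\<^sup>2"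
proof -
  let ?c = "conj_by (pt u 0)"
  have c: "?c x \<in> unip" "cC (?c x) = cC x / u\<^sup>2" if "x \<in> unip" for x
    using that u by (auto simp: unip_def conj_pt)
  have one: "?c (mat 1) = mat 1" "mat 1 \<in> unip"
    using conj_pt[OF u, of 1 0] by (simp_all add: pt_one mat1_unip)
  have comp: "restr unip (\<lambda>x. f (?c x)) \<in> coord_ring unip" if "f \<in> coord_ring unip" for f
    by (rule reg_coord_ring, rule reg_comp[OF that c(1)]) (auto simp: conj_by_def intro!: reg_matrix_mult reg_intros)
  show "Ad unip (pt u 0) \<delta> \<in> carrier (Lie unip)"
  proof (intro Lie_memI functionalsI)
    fix f f' :: "'k mat2 \<Rightarrow> 'k" and a
    assume f: "f \<in> coord_ring unip"
    show "Ad unip (pt u 0) \<delta> (\<lambda>x. a * f x) = a * Ad unip (pt u 0) \<delta> f"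
      using f Lie_simps(2)[OF \<delta> comp[OF f], of a] by (simp add: Ad_def coord_ring_scale restr_scale)
    assume f': "f' \<in> coord_ring unip"
    show "Ad unip (pt u 0) \<delta> (\<lambda>x. f x + f' x) = Ad unip (pt u 0) \<delta> f + Ad unip (pt u 0) \<delta> f'"
      using f f' Lie_simps(1)[OF \<delta> comp[OF f] comp[OF f']] by (simp add: Ad_def coord_ring.add restr_add)
    show "Ad unip (pt u 0) \<delta> (\<lambda>x. f x * f' x) =
        f (mat 1) * Ad unip (pt u 0) \<delta> f' + Ad unip (pt u 0) \<delta> f * f' (mat 1)"
      using f f' Lie_simps(3)[OF \<delta> comp[OF f] comp[OF f']] by (simp add: Ad_def coord_ring.mult restr_mult one)
  qed (simp add: Ad_def)
  have "restr unip (\<lambda>x. unip_coord (?c x)) = (\<lambda>x. 1 / u\<^sup>2 * unip_coord x)"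
    using c by (auto simp: restr_def)
  then show "Ad unip (pt u 0) \<delta> unip_coord = \<delta> unip_coord / u\<^sup>2"
    using Lie_simps(2)[OF \<delta> unip_coord(1), of "1 / u\<^sup>2"] by (simp add: Ad_def unip_coord)
qed

text \<open>The dual action uses the inverse torus element, which turns the weight u^-2 of the Lie
  algebra into u^2.\<close>

lemma coad:
  assumes u: "u \<noteq> 0" and \<eta>: "\<eta> \<in> carrier u_dual"
  shows "dual_act (Lie unip) (Ad unip) (pt u 0) \<eta> \<in> carrier u_dual"
    "dual_coord (dual_act (Lie unip) (Ad unip) (pt u 0) \<eta>) = u\<^sup>2 * dual_coord \<eta>"
proof -
  let ?Ad = "Ad unip (pt (1 / u) 0)"
  have u': "1 / u \<noteq> 0" using u by simp
  have act: "dual_act (Lie unip) (Ad unip) (pt u 0) \<eta> \<delta> = (if \<delta> \<in> carrier (Lie unip) then \<eta> (?Ad \<delta>) else 0)" for \<delta>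
    by (simp add: dual_act_def pt_inv u)
  have Ad: "?Ad \<delta> = (\<lambda>f. u\<^sup>2 * \<delta> f)" if \<delta>: "\<delta> \<in> carrier (Lie unip)" for \<delta>
  proof
    fix f
    show "?Ad \<delta> f = u\<^sup>2 * \<delta> f"
      using Lie_unip_eq[OF Ad_Lie(1)[OF u' \<delta>], of f] Lie_unip_eq[OF \<delta>, of f] Ad_Lie(2)[OF u' \<delta>]
      by (simp add: power_divide mult.commute)
  qed
  show "dual_act (Lie unip) (Ad unip) (pt u 0) \<eta> \<in> carrier u_dual"
    using \<eta> unfolding u_dual_carrier act
    by (simp add: Ad Lie_add Lie_scale) (simp add: distrib_left mult.left_commute)
  show "dual_coord (dual_act (Lie unip) (Ad unip) (pt u 0) \<eta>) = u\<^sup>2 * dual_coord \<eta>"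
    using \<eta> unip_deriv_Lie by (simp add: dual_coord_def act Ad u_dual_carrier)
qed

section \<open>The weight of the torus\<close>

text \<open>The coadjoint character as a function of the Frobenius image: conjugated back, the upper
  left entry of \<open>frob (pt u 0)\<close> is u^2. Being regular in \<open>s\<close>, it makes the
  descended actions rational.\<close>

definition weight :: "'k mat2 \<Rightarrow> 'k" where
  "weight = restr (frob ` torus) (\<lambda>s. (frob h ** s ** frob g) $ 1 $ 1)"

lemma unconj_frob: "frob h ** frob (pt u 0) ** frob g = frob (lower u 0)"
  by (simp add: unconj_pt flip: frob_mult)

lemma weight_frob: "u \<noteq> 0 \<Longrightarrow> weight (frob (pt u 0)) = u\<^sup>2"
proof -
  assume "u \<noteq> 0"
  then have "frob (pt u 0) \<in> frob ` torus"
    by (intro imageI) (auto simp: torus_def)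
  then have "weight (frob (pt u 0)) = frob (lower u 0) $ 1 $ 1"
    by (simp add: weight_def unconj_frob)
  then show ?thesis by (simp add: frob_def)
qed

lemma torusE: "t \<in> torus \<Longrightarrow> (\<And>u. t = pt u 0 \<Longrightarrow> u \<noteq> 0 \<Longrightarrow> thesis) \<Longrightarrow> thesis"
  by (auto simp: torus_def)

lemma weight_regular: "weight \<in> coord_ring (frob ` torus)" "(\<lambda>s. 1 / weight s) \<in> coord_ring (frob ` torus)"
proof -
  show "weight \<in> coord_ring (frob ` torus)"
    unfolding weight_def by (intro reg_coord_ring reg_matrix_mult reg_intros)
  have "(\<lambda>s. 1 / weight s) = restr (frob ` torus) (\<lambda>s. (frob h ** s ** frob g) $ 2 $ 2)"
  proof
    fix s
    show "1 / weight s = restr (frob ` torus) (\<lambda>s. (frob h ** s ** frob g) $ 2 $ 2) s"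
    proof (cases "s \<in> frob ` torus")
      case True
      then obtain u where "s = frob (pt u 0)" "u \<noteq> 0" by (auto elim: torusE)
      then show ?thesis
        using True weight_frob by (simp add: unconj_frob) (simp add: frob_def power_divide)
    qed (simp add: weight_def)
  qed
  then show "(\<lambda>s. 1 / weight s) \<in> coord_ring (frob ` torus)"
    by (simp only:) (intro reg_coord_ring reg_matrix_mult reg_intros)
qed

lemma weight_hom:
  "weight (mat 1) = 1" "s \<in> frob ` torus \<Longrightarrow> t \<in> frob ` torus \<Longrightarrow> weight (s ** t) = weight s * weight t"
proof -
  show "weight (mat 1) = 1"
    using weight_frob[of 1] by (simp add: pt_one frob_one)
  assume "s \<in> frob ` torus" "t \<in> frob ` torus"
  then obtain u v where "s = frob (pt u 0)" "t = frob (pt v 0)" "u \<noteq> 0" "v \<noteq> 0"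
    by (auto elim!: torusE)
  then show "weight (s ** t) = weight s * weight t"
    using weight_frob[of "u * v"] by (simp add: weight_frob pt_mult power_mult_distrib flip: frob_mult)
qed

lemma weight_nonzero: "t \<in> torus \<Longrightarrow> weight (frob t) \<noteq> 0"
  by (auto elim!: torusE simp: weight_frob)

lemma Ad_dist_torus: "t \<in> torus \<Longrightarrow> Ad borel t (dist z) = dist (dp_torus (weight (frob t)) z)"
  by (auto elim!: torusE simp: Ad_dist weight_frob)

lemma Ad_dist_torus_inv:
  "t \<in> torus \<Longrightarrow> Ad borel (matrix_inv t) (dist z) = dist (dp_torus (1 / weight (frob t)) z)"
  by (auto elim!: torusE simp: pt_inv Ad_dist weight_frob power_divide)

text \<open>The cohomology ring and the tensor product share the model \<open>'k poly dp\<close>,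
  and the isomorphism is the change of model. Degrees and actions agree because each is given by the
  same formula there.\<close>

lemma HH_Dist1_iso:
  defines "D \<equiv> Dist1 borel"
    and "coad \<equiv> dual_act (Lie unip) (Ad unip)"
  shows "\<exists>\<sigma>\<^sub>H \<sigma>\<^sub>S \<sigma>\<^sub>D \<Phi>.
    frob_descent torus (HH D) (HH_act D (Ad borel)) \<sigma>\<^sub>H \<and>
    frob_descent torus (sym_algebra u_dual) (sym_act coad) \<sigma>\<^sub>S \<and>
    frob_descent torus D (Ad borel) \<sigma>\<^sub>D \<and>
    \<Phi> \<in> algebra_iso (HH D) (tensor_algebra (sym_algebra u_dual) D) \<and>
    (\<forall>n. \<Phi> ` HH_grade D n = tensor_grade (sym_algebra u_dual) D (sym_grade u_dual) n) \<and>
    (\<forall>s\<in>frob ` torus. \<forall>x\<in>carrier (HH D).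
       \<Phi> (\<sigma>\<^sub>H s x) = tensor_act \<sigma>\<^sub>S \<sigma>\<^sub>D s (\<Phi> x))"
proof -
  let ?S = "sym_algebra u_dual"
  have D: "alg_model dscal dist D"
    unfolding D_def by (rule Dist1_model)
  define \<eta> where "\<eta> = fib (hoch_cocycles D) (hoch_symbol dist)"
  have H: "alg_model dp_poly_scal \<eta> (HH D)"
    unfolding \<eta>_def by (rule HH_model[OF D two])
  note line = dual_gen u_dual_closed dual_coord u_dual_line
  define \<alpha> where "\<alpha> = fib (free_comm_algebra u_dual) (sym_symbol dual_coord)"
  have S: "alg_model poly_scal \<alpha> ?S"
    unfolding \<alpha>_def by (rule sym_model[OF line])
  define \<tau> where "\<tau> = fib (pair_algebra ?S D) (pair_symbol \<alpha> dist)"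
  have T: "alg_model dp_poly_scal \<tau> (tensor_algebra ?S D)"
    unfolding \<tau>_def by (rule tensor_model[OF S D])
  define \<sigma>\<^sub>H where "\<sigma>\<^sub>H = (\<lambda>s x. \<eta> (dp_poly_torus (weight s) (inv_into UNIV \<eta> x)))"
  define \<sigma>\<^sub>S where "\<sigma>\<^sub>S = (\<lambda>s x. \<alpha> (poly_torus (weight s) (inv_into UNIV \<alpha> x)))"
  define \<sigma>\<^sub>D where "\<sigma>\<^sub>D = (\<lambda>s x. dist (dp_torus (weight s) (inv_into UNIV dist x)))"
  define \<Phi> where "\<Phi> = \<tau> \<circ> inv_into UNIV \<eta>"
  have \<Phi>: "\<Phi> (\<eta> p) = \<tau> p" for p
    by (simp add: \<Phi>_def alg_modelD[OF H])
  have "frob_descent torus (HH D) (HH_act D (Ad borel)) \<sigma>\<^sub>H"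
    unfolding \<sigma>\<^sub>H_def
  proof (rule model_frob_descent[OF H model_rational_rep[OF H]])
    show "HH_act D (Ad borel) t (\<eta> z) = \<eta> (dp_poly_torus (weight (frob t)) z)" if "t \<in> torus" for t z
      unfolding \<eta>_def using that
      by (intro HH_act_eq[OF D two] weight_nonzero Ad_dist_torus Ad_dist_torus_inv)
  qed (use dp_poly_torus_simps weight_hom loc_fin_dp_poly_torus[OF weight_regular] in auto)
  moreover have "frob_descent torus ?S (sym_act coad) \<sigma>\<^sub>S"
    unfolding \<sigma>\<^sub>S_def
  proof (rule model_frob_descent[OF S model_rational_rep[OF S]])
    show "sym_act coad t (\<alpha> z) = \<alpha> (poly_torus (weight (frob t)) z)" if t: "t \<in> torus" for t z
    proof -
      obtain u where "t = pt u 0" "u \<noteq> 0" using t by (rule torusE)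
      then show ?thesis
        unfolding \<alpha>_def coad_def using coad[of u]
        by (intro sym_act_eq[OF line]) (simp_all add: weight_frob)
    qed
  qed (use poly_torus_simps weight_hom loc_fin_poly_torus[OF weight_regular] in auto)
  moreover have "frob_descent torus D (Ad borel) \<sigma>\<^sub>D"
    unfolding \<sigma>\<^sub>D_def
    by (rule model_frob_descent[OF D model_rational_rep[OF D]])
      (use dp_torus_simps weight_hom loc_fin_dp_torus[OF weight_regular] Ad_dist_torus in auto)
  moreover have "\<Phi> \<in> algebra_iso (HH D) (tensor_algebra ?S D)"
    unfolding \<Phi>_def by (rule alg_model_iso[OF H T])
  moreover have "\<Phi> ` HH_grade D n = tensor_grade ?S D (sym_grade u_dual) n" for n
  proof -
    have "sym_grade u_dual n = \<alpha> ` {r. \<forall>i. i \<noteq> n \<longrightarrow> coeff r i = 0}"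
      unfolding \<alpha>_def by (rule sym_grade_eq[OF line])
    then show ?thesis
      using HH_grade_eq[OF D two, of n] tensor_grade_eq[OF S D, of "sym_grade u_dual" n]
      by (simp add: image_image \<Phi> flip: \<eta>_def \<tau>_def)
  qed
  moreover have "\<Phi> (\<sigma>\<^sub>H s x) = tensor_act \<sigma>\<^sub>S \<sigma>\<^sub>D s (\<Phi> x)" if "s \<in> frob ` torus" and x: "x \<in> carrier (HH D)" for s x
  proof -
    obtain p where "x = \<eta> p" using x by (auto simp: alg_modelD[OF H])
    moreover have "tensor_act \<sigma>\<^sub>S \<sigma>\<^sub>D s (\<tau> p) = \<tau> (dp_poly_torus (weight s) p)"
      unfolding \<tau>_def using that(1) weight_nonzero
      by (intro tensor_act_eq[OF S D]) (auto simp: \<sigma>\<^sub>S_def \<sigma>\<^sub>D_def alg_modelD[OF S] alg_modelD[OF D])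
    ultimately show ?thesis
      by (simp add: \<sigma>\<^sub>H_def \<Phi> alg_modelD[OF H])
  qed
  ultimately show ?thesis by blast
qed

end

theorem theorem3p3p1:
  fixes T U B :: "'k::alg_closed_field mat2 set"
  assumes "CHAR('k) = 2"
    and "borel_triple T U B"
  defines "D \<equiv> Dist1 B"
    and "u_dual \<equiv> dual_space (Lie U)"
    and "coad \<equiv> dual_act (Lie U) (Ad U)"
  shows "\<exists>\<sigma>\<^sub>H \<sigma>\<^sub>S \<sigma>\<^sub>D \<Phi>.
    frob_descent T (HH D) (HH_act D (Ad B)) \<sigma>\<^sub>H \<and>
    frob_descent T (sym_algebra u_dual) (sym_act coad) \<sigma>\<^sub>S \<and>
    frob_descent T D (Ad B) \<sigma>\<^sub>D \<and>
    \<Phi> \<in> algebra_iso (HH D) (tensor_algebra (sym_algebra u_dual) D) \<and>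
    (\<forall>n. \<Phi> ` HH_grade D n = tensor_grade (sym_algebra u_dual) D (sym_grade u_dual) n) \<and>
    (\<forall>s\<in>frob ` T. \<forall>x\<in>carrier (HH D).
       \<Phi> (\<sigma>\<^sub>H s x) = tensor_act \<sigma>\<^sub>S \<sigma>\<^sub>D s (\<Phi> x))"
proof -
  obtain g where g: "g \<in> SL2" and TUB: "T = conj_by g ` diag_torus" "U = conj_by g ` lower_unipotent"
      "B = conj_by g ` lower_borel"
    using assms(2) by (auto simp: borel_triple_def)
  have det: "det g = 1" using g by (simp add: SL2_def)
  then have "invertible g" by (simp add: invertible_det_nz)
  then obtain h where h: "g ** h = mat 1" "h ** g = mat 1" by (auto simp: invertible_def)
  have "(2::'k) = 0"
    using of_nat_CHAR[where 'a = 'k] assms(1) by simp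
  then interpret conjugate_borel g h
    using h by unfold_locales
  show ?thesis
    unfolding D_def u_dual_def coad_def TUB groups_eq by (rule HH_Dist1_iso)
qed

end
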